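(* Let $2\le m<n$ be integers and let $E=K(n,m,\mathcal D)\in\mathcal M_{t,v,r}(n,m)$. Then $E\sim(\mathcal D^\infty,\lambda)$, where, writing an element of $\mathcal D^\infty$ as a pair $(\mathbf x,\mathbf y)$ with $\mathbf x=(x_k)_{k\ge1}$, $\mathbf y=(y_k)_{k\ge1}$ and $(x_k,y_k)\in\mathcal D$ for all $k$, $$\lambda\big((\mathbf x,\mathbf y),(\mathbf x',\mathbf y')\big)=\max\{d_{1/n}(\mathbf x,\mathbf x'),\,d_{1/m}(\mathbf y,\mathbf y')\}.$$
   Context: For $\mathcal D\subset\{0,\dots,n-1\}\times\{0,\dots,m-1\}$ and $d\in\mathcal D$ let $S_d(z)=\mathrm{diag}(n^{-1},m^{-1})(z+d)$ for $z\in\mathbb R^2$. $K(n,m,\mathcal D)$ denotes the unique non-empty compact set $E\subset\mathbb R^2$ with $E=\bigcup_{d\in\mathcal D}S_d(E)$ (a self-affine, or Bedford–McMullen, carpet); it carries the Euclidean metric. It is always assumed that $\#\mathcal D>1$. Put $a_j=\#\{i:(i,j)\in\mathcal D\}$ for $0\le j\le m-1$. Row $j$ is vacant if $a_j=0$. $E$ has uniform horizontal fibers if all non-zero $a_j$ are equal. $\mathcal M_{t,v,r}(n,m)$ is the class of carpets $K(n,m,\mathcal D)$ that are totally disconnected, possess at least one vacant row, and have uniform horizontal fibers. Two metric spaces $(X,d_X)$, $(Y,d_Y)$ are Lipschitz equivalent, written $X\sim Y$, if there are a bijection $f:X\to Y$ and a constant $C>0$ with $C^{-1}d_X(x,y)\le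 d_Y(f(x),f(y))\le C\,d_X(x,y)$ for all $x,y\in X$. For $\xi\in(0,1)$ and infinite integer sequences $\mathbf x,\mathbf x'$, $d_\xi(\mathbf x,\mathbf x')=\xi^{|\mathbf x\wedge\mathbf x'|}$, where $|\mathbf x\wedge\mathbf x'|$ is the length of the maximal common prefix of $\mathbf x$ and $\mathbf x'$ (and $d_\xi(\mathbf x,\mathbf x)=0$). *)

theory Defs
  imports "HOL-Analysis.Analysis"
begin

section \<open>Self-affine carpets\<close>

text \<open>The plane is \<open>real \<times> real\<close>, whose library metric \<open>dist\<close> is the Euclidean one
  (\<open>dist_Pair_Pair\<close>). A digit \<open>(i, j)\<close> has column \<open>i < n\<close> and row \<open>j < m\<close>.\<close>

definition digit_set :: "nat \<Rightarrow> nat \<Rightarrow> (nat \<times> nat) set \<Rightarrow> bool" where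
  "digit_set n m D \<longleftrightarrow> D \<subseteq> {0..<n} \<times> {0..<m} \<and> card D > 1"

definition carpet_map :: "nat \<Rightarrow> nat \<Rightarrow> nat \<times> nat \<Rightarrow> real \<times> real \<Rightarrow> real \<times> real" where
  "carpet_map n m d z =
     (inverse (real n) * (fst z + real (fst d)), inverse (real m) * (snd z + real (snd d)))"

definition is_carpet :: "nat \<Rightarrow> nat \<Rightarrow> (nat \<times> nat) set \<Rightarrow> (real \<times> real) set \<Rightarrow> bool" where
  "is_carpet n m D E \<longleftrightarrow> E \<noteq> {} \<and> compact E \<and> E = (\<Union>d\<in>D. carpet_map n m d ` E)"

text \<open>The definite description is justified by \<open>is_carpet_ex1\<close> below.\<close>

definition carpet :: "nat \<Rightarrow> nat \<Rightarrow> (nat \<times> nat) set \<Rightarrow> (real \<times> real) set" where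
  "carpet n m D = (THE E. is_carpet n m D E)"

definition row_count :: "(nat \<times> nat) set \<Rightarrow> nat \<Rightarrow> nat" where
  "row_count D j = card {i. (i, j) \<in> D}"

definition has_vacant_row :: "nat \<Rightarrow> (nat \<times> nat) set \<Rightarrow> bool" where
  "has_vacant_row m D \<longleftrightarrow> (\<exists>j<m. row_count D j = 0)"

definition uniform_horizontal_fibers :: "nat \<Rightarrow> (nat \<times> nat) set \<Rightarrow> bool" where
  "uniform_horizontal_fibers m D \<longleftrightarrow>
     (\<forall>j<m. \<forall>j'<m. row_count D j \<noteq> 0 \<longrightarrow> row_count D j' \<noteq> 0 \<longrightarrow> row_count D j = row_count D j')"

definition totally_disconnected :: "'a::topological_space set \<Rightarrow> bool" where
  "totally_disconnected S \<longleftrightarrow> (\<forall>x\<in>S. connected_component_set S x = {x})"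

text \<open>Membership of \<open>carpet n m D\<close> in the class \<open>\<M>\<^sub>t\<^sub>,\<^sub>v\<^sub>,\<^sub>r(n, m)\<close>. It is a predicate of
  the digit set, since vacancy of rows and uniformity of the fibers are read off from \<open>D\<close>.\<close>

definition carpet_tvr :: "nat \<Rightarrow> nat \<Rightarrow> (nat \<times> nat) set \<Rightarrow> bool" where
  "carpet_tvr n m D \<longleftrightarrow>
     digit_set n m D \<and> totally_disconnected (carpet n m D) \<and>
     has_vacant_row m D \<and> uniform_horizontal_fibers m D"


section \<open>Lipschitz equivalence\<close>

definition lipschitz_equivalent ::
    "'a set \<Rightarrow> ('a \<Rightarrow> 'a \<Rightarrow> real) \<Rightarrow> 'b set \<Rightarrow> ('b \<Rightarrow> 'b \<Rightarrow> real) \<Rightarrow> bool" where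
  "lipschitz_equivalent X dX Y dY \<longleftrightarrow>
     Metric_space X dX \<and> Metric_space Y dY \<and>
     (\<exists>f C. bij_betw f X Y \<and> C > 0 \<and>
        (\<forall>x\<in>X. \<forall>y\<in>X. inverse C * dX x y \<le> dY (f x) (f y) \<and> dY (f x) (f y) \<le> C * dX x y))"


section \<open>The symbolic space\<close>

text \<open>Sequences are indexed from \<open>0\<close>, so \<open>x k\<close> is the term \<open>x\<^sub>k\<^sub>+\<^sub>1\<close> of a sequence
  \<open>(x\<^sub>k)\<close>, \<open>k \<ge> 1\<close>. The length \<open>common_prefix x x'\<close> is meaningful only for \<open>x \<noteq> x'\<close>.\<close>

definition common_prefix :: "(nat \<Rightarrow> 'a) \<Rightarrow> (nat \<Rightarrow> 'a) \<Rightarrow> nat" where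
  "common_prefix x x' = (GREATEST k. \<forall>i<k. x i = x' i)"

definition seq_dist :: "real \<Rightarrow> (nat \<Rightarrow> 'a) \<Rightarrow> (nat \<Rightarrow> 'a) \<Rightarrow> real" where
  "seq_dist \<xi> x x' = (if x = x' then 0 else \<xi> ^ common_prefix x x')"

definition digit_sequences :: "('a \<times> 'b) set \<Rightarrow> ((nat \<Rightarrow> 'a) \<times> (nat \<Rightarrow> 'b)) set" where
  "digit_sequences D = {(x, y). \<forall>k. (x k, y k) \<in> D}"

definition carpet_seq_dist ::
    "nat \<Rightarrow> nat \<Rightarrow> (nat \<Rightarrow> 'a) \<times> (nat \<Rightarrow> 'b) \<Rightarrow> (nat \<Rightarrow> 'a) \<times> (nat \<Rightarrow> 'b) \<Rightarrow> real" where
  "carpet_seq_dist n m p q =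
     max (seq_dist (1 / real n) (fst p) (fst q)) (seq_dist (1 / real m) (snd p) (snd q))"


section \<open>Well-definedness\<close>

lemma common_prefix_props:
  assumes "x \<noteq> x'"
  shows common_prefix_eq_Least: "common_prefix x x' = (LEAST k. x k \<noteq> x' k)"
    and common_prefix_neq: "x (common_prefix x x') \<noteq> x' (common_prefix x x')"
    and common_prefix_agree: "\<And>i. i < common_prefix x x' \<Longrightarrow> x i = x' i"
proof -
  define l where "l = (LEAST k. x k \<noteq> x' k)"
  obtain k where "x k \<noteq> x' k" using assms by auto
  then have l: "x l \<noteq> x' l" unfolding l_def by (rule LeastI)
  have below: "x i = x' i" if "i < l" for i
    using not_less_Least that unfolding l_def by blast
  have eq: "common_prefix x x' = l" unfolding common_prefix_def
  proof (rule Greatest_equality)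
    show "\<forall>i<l. x i = x' i" using below by blast
    show "k \<le> l" if "\<forall>i<k. x i = x' i" for k using that l not_le by blast
  qed
  show "common_prefix x x' = (LEAST k. x k \<noteq> x' k)" using eq by (simp only: l_def)
  show "x (common_prefix x x') \<noteq> x' (common_prefix x x')" using l by (simp only: eq not_False_eq_True)
  show "x i = x' i" if "i < common_prefix x x'" for i using below that unfolding eq .
qed

lemma seq_dist_Metric_space:
  assumes "0 < \<xi>" "\<xi> < 1"
  shows "Metric_space UNIV (seq_dist \<xi>)"
proof
  fix x y z :: "nat \<Rightarrow> 'a"
  show "0 \<le> seq_dist \<xi> x y" using assms by (simp add: seq_dist_def)
  show "seq_dist \<xi> x y = seq_dist \<xi> y x"
    by (simp add: seq_dist_def common_prefix_def eq_commute)
  show "seq_dist \<xi> x y = 0 \<longleftrightarrow> x = y" using assms by (simp add: seq_dist_def)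
  show "seq_dist \<xi> x z \<le> seq_dist \<xi> x y + seq_dist \<xi> y z"
  proof (cases "x = y \<or> y = z \<or> x = z")
    case True
    then show ?thesis using assms by (auto simp: seq_dist_def)
  next
    case False
    then have ne: "x \<noteq> y" "y \<noteq> z" "x \<noteq> z" by auto
    have "common_prefix x y \<le> common_prefix x z \<or> common_prefix y z \<le> common_prefix x z"
      using common_prefix_neq[OF ne(3)] common_prefix_agree[OF ne(1)] common_prefix_agree[OF ne(2)]
      by (metis not_le)
    then have "\<xi> ^ common_prefix x z \<le> \<xi> ^ common_prefix x y \<or>
               \<xi> ^ common_prefix x z \<le> \<xi> ^ common_prefix y z"
      using assms by (auto intro: power_decreasing)
    moreover have "0 < \<xi> ^ common_prefix x y" "0 < \<xi> ^ common_prefix y z" using assms by auto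
    ultimately show ?thesis using ne by (auto simp: seq_dist_def)
  qed
qed

lemma carpet_seq_dist_Metric_space:
  assumes "2 \<le> m" "2 \<le> n"
  shows "Metric_space X (carpet_seq_dist n m)"
proof -
  interpret a: Metric_space UNIV "seq_dist (1 / real n) :: (nat \<Rightarrow> 'a) \<Rightarrow> _"
    using assms by (intro seq_dist_Metric_space) auto
  interpret b: Metric_space UNIV "seq_dist (1 / real m) :: (nat \<Rightarrow> 'b) \<Rightarrow> _"
    using assms by (intro seq_dist_Metric_space) auto
  show ?thesis
  proof
    fix p q r :: "(nat \<Rightarrow> 'a) \<times> (nat \<Rightarrow> 'b)"
    show "0 \<le> carpet_seq_dist n m p q" by (simp add: carpet_seq_dist_def le_max_iff_disj)
    show "carpet_seq_dist n m p q = carpet_seq_dist n m q p"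
      by (simp add: carpet_seq_dist_def a.commute b.commute)
    show "carpet_seq_dist n m p q = 0 \<longleftrightarrow> p = q"
      using a.nonneg[of "fst p" "fst q"] b.nonneg[of "snd p" "snd q"]
        a.zero[of "fst p" "fst q"] b.zero[of "snd p" "snd q"]
      unfolding carpet_seq_dist_def prod_eq_iff max_def by (smt (verit) UNIV_I)
    show "carpet_seq_dist n m p r \<le> carpet_seq_dist n m p q + carpet_seq_dist n m q r"
      using a.triangle[of "fst p" "fst q" "fst r"] b.triangle[of "snd p" "snd q" "snd r"]
      unfolding carpet_seq_dist_def by auto
  qed
qed

lemma carpet_map_contraction:
  assumes "2 \<le> n" "2 \<le> m"
  shows "dist (carpet_map n m d p) (carpet_map n m d q) \<le> dist p q / 2"
proof -
  have c: "(inverse (real k) * u)\<^sup>2 \<le> u\<^sup>2 / 4" if "2 \<le> k" for k :: nat and u :: real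
  proof -
    have "inverse (real k) \<le> 1 / 2" using that by (simp add: field_simps)
    then have "(inverse (real k))\<^sup>2 \<le> (1 / 2)\<^sup>2" by (intro power_mono) auto
    then have "(inverse (real k))\<^sup>2 * u\<^sup>2 \<le> (1 / 2)\<^sup>2 * u\<^sup>2" by (intro mult_right_mono) auto
    then show ?thesis by (simp add: power_mult_distrib power_divide)
  qed
  have "(dist (carpet_map n m d p) (carpet_map n m d q))\<^sup>2 =
        (inverse (real n) * (fst p - fst q))\<^sup>2 + (inverse (real m) * (snd p - snd q))\<^sup>2"
    by (simp add: carpet_map_def dist_Pair_Pair dist_real_def right_diff_distrib distrib_left)
  also have "\<dots> \<le> (fst p - fst q)\<^sup>2 / 4 + (snd p - snd q)\<^sup>2 / 4"
    using c assms by (intro add_mono) auto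
  also have "\<dots> = (dist p q / 2)\<^sup>2"
    by (simp add: dist_prod_def dist_real_def power_divide)
  finally show ?thesis by (rule power2_le_imp_le) simp
qed

lemma is_carpet_subset:
  assumes nm: "2 \<le> n" "2 \<le> m" and A: "is_carpet n m D A" and B: "is_carpet n m D B"
  shows "A \<subseteq> B"
proof -
  have cA: "compact A" "A \<noteq> {}" and cB: "compact B" "B \<noteq> {}"
    and eA: "A = (\<Union>d\<in>D. carpet_map n m d ` A)" and eB: "B = (\<Union>d\<in>D. carpet_map n m d ` B)"
    using A B unfolding is_carpet_def by blast+
  have "continuous_on A (\<lambda>x. infdist x B)" by (intro continuous_intros)
  then obtain x where x: "x \<in> A" "\<And>y. y \<in> A \<Longrightarrow> infdist y B \<le> infdist x B"
    using continuous_attains_sup[OF cA] by blast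
  obtain d y where dy: "d \<in> D" "y \<in> A" "x = carpet_map n m d y" using x(1) by (subst (asm) eA) blast
  obtain b where b: "b \<in> B" "infdist y B = dist y b"
    using infdist_attains_inf[OF compact_imp_closed[OF cB(1)] cB(2)] by blast
  have "carpet_map n m d b \<in> B" by (subst eB) (use b dy in blast)
  then have "infdist x B \<le> dist x (carpet_map n m d b)" by (rule infdist_le)
  also have "\<dots> \<le> dist y b / 2" unfolding dy(3) by (rule carpet_map_contraction[OF nm])
  also have "\<dots> \<le> infdist x B / 2" using x(2)[OF dy(2)] b by simp
  finally have "infdist x B \<le> 0" by simp
  then have "infdist z B = 0" if "z \<in> A" for z
    using x(2)[OF that] infdist_nonneg[of z B] by linarith
  then show ?thesis
    using in_closed_iff_infdist_zero[OF compact_imp_closed[OF cB(1)] cB(2)] by blast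
qed

lemma is_carpet_ex:
  assumes nm: "2 \<le> n" "2 \<le> m" and D: "digit_set n m D"
  shows "\<exists>E. is_carpet n m D E"
proof -
  define F where "F A = (\<Union>d\<in>D. carpet_map n m d ` A)" for A
  define Q where "Q = ({0..1} \<times> {0..1} :: (real \<times> real) set)"
  define T where "T k = (F ^^ k) Q" for k
  have sub: "D \<subseteq> {0..<n} \<times> {0..<m}" using D by (simp add: digit_set_def)
  then have fin: "finite D" by (rule finite_subset) simp
  have ne: "D \<noteq> {}" using D by (auto simp: digit_set_def)
  have TS: "T (Suc k) = F (T k)" for k by (simp add: T_def)
  have mono: "F A \<subseteq> F B" if "A \<subseteq> B" for A B using that by (auto simp: F_def)
  have unit: "0 \<le> inverse (real k) * (u + real i) \<and> inverse (real k) * (u + real i) \<le> 1"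
    if "0 \<le> u" "u \<le> 1" "i < k" for k i :: nat and u :: real
  proof -
    have "real i + 1 \<le> real k" using that(3) by linarith
    then show ?thesis using that by (auto simp: field_simps)
  qed
  have "F Q \<subseteq> Q"
  proof
    fix z assume "z \<in> F Q"
    then obtain d w where "d \<in> D" "w \<in> Q" "z = carpet_map n m d w" by (auto simp: F_def)
    moreover from this sub have "fst d < n" "snd d < m" by auto
    ultimately show "z \<in> Q" by (auto simp: Q_def carpet_map_def intro: unit[THEN conjunct1] unit[THEN conjunct2])
  qed
  then have "T (Suc k) \<subseteq> T k" for k
    by (induction k) (auto simp: T_def dest: mono)
  then have dec: "T l \<subseteq> T k" if "k \<le> l" for k l
    using that by (rule lift_Suc_antimono_le)
  have cont: "continuous_on A (carpet_map n m d)" for A d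
    unfolding carpet_map_def[abs_def] by (intro continuous_intros)
  have T: "compact (T k) \<and> T k \<noteq> {}" for k
  proof (induction k)
    case 0
    show ?case by (auto simp: T_def Q_def intro: compact_Times)
  next
    case (Suc k)
    then show ?case unfolding TS F_def using ne fin
      by (auto intro!: compact_UN compact_continuous_image cont)
  qed
  define E where "E = (\<Inter>k. T k)"
  have "E \<noteq> {}" unfolding E_def
    using T dec by (intro compact_nest) auto
  moreover have "compact E" unfolding E_def
    using T by (intro compact_Inter) auto
  moreover have "F E \<subseteq> E"
  proof -
    have "F E \<subseteq> T k" for k
    proof -
      have "F E \<subseteq> F (T k)" by (rule mono) (auto simp: E_def)
      then show ?thesis using dec[of k "Suc k"] TS by auto
    qed
    then show ?thesis by (auto simp: E_def)
  qed
  moreover have "E \<subseteq> F E"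
  proof
    fix z assume "z \<in> E"
    then have "z \<in> F (T k)" for k using TS by (auto simp: E_def)
    then have "\<forall>k. \<exists>d. d \<in> D \<and> z \<in> carpet_map n m d ` T k" unfolding F_def by blast
    then obtain g where g: "\<And>k. g k \<in> D" "\<And>k. z \<in> carpet_map n m (g k) ` T k" by metis
    have "finite (range g)" using fin g(1) by (auto intro: finite_subset)
    then obtain k0 where inf: "infinite {k. g k = g k0}"
      using pigeonhole_infinite[of UNIV g] by auto
    have inj: "inj (carpet_map n m (g k0))"
      using nm by (auto simp: inj_def carpet_map_def prod_eq_iff)
    obtain w where w: "z = carpet_map n m (g k0) w" using g(2)[of k0] by auto
    have "w \<in> T k" for k
    proof -
      obtain l where "l \<ge> k" "g l = g k0"
        using inf by (metis (mono_tags, lifting) infinite_nat_iff_unbounded_le mem_Collect_eq)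
      then have "z \<in> carpet_map n m (g k0) ` T k" using g(2)[of l] dec by auto
      then show ?thesis using w inj by (auto dest: injD)
    qed
    then show "z \<in> F E" using w g(1) by (auto simp: F_def E_def)
  qed
  ultimately have "is_carpet n m D E" unfolding is_carpet_def F_def[symmetric] by blast
  then show ?thesis ..
qed

lemma is_carpet_ex1:
  assumes "2 \<le> n" "2 \<le> m" "digit_set n m D"
  shows "\<exists>!E. is_carpet n m D E"
  using is_carpet_ex[OF assms] is_carpet_subset[OF assms(1,2)] by (metis subset_antisym)

lemma carpet_is_carpet:
  assumes "2 \<le> n" "2 \<le> m" "digit_set n m D"
  shows "is_carpet n m D (carpet n m D)"
  unfolding carpet_def by (rule theI') (rule is_carpet_ex1[OF assms])

end

theory Submission
  imports Defs
begin

text \<open>Let \<open>N\<close> be the number of non-vacant rows and \<open>a\<close> the common number of digits in these rows. A full row would produce a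
  horizontal segment in \<open>E\<close>, so total disconnectedness gives \<open>a < n\<close>. Points of \<open>E\<close> and points of the symbolic space are
  both coded by pairs of sequences over \<open>a\<close> and \<open>N\<close> symbols, the ranks of digits and of rows. Prefixes of
  suitable lengths form a tree of cells, all vertices of one level having equally many children, in which a cell of
  level \<open>t\<close> has diameter about \<open>\<theta> ^ t\<close>. In the symbolic space distinct cells of level \<open>t\<close> are also separated by about
  \<open>\<theta> ^ t\<close>, so that the tree determines the metric up to a constant. In \<open>E\<close>, however, cells may touch each other, and
  different codes may even name the same point. Two ideas overcome this.

  The first one is a shifted coding (\<open>decode\<close>). There is a vacant row, and by \<open>a < n\<close> there is a vacant digit in
  every row. Each cylinder is cut at the vacant digit of the next level, and its upper part is glued to the lower part of the
  next cylinder. The resulting pieces again form a homogeneous tree, but now two pieces can be close only if a carry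
  runs over two consecutive digits. Two suitably chosen last symbols exclude this in any surrounding
  (\<open>isolated_code\<close>). Therefore every cell has many isolated descendants.

  The second one is a rearrangement of the tree (\<open>ex_rearrangement\<close>). Cells of level \<open>t\<close> that are connected by a
  chain of close cells form a cluster. Clusters have a bounded number of cells (\<open>card_cluster_le\<close>): a chain cannot
  pass a vacant row, and among the remaining few rows a count shows that there are vacant columns, which it
  cannot pass either. Suppose that a cluster of \<open>b\<close> cells has been assigned \<open>b\<close> cells of the symbolic tree. Its
  children fall into clusters of bounded size, and many of them are isolated. Hence these clusters can be distributed over the
  \<open>b\<close> given cells so that no cluster is split and every cell gets exactly its number of children
  (\<open>pack_blocks\<close>). Repeating this in every level moves every cluster into a single symbolic cell of the previous level while
  distinct clusters stay disjoint. In the limit this gives a bijection that distorts distances by a bounded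
  factor only.\<close>

section \<open>Packing blocks into bins\<close>

lemma sum_loads:
  fixes s :: "'b \<Rightarrow> nat"
  assumes "finite X" "finite W" "p ` X \<subseteq> W"
  shows "(\<Sum>w\<in>W. sum s {x\<in>X. p x = w}) = sum s X"
  using sum.group[OF assms] .

text \<open>Blocks are placed one after the other. As long as the total weight is at most
  \<open>card W * (Q - B)\<close>, some bin carries at most \<open>Q - B\<close> by averaging, and has room for one more block.\<close>

lemma pack_large_blocks:
  fixes s :: "'b \<Rightarrow> nat"
  assumes "finite X" "finite W" "W \<noteq> {}" "\<And>x. x \<in> X \<Longrightarrow> s x \<le> B"
    and "sum s X + card W * B \<le> card W * Q"
  shows "\<exists>p. p ` X \<subseteq> W \<and> (\<forall>w\<in>W. sum s {x\<in>X. p x = w} \<le> Q)"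
  using assms(1,4,5)
proof (induction X rule: finite_induct)
  case empty
  then show ?case by auto
next
  case (insert b X)
  then obtain p where p: "p ` X \<subseteq> W" "\<And>w. w \<in> W \<Longrightarrow> sum s {x\<in>X. p x = w} \<le> Q" by auto
  have "\<exists>w\<in>W. sum s {x\<in>X. p x = w} + s b \<le> Q"
  proof (rule ccontr)
    assume "\<not> ?thesis"
    then have "Q < sum s {x\<in>X. p x = w} + B" if "w \<in> W" for w
      using that insert.prems(1)[of b] by fastforce
    then have "(\<Sum>w\<in>W. Q) < (\<Sum>w\<in>W. sum s {x\<in>X. p x = w} + B)"
      using assms(2,3) by (intro sum_strict_mono) auto
    also have "\<dots> = sum s X + card W * B"
      using sum_loads[OF insert.hyps(1) assms(2) p(1)] by (simp add: sum.distrib)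
    finally show False using insert by simp
  qed
  then obtain w0 where w0: "w0 \<in> W" "sum s {x\<in>X. p x = w0} + s b \<le> Q" by auto
  have "sum s {x\<in>insert b X. (p(b := w0)) x = w} \<le> Q" if "w \<in> W" for w
  proof (cases "w = w0")
    case True
    have "{x\<in>insert b X. (p(b := w0)) x = w} = insert b {x\<in>X. p x = w0}"
      using True insert.hyps by auto
    then show ?thesis using insert.hyps w0 by simp
  next
    case False
    then have "{x\<in>insert b X. (p(b := w0)) x = w} = {x\<in>X. p x = w}"
      using insert.hyps by auto
    then show ?thesis using p(2)[OF that] by simp
  qed
  moreover have "(p(b := w0)) ` insert b X \<subseteq> W" using p(1) w0(1) by auto
  ultimately show ?case by blast
qed

lemma ex_map_with_fibre_cards:
  assumes "finite W" "finite Y" "card Y = sum c W"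
  shows "\<exists>p. p ` Y \<subseteq> W \<and> (\<forall>w\<in>W. card {y\<in>Y. p y = w} = c w)"
  using assms
proof (induction W arbitrary: Y rule: finite_induct)
  case empty
  then show ?case by simp
next
  case (insert w W)
  have "c w \<le> card Y" using insert by simp
  then obtain Z where Z: "Z \<subseteq> Y" "card Z = c w" by (meson obtain_subset_with_card_n)
  have "card (Y - Z) = sum c W"
    using insert Z by (simp add: card_Diff_subset finite_subset)
  then obtain p where p: "p ` (Y - Z) \<subseteq> W" "\<And>v. v \<in> W \<Longrightarrow> card {y\<in>Y - Z. p y = v} = c v"
    using insert.IH[of "Y - Z"] insert.prems by auto
  define q where "q y = (if y \<in> Z then w else p y)" for y
  have "{y\<in>Y. q y = w} = Z" using Z p(1) insert.hyps by (auto simp: q_def)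
  moreover have "{y\<in>Y. q y = v} = {y\<in>Y - Z. p y = v}" if "v \<in> W" for v
    using that insert.hyps by (auto simp: q_def)
  moreover have "q ` Y \<subseteq> insert w W" using p(1) by (auto simp: q_def)
  ultimately show ?case using Z p(2) by (intro exI[of _ q]) auto
qed

text \<open>The blocks of weight one serve as small change: the larger blocks are placed first,
  and the units then fill every bin up to exactly \<open>Q\<close>. Exact filling is what makes it possible to match
  a tree whose branching numbers are prescribed.\<close>

lemma pack_blocks:
  fixes s :: "'b \<Rightarrow> nat"
  assumes X: "finite X" and W: "finite W" "W \<noteq> {}"
    and s: "\<And>x. x \<in> X \<Longrightarrow> s x \<le> B"
    and total: "sum s X = card W * Q"
    and units: "card W * B \<le> card {x\<in>X. s x = 1}"
  shows "\<exists>p. p ` X \<subseteq> W \<and> (\<forall>w\<in>W. sum s {x\<in>X. p x = w} = Q)"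
proof -
  define U where "U = {x\<in>X. s x = 1}"
  define V where "V = X - U"
  have fin: "finite U" "finite V" using X by (auto simp: U_def V_def)
  have split: "sum s X = sum s V + card U"
  proof -
    have "sum s X = sum s V + sum s U"
      unfolding V_def by (rule sum.subset_diff) (auto simp: U_def X)
    then show ?thesis by (simp add: U_def)
  qed
  have "\<exists>p. p ` V \<subseteq> W \<and> (\<forall>w\<in>W. sum s {x\<in>V. p x = w} \<le> Q)"
    using split units total s
    by (intro pack_large_blocks[OF fin(2) W, of s B]) (auto simp: V_def U_def)
  then obtain p where p: "p ` V \<subseteq> W" "\<And>w. w \<in> W \<Longrightarrow> sum s {x\<in>V. p x = w} \<le> Q" by auto
  have "(\<Sum>w\<in>W. Q - sum s {x\<in>V. p x = w}) = (\<Sum>w\<in>W. Q) - (\<Sum>w\<in>W. sum s {x\<in>V. p x = w})"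
    by (rule sum_subtractf_nat) (use p in auto)
  then have "card U = (\<Sum>w\<in>W. Q - sum s {x\<in>V. p x = w})"
    using sum_loads[OF fin(2) W(1) p(1), of s] split total by simp
  from ex_map_with_fibre_cards[OF W(1) fin(1) this]
  obtain q where q: "q ` U \<subseteq> W"
      "\<And>w. w \<in> W \<Longrightarrow> card {x\<in>U. q x = w} = Q - sum s {x\<in>V. p x = w}" by auto
  define r where "r x = (if x \<in> U then q x else p x)" for x
  have "sum s {x\<in>X. r x = w} = Q" if w: "w \<in> W" for w
  proof -
    have "{x\<in>X. r x = w} = {x\<in>V. p x = w} \<union> {x\<in>U. q x = w}"
      by (auto simp: r_def V_def U_def)
    moreover have "{x\<in>V. p x = w} \<inter> {x\<in>U. q x = w} = {}" by (auto simp: V_def)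
    ultimately have "sum s {x\<in>X. r x = w} = sum s {x\<in>V. p x = w} + sum s {x\<in>U. q x = w}"
      using fin by (simp add: sum.union_disjoint)
    also have "sum s {x\<in>U. q x = w} = card {x\<in>U. q x = w}" by (simp add: U_def)
    finally show ?thesis using q(2)[OF w] p(2)[OF w] by simp
  qed
  moreover have "r ` X \<subseteq> W" using p(1) q(1) by (auto simp: r_def V_def)
  ultimately show ?thesis by blast
qed

section \<open>Rearranging a homogeneous tree of cells\<close>

text \<open>A compact set \<open>\<pi> ` \<Omega>\<close> is coded by the branches of a tree in which all vertices of one level have the same
  number of children. The label \<open>lab t \<omega>\<close> names the cell of level \<open>t\<close> that contains the code \<open>\<omega>\<close>; the coding map \<open>\<pi>\<close>
  may identify codes of different cells, and \<open>\<epsilon> t\<close> is the distance below which two cells of level \<open>t\<close> count as close.\<close>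

locale cell_tree =
  fixes \<Omega> :: "'w set" and lab :: "nat \<Rightarrow> 'w \<Rightarrow> 'l" and \<pi> :: "'w \<Rightarrow> 'm::metric_space"
    and \<epsilon> :: "nat \<Rightarrow> real" and Q :: "nat \<Rightarrow> nat"
  assumes nonempty: "\<Omega> \<noteq> {}"
    and root: "\<lbrakk>\<omega> \<in> \<Omega>; \<omega>' \<in> \<Omega>\<rbrakk> \<Longrightarrow> lab 0 \<omega> = lab 0 \<omega>'"
    and refine: "\<lbrakk>\<omega> \<in> \<Omega>; \<omega>' \<in> \<Omega>; lab (Suc t) \<omega> = lab (Suc t) \<omega>'\<rbrakk> \<Longrightarrow> lab t \<omega> = lab t \<omega>'"
    and branch_finite: "\<omega> \<in> \<Omega> \<Longrightarrow> finite (lab (Suc t) ` {\<omega>'\<in>\<Omega>. lab t \<omega>' = lab t \<omega>})"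
    and branch_card: "\<omega> \<in> \<Omega> \<Longrightarrow> card (lab (Suc t) ` {\<omega>'\<in>\<Omega>. lab t \<omega>' = lab t \<omega>}) = Q t"
    and complete: "\<lbrakk>\<And>t. w t \<in> \<Omega>; \<And>t. lab t (w (Suc t)) = lab t (w t)\<rbrakk>
                   \<Longrightarrow> \<exists>\<omega>\<in>\<Omega>. \<forall>t. lab t \<omega> = lab t (w t)"
    and separating: "\<lbrakk>\<omega> \<in> \<Omega>; \<omega>' \<in> \<Omega>; \<And>t. lab t \<omega> = lab t \<omega>'\<rbrakk> \<Longrightarrow> \<omega> = \<omega>'"
    and scale_pos: "0 < \<epsilon> t"
    and scale_antimono: "\<epsilon> (Suc t) \<le> \<epsilon> t"
    and compact_image: "compact (\<pi> ` \<Omega>)"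
begin

definition cells :: "nat \<Rightarrow> 'l set" where
  "cells t = lab t ` \<Omega>"

definition near :: "nat \<Rightarrow> 'w \<Rightarrow> 'w \<Rightarrow> bool" where
  "near t \<omega> \<omega>' \<longleftrightarrow> \<omega> \<in> \<Omega> \<and> \<omega>' \<in> \<Omega> \<and> (lab t \<omega> = lab t \<omega>' \<or> dist (\<pi> \<omega>) (\<pi> \<omega>') < \<epsilon> t)"

text \<open>Points with unlinked codes are at least \<open>\<epsilon> t\<close> apart, whatever the cells of level \<open>t\<close> look like. This is why
  the clusters, and not the cells, are the pieces of the set that can be moved independently.\<close>

definition linked :: "nat \<Rightarrow> 'w \<Rightarrow> 'w \<Rightarrow> bool" where
  "linked t = (near t)\<^sup>*\<^sup>*"

definition cluster :: "nat \<Rightarrow> 'l \<Rightarrow> 'l set" where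
  "cluster t l = lab t ` {\<omega>'\<in>\<Omega>. \<exists>\<omega>\<in>\<Omega>. lab t \<omega> = l \<and> linked t \<omega> \<omega>'}"

definition isolated :: "nat \<Rightarrow> 'l \<Rightarrow> bool" where
  "isolated t l \<longleftrightarrow> (\<forall>\<omega>\<in>\<Omega>. \<forall>\<omega>'\<in>\<Omega>. lab t \<omega> = l \<longrightarrow> dist (\<pi> \<omega>) (\<pi> \<omega>') < \<epsilon> t \<longrightarrow> lab t \<omega>' = l)"

definition parent :: "nat \<Rightarrow> 'l \<Rightarrow> 'l" where
  "parent t l = lab t (SOME \<omega>. \<omega> \<in> \<Omega> \<and> lab (Suc t) \<omega> = l)"

lemma parent_lab: "\<omega> \<in> \<Omega> \<Longrightarrow> parent t (lab (Suc t) \<omega>) = lab t \<omega>"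
  unfolding parent_def
  by (rule someI2[where a = \<omega>]) (auto dest: refine)

lemma lab_in_cells [simp]: "\<omega> \<in> \<Omega> \<Longrightarrow> lab t \<omega> \<in> cells t"
  by (simp add: cells_def)

lemma parent_in_cells: "l \<in> cells (Suc t) \<Longrightarrow> parent t l \<in> cells t"
  by (auto simp: cells_def parent_lab)

lemma children_eq:
  assumes "\<omega> \<in> \<Omega>"
  shows "{l\<in>cells (Suc t). parent t l = lab t \<omega>} = lab (Suc t) ` {\<omega>'\<in>\<Omega>. lab t \<omega>' = lab t \<omega>}"
  by (auto simp: cells_def parent_lab)

lemma card_children: "l \<in> cells t \<Longrightarrow> card {l'\<in>cells (Suc t). parent t l' = l} = Q t"
  by (subst (asm) cells_def, erule imageE, simp add: children_eq branch_card)

lemma finite_children: "l \<in> cells t \<Longrightarrow> finite {l'\<in>cells (Suc t). parent t l' = l}"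
  by (subst (asm) cells_def, erule imageE, simp add: children_eq branch_finite)

lemma finite_cells: "finite (cells t)"
proof (induction t)
  case 0
  obtain \<omega> where "\<omega> \<in> \<Omega>" using nonempty by auto
  then have "cells 0 \<subseteq> {lab 0 \<omega>}" unfolding cells_def using root by blast
  then show ?case by (rule finite_subset) simp
next
  case (Suc t)
  have "cells (Suc t) = (\<Union>l\<in>cells t. {l'\<in>cells (Suc t). parent t l' = l})"
    using parent_in_cells by auto
  then show ?case using Suc finite_children by (metis (no_types, lifting) finite_UN)
qed

lemma linked_refl [simp]: "linked t \<omega> \<omega>"
  by (simp add: linked_def)

lemma linked_trans: "linked t \<omega> \<omega>' \<Longrightarrow> linked t \<omega>' \<omega>'' \<Longrightarrow> linked t \<omega> \<omega>''"
  by (simp add: linked_def)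

lemma linked_sym: "linked t \<omega> \<omega>' \<Longrightarrow> linked t \<omega>' \<omega>"
proof -
  have "symp (near t)" by (auto simp: symp_def near_def dist_commute)
  then have "symp (linked t)" unfolding linked_def by (rule symp_rtranclp)
  then show "linked t \<omega> \<omega>' \<Longrightarrow> linked t \<omega>' \<omega>" by (rule sympD)
qed

lemma near_imp_linked: "near t \<omega> \<omega>' \<Longrightarrow> linked t \<omega> \<omega>'"
  by (auto simp: linked_def)

lemma same_lab_linked: "\<lbrakk>\<omega> \<in> \<Omega>; \<omega>' \<in> \<Omega>; lab t \<omega> = lab t \<omega>'\<rbrakk> \<Longrightarrow> linked t \<omega> \<omega>'"
  by (auto simp: linked_def near_def)

lemma linked_mono: "linked (Suc t) \<omega> \<omega>' \<Longrightarrow> linked t \<omega> \<omega>'"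
proof -
  have "near t \<alpha> \<beta>" if "near (Suc t) \<alpha> \<beta>" for \<alpha> \<beta>
    using that scale_antimono[of t] refine[of \<alpha> \<beta> t] unfolding near_def by linarith
  then have "near (Suc t) \<le> near t" by blast
  then show "linked (Suc t) \<omega> \<omega>' \<Longrightarrow> linked t \<omega> \<omega>'"
    unfolding linked_def using rtranclp_mono by blast
qed

lemma cluster_lab:
  assumes "\<omega> \<in> \<Omega>"
  shows "cluster t (lab t \<omega>) = lab t ` {\<omega>'\<in>\<Omega>. linked t \<omega> \<omega>'}"
proof -
  have "linked t \<omega> \<omega>'" if "\<omega>'' \<in> \<Omega>" "lab t \<omega>'' = lab t \<omega>" "linked t \<omega>'' \<omega>'" for \<omega>' \<omega>''
    using same_lab_linked[OF assms that(1)] that linked_trans by metis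
  then show ?thesis using assms unfolding cluster_def by auto
qed

lemma lab_in_cluster_iff:
  assumes "\<omega> \<in> \<Omega>" "\<omega>' \<in> \<Omega>"
  shows "lab t \<omega>' \<in> cluster t (lab t \<omega>) \<longleftrightarrow> linked t \<omega> \<omega>'"
proof
  assume "lab t \<omega>' \<in> cluster t (lab t \<omega>)"
  then obtain \<omega>'' where "\<omega>'' \<in> \<Omega>" "linked t \<omega> \<omega>''" "lab t \<omega>' = lab t \<omega>''"
    unfolding cluster_lab[OF assms(1)] by auto
  then show "linked t \<omega> \<omega>'" using same_lab_linked[of \<omega>'' \<omega>'] assms linked_trans by metis
qed (use assms in \<open>auto simp: cluster_lab\<close>)

lemma cluster_eqI: "\<lbrakk>\<omega> \<in> \<Omega>; \<omega>' \<in> \<Omega>; linked t \<omega> \<omega>'\<rbrakk> \<Longrightarrow> cluster t (lab t \<omega>) = cluster t (lab t \<omega>')"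
proof -
  assume *: "\<omega> \<in> \<Omega>" "\<omega>' \<in> \<Omega>" "linked t \<omega> \<omega>'"
  have "linked t \<omega> \<alpha> \<longleftrightarrow> linked t \<omega>' \<alpha>" for \<alpha>
    using *(3) linked_trans linked_sym by blast
  then show "cluster t (lab t \<omega>) = cluster t (lab t \<omega>')" using * by (simp add: cluster_lab)
qed

lemma cluster_self: "l \<in> cells t \<Longrightarrow> l \<in> cluster t l"
  by (auto simp: cells_def lab_in_cluster_iff)

lemma cluster_subset: "cluster t l \<subseteq> cells t"
  by (auto simp: cluster_def)

lemma cluster_eq_iff:
  assumes "l \<in> cells t" "l' \<in> cells t"
  shows "l' \<in> cluster t l \<longleftrightarrow> cluster t l' = cluster t l"
proof
  assume *: "l' \<in> cluster t l"
  obtain \<omega> \<omega>' where "\<omega> \<in> \<Omega>" "\<omega>' \<in> \<Omega>" "l = lab t \<omega>" "l' = lab t \<omega>'"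
    using assms by (auto simp: cells_def)
  then show "cluster t l' = cluster t l"
    using * cluster_eqI by (metis lab_in_cluster_iff)
qed (use assms cluster_self in blast)

lemma parent_cluster:
  assumes "l \<in> cells (Suc t)" "l' \<in> cluster (Suc t) l"
  shows "parent t l' \<in> cluster t (parent t l)"
proof -
  obtain \<omega> where \<omega>: "\<omega> \<in> \<Omega>" "l = lab (Suc t) \<omega>" using assms by (auto simp: cells_def)
  then obtain \<omega>' where "\<omega>' \<in> \<Omega>" "l' = lab (Suc t) \<omega>'" "linked (Suc t) \<omega> \<omega>'"
    using assms by (auto simp: cluster_lab)
  then show ?thesis using \<omega> by (simp add: parent_lab lab_in_cluster_iff linked_mono)
qed

lemma isolated_cluster:
  assumes "l \<in> cells t" "isolated t l"
  shows "cluster t l = {l}"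
proof -
  obtain \<omega> where \<omega>: "\<omega> \<in> \<Omega>" "l = lab t \<omega>" using assms by (auto simp: cells_def)
  have "\<omega>' \<in> \<Omega> \<and> lab t \<omega>' = l" if "linked t \<omega> \<omega>'" for \<omega>'
    using that unfolding linked_def
  proof (induction rule: rtranclp_induct)
    case base
    then show ?case using \<omega> by simp
  next
    case (step y z)
    then show ?case using assms(2) unfolding near_def isolated_def by auto
  qed
  then have "cluster t l \<subseteq> {l}" unfolding \<omega>(2) cluster_lab[OF \<omega>(1)] by blast
  then show ?thesis using cluster_self[OF assms(1)] by blast
qed

end

text \<open>This turns an assignment of parents to cells into a permutation of the cells.\<close>

lemma ex_bij_over:
  assumes "finite X" "\<And>x. x \<in> X \<Longrightarrow> f x \<in> Y" "\<And>x. x \<in> X \<Longrightarrow> g x \<in> Y"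
    and "\<And>y. y \<in> Y \<Longrightarrow> card {x\<in>X. f x = y} = card {x\<in>X. g x = y}"
  shows "\<exists>h. bij_betw h X X \<and> (\<forall>x\<in>X. g (h x) = f x)"
proof -
  have "\<exists>h. bij_betw h {x\<in>X. f x = y} {x\<in>X. g x = y}" if "y \<in> Y" for y
    using assms(1) assms(4)[OF that] by (intro finite_same_card_bij) auto
  then obtain h where h: "\<And>y. y \<in> Y \<Longrightarrow> bij_betw (h y) {x\<in>X. f x = y} {x\<in>X. g x = y}" by metis
  define k where "k x = h (f x) x" for x
  have k: "k x \<in> X \<and> g (k x) = f x" if "x \<in> X" for x
    using h[of "f x"] that assms(2) by (force simp: k_def bij_betw_def)
  have inj: "inj_on k X"
  proof (rule inj_onI)
    fix x y assume xy: "x \<in> X" "y \<in> X" "k x = k y"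
    then have "f x = f y" using k by metis
    then show "x = y" using xy h[of "f x"] assms(2) by (auto simp: k_def bij_betw_def inj_on_def)
  qed
  have "k ` X = X" using k inj assms(1) by (intro endo_inj_surj) auto
  then show ?thesis using k inj by (auto simp: bij_betw_def)
qed

text \<open>The same number \<open>B\<close> bounds the size of a cluster and, from below, the number of isolated children of a cell.
  So a cluster of \<open>b\<close> cells has at least \<open>b * B\<close> isolated children, which is the supply of units that
  \<open>pack_blocks\<close> asks for.\<close>

locale clustered_cell_tree = cell_tree +
  fixes B :: nat
  assumes cluster_card: "l \<in> cells t \<Longrightarrow> card (cluster t l) \<le> B"
    and many_isolated:
      "l \<in> cells t \<Longrightarrow> B \<le> card {l'\<in>cells (Suc t). parent t l' = l \<and> isolated (Suc t) l'}"
begin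

text \<open>One step of the construction. The permutation \<open>G\<close> has placed the cells of level \<open>t\<close>, and \<open>p l\<close> is to be the
  parent of the new place of the cell \<open>l\<close> of level \<open>t + 1\<close>. Each cluster \<open>T\<close> of level \<open>t\<close> poses a separate packing
  problem: the bins are the cells in \<open>G ` T\<close>, the blocks are the clusters of level \<open>t + 1\<close> below \<open>T\<close>, and a bin
  has to receive as many cells as it has children.\<close>

lemma ex_assignment:
  assumes G: "bij_betw G (cells t) (cells t)"
  shows "\<exists>p. (\<forall>l\<in>cells (Suc t). \<forall>l'\<in>cells (Suc t). cluster (Suc t) l = cluster (Suc t) l' \<longrightarrow> p l = p l')
     \<and> (\<forall>l\<in>cells (Suc t). p l \<in> G ` cluster t (parent t l))
     \<and> (\<forall>c\<in>cells t. card {l\<in>cells (Suc t). p l = c} = Q t)"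
proof -
  define K where "K T = {l\<in>cells (Suc t). parent t l \<in> T}" for T
  define bl where "bl T = cluster (Suc t) ` K T" for T
  have packing: "\<exists>p. p ` bl T \<subseteq> G ` T \<and> (\<forall>w\<in>G ` T. sum card {x\<in>bl T. p x = w} = Q t)"
    if T: "T \<in> cluster t ` cells t" for T
  proof (rule pack_blocks)
    obtain l0 where l0: "l0 \<in> cells t" "T = cluster t l0" using T by auto
    have sub: "T \<subseteq> cells t" using l0 cluster_subset by simp
    have finT: "finite T" using sub finite_cells finite_subset by blast
    have finK: "finite (K T)" using finite_cells by (simp add: K_def)
    show "finite (bl T)" using finK by (simp add: bl_def)
    show "finite (G ` T)" using finT by simp
    show "G ` T \<noteq> {}" using l0 cluster_self by blast
    show "card x \<le> B" if "x \<in> bl T" for x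
      using that cluster_card by (auto simp: bl_def K_def)
    have cG: "card (G ` T) = card T"
      using G sub by (metis bij_betw_def card_image inj_on_subset)
    have closed: "x \<subseteq> K T" if x: "x \<in> bl T" for x
    proof
      fix l' assume "l' \<in> x"
      moreover obtain l where l: "l \<in> K T" "x = cluster (Suc t) l" using x unfolding bl_def by blast
      ultimately have "parent t l' \<in> cluster t (parent t l)" "l' \<in> cells (Suc t)"
        using parent_cluster[of l t l'] cluster_subset[of "Suc t" l] by (auto simp: K_def)
      moreover have "cluster t (parent t l) = T"
        using l l0 cluster_eq_iff parent_in_cells by (auto simp: K_def)
      ultimately show "l' \<in> K T" by (simp add: K_def)
    qed
    have un: "\<Union>(bl T) = K T"
      using closed cluster_self by (fastforce simp: bl_def K_def)
    have dis: "pairwise disjnt (bl T)"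
    proof (rule pairwiseI)
      fix x y assume "x \<in> bl T" "y \<in> bl T" "x \<noteq> y"
      then show "disjnt x y"
        using cluster_eq_iff cluster_subset unfolding bl_def K_def disjnt_def
        by (smt (verit) disjoint_iff image_iff mem_Collect_eq subsetD)
    qed
    have "sum card (bl T) = card (K T)"
      using card_Union_disjoint[OF dis] un closed finK finite_subset by metis
    also have "K T = (\<Union>l\<in>T. {l'\<in>cells (Suc t). parent t l' = l})" by (auto simp: K_def)
    also have "card \<dots> = (\<Sum>l\<in>T. card {l'\<in>cells (Suc t). parent t l' = l})"
      using finT sub finite_children by (intro card_UN_disjoint) auto
    also have "\<dots> = (\<Sum>l\<in>T. Q t)" using sub card_children by (intro sum.cong) auto
    finally show "sum card (bl T) = card (G ` T) * Q t" by (simp add: cG)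
    define I where "I l = {l'\<in>cells (Suc t). parent t l' = l \<and> isolated (Suc t) l'}" for l
    have "card T * B = (\<Sum>l\<in>T. B)" by simp
    also have "\<dots> \<le> (\<Sum>l\<in>T. card (I l))" using many_isolated sub by (intro sum_mono) (auto simp: I_def)
    also have "\<dots> = card (\<Union>l\<in>T. I l)"
      using finT finite_cells[of "Suc t"] by (intro card_UN_disjoint[symmetric]) (auto simp: I_def)
    also have "\<dots> = card ((\<lambda>l. {l}) ` (\<Union>l\<in>T. I l))" by (simp add: card_image)
    also have "\<dots> \<le> card {x\<in>bl T. card x = 1}"
    proof (rule card_mono)
      show "finite {x\<in>bl T. card x = 1}" using finK by (simp add: bl_def)
      have "{l} \<in> bl T" if "l \<in> K T" "isolated (Suc t) l" for l
        using isolated_cluster[of l "Suc t"] that unfolding bl_def K_def by (metis (lifting) image_eqI mem_Collect_eq)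
      then show "(\<lambda>l. {l}) ` (\<Union>l\<in>T. I l) \<subseteq> {x\<in>bl T. card x = 1}"
        by (auto simp: I_def K_def)
    qed
    finally show "card (G ` T) * B \<le> card {x\<in>bl T. card x = 1}" by (simp add: cG)
  qed
  then have "\<forall>T\<in>cluster t ` cells t. \<exists>p. p ` bl T \<subseteq> G ` T \<and> (\<forall>w\<in>G ` T. sum card {x\<in>bl T. p x = w} = Q t)"
    by blast
  then obtain P where P': "\<forall>T\<in>cluster t ` cells t. P T ` bl T \<subseteq> G ` T \<and>
      (\<forall>w\<in>G ` T. sum card {x\<in>bl T. P T x = w} = Q t)"
    unfolding bchoice_iff by (elim exE)
  then have P: "\<And>T. T \<in> cluster t ` cells t \<Longrightarrow> P T ` bl T \<subseteq> G ` T"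
      "\<And>T w. T \<in> cluster t ` cells t \<Longrightarrow> w \<in> G ` T \<Longrightarrow> sum card {x\<in>bl T. P T x = w} = Q t"
    by blast+
  define p where "p l = P (cluster t (parent t l)) (cluster (Suc t) l)" for l
  have mem: "p l \<in> G ` cluster t (parent t l)" if l: "l \<in> cells (Suc t)" for l
  proof -
    have "cluster (Suc t) l \<in> bl (cluster t (parent t l))"
      using l parent_in_cells cluster_self by (auto simp: bl_def K_def)
    then show ?thesis using P(1)[of "cluster t (parent t l)"] l parent_in_cells by (auto simp: p_def)
  qed
  moreover have "p l = p l'"
    if "l \<in> cells (Suc t)" "l' \<in> cells (Suc t)" "cluster (Suc t) l = cluster (Suc t) l'" for l l'
  proof -
    have "l' \<in> cluster (Suc t) l" using that cluster_self by blast
    then have "cluster t (parent t l') = cluster t (parent t l)"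
      using parent_cluster that cluster_eq_iff parent_in_cells by metis
    then show ?thesis using that by (simp add: p_def)
  qed
  moreover have "card {l\<in>cells (Suc t). p l = c} = Q t" if c: "c \<in> cells t" for c
  proof -
    obtain c0 where c0: "c0 \<in> cells t" "c = G c0" using G c by (auto simp: bij_betw_def)
    define T where "T = cluster t c0"
    have T: "T \<in> cluster t ` cells t" using c0 by (simp add: T_def)
    have cT: "c \<in> G ` T" using c0 cluster_self by (auto simp: T_def)
    have inT: "cluster t (parent t l) = T" if l: "l \<in> cells (Suc t)" "p l = c" for l
    proof -
      obtain c1 where c1: "c1 \<in> cluster t (parent t l)" "c = G c1" using mem[OF l(1)] l(2) by blast
      then have "c1 = c0" using G c0 cluster_subset by (metis bij_betw_def inj_onD subsetD)
      then show ?thesis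
        using c0 c1 l parent_in_cells cluster_eq_iff by (simp add: T_def)
    qed
    define S where "S = {x\<in>bl T. P T x = c}"
    have "{l\<in>cells (Suc t). p l = c} = \<Union>S"
    proof (intro equalityI subsetI)
      fix l assume "l \<in> {l\<in>cells (Suc t). p l = c}"
      then have l: "l \<in> cells (Suc t)" "p l = c" by auto
      then have "cluster (Suc t) l \<in> S"
        using inT[OF l] cluster_self[OF parent_in_cells[OF l(1)]] by (auto simp: S_def bl_def K_def p_def)
      then show "l \<in> \<Union>S" using cluster_self[OF l(1)] by auto
    next
      fix l assume "l \<in> \<Union>S"
      then obtain l' where l': "l' \<in> K T" "P T (cluster (Suc t) l') = c" "l \<in> cluster (Suc t) l'"
        by (auto simp: S_def bl_def)
      then have l: "l \<in> cells (Suc t)" "l' \<in> cells (Suc t)" using cluster_subset by (auto simp: K_def)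
      have "cluster (Suc t) l = cluster (Suc t) l'" using l l' cluster_eq_iff by blast
      moreover have "cluster t (parent t l') = T"
        using l' c0 cluster_eq_iff parent_in_cells by (auto simp: K_def T_def)
      moreover have "cluster t (parent t l) = cluster t (parent t l')"
        using parent_cluster[OF l(2) l'(3)] l parent_in_cells cluster_eq_iff by blast
      ultimately show "l \<in> {l\<in>cells (Suc t). p l = c}" using l l' by (simp add: p_def)
    qed
    moreover have "card (\<Union>S) = sum card S"
    proof (rule card_Union_disjoint)
      show "pairwise disjnt S"
      proof (rule pairwiseI)
        fix x y assume "x \<in> S" "y \<in> S" "x \<noteq> y"
        then show "disjnt x y"
          using cluster_eq_iff cluster_subset unfolding S_def bl_def K_def disjnt_def
          by (smt (verit) disjoint_iff image_iff mem_Collect_eq subsetD)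
      qed
      show "finite x" if "x \<in> S" for x
        using that cluster_subset finite_cells finite_subset unfolding S_def bl_def by blast
    qed
    ultimately show ?thesis using P(2)[OF T cT] by (simp add: S_def)
  qed
  ultimately show ?thesis by blast
qed

text \<open>Under compatible permutations, nested clusters are moved to nested sets of cells, and each of these sets lies below
  a single cell of the previous level.\<close>

definition compatible :: "nat \<Rightarrow> ('b \<Rightarrow> 'b) \<Rightarrow> ('b \<Rightarrow> 'b) \<Rightarrow> bool" where
  "compatible t G G' \<longleftrightarrow>
     (\<forall>l\<in>cells (Suc t). \<forall>l'\<in>cells (Suc t). cluster (Suc t) l = cluster (Suc t) l' \<longrightarrow>
        parent t (G' l) = parent t (G' l'))
   \<and> (\<forall>l\<in>cells (Suc t). parent t (G' l) \<in> G ` cluster t (parent t l))"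

lemma ex_compatible:
  assumes G: "bij_betw G (cells t) (cells t)"
  shows "\<exists>G'. bij_betw G' (cells (Suc t)) (cells (Suc t)) \<and> compatible t G G'"
proof -
  obtain p where p':
    "\<forall>l\<in>cells (Suc t). \<forall>l'\<in>cells (Suc t). cluster (Suc t) l = cluster (Suc t) l' \<longrightarrow> p l = p l'"
    "\<forall>l\<in>cells (Suc t). p l \<in> G ` cluster t (parent t l)"
    "\<forall>c\<in>cells t. card {l\<in>cells (Suc t). p l = c} = Q t"
    using ex_assignment[OF G] by (elim exE conjE)
  then have p:
    "\<And>l l'. l \<in> cells (Suc t) \<Longrightarrow> l' \<in> cells (Suc t) \<Longrightarrow> cluster (Suc t) l = cluster (Suc t) l' \<Longrightarrow> p l = p l'"
    "\<And>l. l \<in> cells (Suc t) \<Longrightarrow> p l \<in> G ` cluster t (parent t l)"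
    "\<And>c. c \<in> cells t \<Longrightarrow> card {l\<in>cells (Suc t). p l = c} = Q t"
    by blast+
  have "p l \<in> cells t" if "l \<in> cells (Suc t)" for l
    using p(2)[OF that] G cluster_subset[of t "parent t l"] by (auto simp: bij_betw_def)
  then have "\<exists>h. bij_betw h (cells (Suc t)) (cells (Suc t)) \<and> (\<forall>l\<in>cells (Suc t). parent t (h l) = p l)"
    using finite_cells parent_in_cells p(3) card_children by (intro ex_bij_over[where Y = "cells t"]) auto
  then obtain h where h: "bij_betw h (cells (Suc t)) (cells (Suc t))"
      "\<And>l. l \<in> cells (Suc t) \<Longrightarrow> parent t (h l) = p l"
    by auto
  have "compatible t G h"
    unfolding compatible_def
  proof (intro conjI ballI impI)
    fix l assume l: "l \<in> cells (Suc t)"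
    show "parent t (h l) \<in> G ` cluster t (parent t l)" using p(2)[OF l] h(2)[OF l] by simp
    fix l' assume l': "l' \<in> cells (Suc t)" "cluster (Suc t) l = cluster (Suc t) l'"
    show "parent t (h l) = parent t (h l')" using p(1)[OF l l'] h(2)[OF l] h(2)[OF l'(1)] by simp
  qed
  then show ?thesis using h(1) by blast
qed

text \<open>Compatible permutations are chosen level by level. The clusters containing \<open>\<omega>\<close> are nested, and the places they are moved to
  shrink to a single code, which is \<open>f \<omega>\<close>; codes in distinct clusters are separated because the places of
  distinct clusters are disjoint. For surjectivity, pull the cells along a given branch back: this gives one cell in
  each level, and although these cells need not be nested, their clusters are. By compactness the points of the
  clusters accumulate somewhere, and a code of the accumulation point lies in all of them.\<close>

lemma ex_rearrangement:
  "\<exists>f. f ` \<Omega> = \<Omega> \<and>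
    (\<forall>\<omega>\<in>\<Omega>. \<forall>\<omega>'\<in>\<Omega>. \<forall>t. (linked (Suc t) \<omega> \<omega>' \<longrightarrow> lab t (f \<omega>) = lab t (f \<omega>')) \<and>
                         (\<not> linked t \<omega> \<omega>' \<longrightarrow> lab t (f \<omega>) \<noteq> lab t (f \<omega>')))"
proof -
  have "\<exists>G. \<forall>t. bij_betw (G t) (cells t) (cells t) \<and> compatible t (G t) (G (Suc t))"
    using ex_compatible bij_betw_id by (intro dependent_nat_choice) blast+
  then obtain G where bij: "\<And>t. bij_betw (G t) (cells t) (cells t)"
    and comp: "\<And>t. compatible t (G t) (G (Suc t))" by blast
  have G_in: "G t l \<in> cells t" if "l \<in> cells t" for t l
    using bij that by (auto simp: bij_betw_def)
  \<comment> \<open>the cell of level \<open>t\<close> below which the whole cluster of \<open>\<omega>\<close> in level \<open>t + 1\<close> is placed\<close>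
  define \<tau> where "\<tau> t \<omega> = parent t (G (Suc t) (lab (Suc t) \<omega>))" for t and \<omega> :: 'a
  have \<tau>_linked: "\<tau> t \<omega> = \<tau> t \<omega>'" if "\<omega> \<in> \<Omega>" "\<omega>' \<in> \<Omega>" "linked (Suc t) \<omega> \<omega>'" for t \<omega> \<omega>'
    using comp[of t] cluster_eqI[OF that] that by (auto simp: compatible_def \<tau>_def)
  have \<tau>_mem: "\<exists>\<omega>'\<in>\<Omega>. linked t \<omega> \<omega>' \<and> \<tau> t \<omega> = G t (lab t \<omega>')" if "\<omega> \<in> \<Omega>" for t \<omega>
  proof -
    have "\<tau> t \<omega> \<in> G t ` cluster t (lab t \<omega>)"
      using comp[of t] that by (auto simp: compatible_def \<tau>_def parent_lab dest!: bspec[of _ _ "lab (Suc t) \<omega>"])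
    then show ?thesis using that by (auto simp: cluster_lab)
  qed
  have \<tau>_apart: "\<tau> t \<omega> \<noteq> \<tau> t \<omega>'" if \<omega>: "\<omega> \<in> \<Omega>" "\<omega>' \<in> \<Omega>" "\<not> linked t \<omega> \<omega>'" for t \<omega> \<omega>'
  proof
    assume eq: "\<tau> t \<omega> = \<tau> t \<omega>'"
    obtain \<alpha> \<beta> where ab: "\<alpha> \<in> \<Omega>" "\<beta> \<in> \<Omega>" "linked t \<omega> \<alpha>" "linked t \<omega>' \<beta>"
        "G t (lab t \<alpha>) = G t (lab t \<beta>)"
      using \<tau>_mem[OF \<omega>(1), of t] \<tau>_mem[OF \<omega>(2), of t] eq by metis
    then have "lab t \<alpha> = lab t \<beta>" using bij[of t] by (auto simp: bij_betw_def inj_on_def)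
    then show False using ab \<omega>(3) same_lab_linked linked_sym linked_trans by metis
  qed
  have "\<exists>\<omega>'\<in>\<Omega>. \<forall>t. lab t \<omega>' = \<tau> t \<omega>" if \<omega>: "\<omega> \<in> \<Omega>" for \<omega>
  proof -
    have "\<tau> t \<omega> \<in> cells t" for t using \<omega> G_in parent_in_cells by (simp add: \<tau>_def)
    then have "\<forall>t. \<exists>w. w \<in> \<Omega> \<and> lab t w = \<tau> t \<omega>" unfolding cells_def by (metis imageE)
    then obtain w where w: "\<And>t. w t \<in> \<Omega>" "\<And>t. lab t (w t) = \<tau> t \<omega>" by metis
    have "lab t (w (Suc t)) = lab t (w t)" for t
    proof -
      obtain \<alpha> where "\<alpha> \<in> \<Omega>" "linked (Suc t) \<omega> \<alpha>" "\<tau> (Suc t) \<omega> = G (Suc t) (lab (Suc t) \<alpha>)"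
        using \<tau>_mem[OF \<omega>] by blast
      then have "parent t (\<tau> (Suc t) \<omega>) = \<tau> t \<omega>" using \<tau>_linked[OF \<omega>] by (simp add: \<tau>_def)
      then show ?thesis using w parent_lab[OF w(1)[of "Suc t"], of t] by simp
    qed
    then show ?thesis using complete[of w] w by simp
  qed
  then obtain f where f: "\<And>\<omega>. \<omega> \<in> \<Omega> \<Longrightarrow> f \<omega> \<in> \<Omega>" "\<And>\<omega> t. \<omega> \<in> \<Omega> \<Longrightarrow> lab t (f \<omega>) = \<tau> t \<omega>"
    by metis
  have "\<omega> \<in> f ` \<Omega>" if \<omega>: "\<omega> \<in> \<Omega>" for \<omega>
  proof -
    have "\<forall>t. \<exists>w. w \<in> \<Omega> \<and> G t (lab t w) = lab t \<omega>"
    proof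
      fix t
      have "lab t \<omega> \<in> G t ` cells t" using bij[of t] \<omega> by (simp add: bij_betw_def)
      then show "\<exists>w. w \<in> \<Omega> \<and> G t (lab t w) = lab t \<omega>" by (force simp: cells_def)
    qed
    then obtain w where w: "\<And>t. w t \<in> \<Omega>" "\<And>t. G t (lab t (w t)) = lab t \<omega>" by metis
    have step: "\<tau> t (w (Suc t)) = lab t \<omega> \<and> linked t (w t) (w (Suc t))" for t
    proof -
      have eq: "\<tau> t (w (Suc t)) = lab t \<omega>" using w \<omega> by (simp add: \<tau>_def parent_lab)
      obtain \<alpha> where a: "\<alpha> \<in> \<Omega>" "linked t (w (Suc t)) \<alpha>" "G t (lab t \<alpha>) = lab t \<omega>"
        using \<tau>_mem[OF w(1)[of "Suc t"], of t] eq by auto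
      then have "lab t \<alpha> = lab t (w t)" using bij[of t] w by (auto simp: bij_betw_def inj_on_def)
      then show ?thesis using a eq w same_lab_linked linked_sym linked_trans by metis
    qed
    have chain: "linked t (w t) (w (t + d))" for t d
    proof (induction d)
      case (Suc d)
      have "linked t (w (t + d)) (w (Suc (t + d)))"
      proof -
        have "linked s x y \<Longrightarrow> s = t + e \<Longrightarrow> linked t x y" for s e x y
          by (induction e arbitrary: s) (auto dest: linked_mono)
        then show ?thesis using step[of "t + d"] by blast
      qed
      then show ?case using Suc linked_trans by auto
    qed simp
    have "\<forall>t. \<pi> (w t) \<in> \<pi> ` \<Omega>" using w by simp
    then obtain e r where e: "e \<in> \<pi> ` \<Omega>" and r: "strict_mono r" and lim: "((\<lambda>t. \<pi> (w t)) \<circ> r) \<longlonglongrightarrow> e"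
      using compact_image unfolding compact_def by metis
    obtain \<alpha> where \<alpha>: "\<alpha> \<in> \<Omega>" "e = \<pi> \<alpha>" using e by auto
    have w\<alpha>: "linked t (w t) \<alpha>" for t
    proof -
      obtain s where s: "\<And>i. i \<ge> s \<Longrightarrow> dist (\<pi> (w (r i))) e < \<epsilon> t"
        using lim scale_pos[of t] unfolding lim_sequentially by (auto simp: o_def)
      define i where "i = max s t"
      have "near t (w (r i)) \<alpha>" using s[of i] w \<alpha> by (simp add: near_def i_def)
      moreover have "t \<le> r i" using seq_suble[OF r, of i] by (simp add: i_def)
      then have "linked t (w t) (w (r i))" using chain[of t "r i - t"] by simp
      ultimately show ?thesis using linked_trans near_imp_linked by blast
    qed
    have "\<tau> t \<alpha> = lab t \<omega>" for t
      using \<tau>_linked[OF w(1) \<alpha>(1) w\<alpha>] step[of t] by simp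
    then have "f \<alpha> = \<omega>" using f \<alpha> \<omega> by (intro separating) auto
    then show ?thesis using \<alpha> by auto
  qed
  then have "f ` \<Omega> = \<Omega>" using f by auto
  moreover have "lab t (f \<omega>) = lab t (f \<omega>')" if "\<omega> \<in> \<Omega>" "\<omega>' \<in> \<Omega>" "linked (Suc t) \<omega> \<omega>'" for t \<omega> \<omega>'
    using \<tau>_linked[OF that] f(2) that by simp
  moreover have "lab t (f \<omega>) \<noteq> lab t (f \<omega>')" if "\<omega> \<in> \<Omega>" "\<omega>' \<in> \<Omega>" "\<not> linked t \<omega> \<omega>'" for t \<omega> \<omega>'
    using \<tau>_apart[OF that] f(2) that by simp
  ultimately show ?thesis by blast
qed

end

section \<open>Expansions and the shifted coding\<close>

fun word_num :: "nat \<Rightarrow> (nat \<Rightarrow> nat) \<Rightarrow> nat \<Rightarrow> nat" where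
  "word_num b x 0 = 0"
| "word_num b x (Suc L) = b * word_num b x L + x L"

definition val :: "nat \<Rightarrow> (nat \<Rightarrow> nat) \<Rightarrow> real" where
  "val b x = (\<Sum>i. real (x i) / real b ^ Suc i)"

lemma digit_series_bounds:
  assumes "2 \<le> b" "\<And>i. x i < b"
  shows "summable (\<lambda>i. real (x i) / real b ^ Suc i)" "0 \<le> val b x" "val b x \<le> 1"
proof -
  have g: "(\<lambda>i. (1 / real b) ^ i) sums (1 / (1 - 1 / real b))"
    using assms by (intro geometric_sums) auto
  from sums_mult[OF this, of "(real b - 1) / real b"]
  have s: "(\<lambda>i. (real b - 1) / real b * (1 / real b) ^ i) sums 1"
    using assms by (simp add: field_simps)
  have le: "real (x i) / real b ^ Suc i \<le> (real b - 1) / real b * (1 / real b) ^ i" for i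
  proof -
    have "real (x i) + 1 \<le> real b" using assms(2)[of i] by linarith
    then show ?thesis using assms by (simp add: field_simps)
  qed
  show sx: "summable (\<lambda>i. real (x i) / real b ^ Suc i)"
    by (rule summable_comparison_test'[OF sums_summable[OF s], of 0]) (use le in auto)
  show "0 \<le> val b x" unfolding val_def by (rule suminf_nonneg[OF sx]) simp
  have "val b x \<le> (\<Sum>i. (real b - 1) / real b * (1 / real b) ^ i)"
    unfolding val_def by (rule suminf_le[OF le sx sums_summable[OF s]])
  then show "val b x \<le> 1" using sums_unique[OF s] by simp
qed

lemma val_unfold:
  assumes "2 \<le> b" "\<And>i. x i < b"
  shows "val b x = (real (x 0) + val b (\<lambda>i. x (Suc i))) / real b"
proof -
  note s = digit_series_bounds(1)[of b x, OF assms]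
  note s' = digit_series_bounds(1)[of b "\<lambda>i. x (Suc i)", OF assms]
  have "val b x = real (x 0) / real b + (\<Sum>i. real (x (Suc i)) / real b ^ Suc (Suc i))"
    unfolding val_def using suminf_split_head[OF s] by simp
  also have "(\<Sum>i. real (x (Suc i)) / real b ^ Suc (Suc i)) = val b (\<lambda>i. x (Suc i)) / real b"
    unfolding val_def using suminf_divide[OF s', of "real b"] by (simp add: mult.commute)
  finally show ?thesis by (simp add: add_divide_distrib)
qed

lemma val_word_num:
  assumes "2 \<le> b" "\<And>i. x i < b"
  shows "val b x = (real (word_num b x L) + val b (\<lambda>i. x (i + L))) / real b ^ L"
proof (induction L)
  case (Suc L)
  have "val b (\<lambda>i. x (i + L)) = (real (x L) + val b (\<lambda>i. x (i + Suc L))) / real b"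
    using val_unfold[OF assms(1), of "\<lambda>i. x (i + L)"] assms by simp
  then show ?case using Suc assms by (simp add: field_simps)
qed simp

lemma val_between:
  assumes "2 \<le> b" "\<And>i. x i < b"
  shows "real (word_num b x L) \<le> val b x * real b ^ L" "val b x * real b ^ L \<le> real (word_num b x L) + 1"
  using val_word_num[of b x L, OF assms] digit_series_bounds(2,3)[of b "\<lambda>i. x (i + L)", OF assms] assms(1)
  by (simp_all add: field_simps)

text \<open>A point lies in the closed \<open>b\<close>-adic interval named by the first \<open>L\<close> digits of any of its expansions, and intervals
  that are neither equal nor adjacent are at least \<open>1 / b ^ L\<close> apart.\<close>

lemma word_num_close:
  assumes "2 \<le> b" "\<And>i. x i < b" "\<And>i. x' i < b" "\<bar>val b x - val b x'\<bar> < 1 / real b ^ L"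
  shows "word_num b x L \<le> word_num b x' L + 1"
proof (rule ccontr)
  assume "\<not> ?thesis"
  then have "real (word_num b x' L) + 2 \<le> real (word_num b x L)" by linarith
  then have "1 \<le> (val b x - val b x') * real b ^ L"
    using val_between(1)[of b x L, OF assms(1,2)] val_between(2)[of b x' L, OF assms(1,3)] by (simp add: algebra_simps)
  also have "\<dots> \<le> \<bar>val b x - val b x'\<bar> * real b ^ L" by (intro mult_right_mono) auto
  also have "\<dots> < 1" using assms(1,4) by (simp add: field_simps)
  finally show False by simp
qed

lemma val_dist_le:
  assumes "2 \<le> b" "\<And>i. x i < b" "\<And>i. x' i < b" "real (word_num b x L) \<le> real (word_num b x' L) + c"
  shows "val b x - val b x' \<le> (c + 1) / real b ^ L"
proof -
  have "(val b x - val b x') * real b ^ L \<le> c + 1"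
    using val_between(2)[of b x L, OF assms(1,2)] val_between(1)[of b x' L, OF assms(1,3)] assms(4)
    by (simp add: algebra_simps)
  then show ?thesis using assms(1) by (simp add: field_simps)
qed

lemma word_num_cong: "(\<And>i. i < L \<Longrightarrow> x i = x' i) \<Longrightarrow> word_num b x L = word_num b x' L"
  by (induction L) auto

lemma word_num_eq_imp:
  assumes "word_num b x L = word_num b x' L" "\<And>i. x i < b" "\<And>i. x' i < b" "i < L"
  shows "x i = x' i"
  using assms(1,4)
proof (induction L)
  case (Suc L)
  have "x L = x' L"
    using arg_cong[OF Suc.prems(1), of "\<lambda>z. z mod b"] assms(2,3) by simp
  moreover have "word_num b x L = word_num b x' L"
    using Suc.prems(1) calculation assms(2)[of 0] by simp
  ultimately show ?case using Suc by (cases "i = L") auto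
qed simp

lemma word_num_less: "(\<And>i. x i < b) \<Longrightarrow> word_num b x L < b ^ L"
proof (induction L)
  case (Suc L)
  then have "b * word_num b x L + x L < b * word_num b x L + b" by simp
  also have "\<dots> = b * Suc (word_num b x L)" by simp
  also have "\<dots> \<le> b * b ^ L" using Suc by (intro mult_left_mono) (auto simp: Suc_leI)
  finally show ?case by simp
qed simp

lemma word_num_carry:
  assumes "word_num b z' (Suc L) = word_num b z (Suc L) + 1" "\<And>i. z i < b" "\<And>i. z' i < b"
  shows "word_num b z' L = word_num b z L \<and> z' L = z L + 1
       \<or> word_num b z' L = word_num b z L + 1 \<and> z L = b - 1 \<and> z' L = 0"
proof (cases "z L = b - 1")
  case True
  then have eq: "b * word_num b z' L + z' L = b * (word_num b z L + 1)"
    using assms(1) assms(2)[of L] by (simp add: algebra_simps)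
  have "(b * word_num b z' L + z' L) mod b = 0" unfolding eq by (rule mod_mult_self1_is_0)
  then have "z' L = 0" using assms(3)[of L] by simp
  moreover have "word_num b z' L = word_num b z L + 1" using eq calculation assms(2)[of L]
    by (metis add.right_neutral less_nat_zero_code mult_left_cancel)
  ultimately show ?thesis using True by simp
next
  case False
  then have lt: "z L + 1 < b" using assms(2)[of L] by linarith
  have eq: "b * word_num b z' L + z' L = b * word_num b z L + (z L + 1)" using assms(1) by simp
  have "(b * word_num b z' L + z' L) mod b = (z L + 1) mod b" unfolding eq by (rule mod_mult_self4)
  then have "z' L = z L + 1" using assms(3)[of L] lt by simp
  then show ?thesis using eq assms(2)[of L] by auto
qed

text \<open>Ranks are used in place of digits because they make all non-vacant rows look alike. The function \<open>e\<close> lists a set of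
  \<open>a\<close> digits in increasing order, and \<open>h\<close> is the number of digits below some vacant digit \<open>v\<close>.\<close>

definition gapped :: "nat \<Rightarrow> nat \<Rightarrow> (nat \<Rightarrow> nat) \<Rightarrow> nat \<Rightarrow> bool" where
  "gapped n a e h \<longleftrightarrow> strict_mono_on {..<a} e \<and> (\<forall>r<a. e r < n) \<and> h \<le> a \<and>
     (\<exists>v<n. \<forall>r<a. e r \<noteq> v \<and> (e r < v \<longleftrightarrow> r < h))"

text \<open>Separate cyclic shifts of the ranks below and above the vacant digit. If two consecutive numbers are digits, they lie on
  the same side of the vacant digit, and \<open>sigma\<close> takes the rank of the first one to the rank of the second
  one. Closing each of the two blocks to a cycle makes \<open>sigma\<close> bijective.\<close>

definition sigma :: "nat \<Rightarrow> nat \<Rightarrow> nat \<Rightarrow> nat" where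
  "sigma a h r = (if Suc r = h then 0 else if Suc r = a then h else Suc r)"

text \<open>The shifted coding. Cut every cylinder at the vacant digit of the next level. The symbol \<open>\<rho> k\<close> stands for the upper part of the
  cylinder with rank \<open>\<rho> k\<close> together with the lower part of the cylinder with rank \<open>sigma a (h k) (\<rho> k)\<close>, and
  the next symbol tells which part is meant. If the two cylinders are neighbours, the parts glued together are just those that may
  touch. Since \<open>sigma\<close> preserves the sides of the vacant digit, the pieces are nested, and every piece
  again splits into \<open>a\<close> pieces.\<close>

definition decode :: "nat \<Rightarrow> (nat \<Rightarrow> nat) \<Rightarrow> (nat \<Rightarrow> nat) \<Rightarrow> nat \<Rightarrow> nat" where
  "decode a h \<rho> k = (if h (Suc k) \<le> \<rho> (Suc k) then \<rho> k else sigma a (h k) (\<rho> k))"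

lemma sigma_less: "\<lbrakk>h \<le> a; r < a\<rbrakk> \<Longrightarrow> sigma a h r < a"
  by (auto simp: sigma_def)

lemma sigma_side: "\<lbrakk>h \<le> a; r < a\<rbrakk> \<Longrightarrow> sigma a h r < h \<longleftrightarrow> r < h"
  by (auto simp: sigma_def)

lemma sigma_inj: "\<lbrakk>h \<le> a; r < a; r' < a; sigma a h r = sigma a h r'\<rbrakk> \<Longrightarrow> r = r'"
  by (auto simp: sigma_def split: if_splits)

lemma sigma_surj:
  assumes "h \<le> a" "r < a"
  shows "\<exists>q<a. sigma a h q = r"
proof -
  have "inj_on (sigma a h) {..<a}" using sigma_inj assms by (auto intro!: inj_onI)
  then have "sigma a h ` {..<a} = {..<a}"
    using sigma_less assms(1) by (intro endo_inj_surj) auto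
  then show ?thesis using assms(2) by (metis (no_types, lifting) imageE lessThan_iff)
qed

lemma decode_less: "\<lbrakk>\<And>i. h i \<le> a; \<And>i. \<rho> i < a\<rbrakk> \<Longrightarrow> decode a h \<rho> k < a"
  by (auto simp: decode_def sigma_less)

lemma decode_side: "\<lbrakk>\<And>i. h i \<le> a; \<And>i. \<rho> i < a\<rbrakk> \<Longrightarrow> h k \<le> decode a h \<rho> k \<longleftrightarrow> h k \<le> \<rho> k"
  using sigma_side[of "h k" a "\<rho> k"] by (auto simp: decode_def not_less[symmetric])

lemma decode_surj:
  assumes "\<And>i. h i \<le> a" "\<And>i. r i < a"
  shows "\<exists>\<rho>. (\<forall>i. \<rho> i < a) \<and> decode a h \<rho> = r"
proof -
  have "\<forall>i. \<exists>q<a. sigma a (h i) q = r i" using sigma_surj assms by blast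
  then obtain q where q: "\<And>i. q i < a" "\<And>i. sigma a (h i) (q i) = r i" by metis
  define \<rho> where "\<rho> i = (if h (Suc i) \<le> r (Suc i) then r i else q i)" for i
  have less: "\<rho> i < a" for i using q assms by (simp add: \<rho>_def)
  have side: "h i \<le> \<rho> i \<longleftrightarrow> h i \<le> r i" for i
    using sigma_side[OF assms(1) q(1), of i i] q(2)[of i] by (auto simp: \<rho>_def)
  have "decode a h \<rho> i = r i" for i
    using side[of "Suc i"] q(2)[of i] by (simp add: decode_def) (simp add: \<rho>_def)
  then show ?thesis using less by blast
qed

lemma gapped_mono: "\<lbrakk>gapped n a e h; r < r'; r' < a\<rbrakk> \<Longrightarrow> e r < e r'"
  by (auto simp: gapped_def strict_mono_on_def)

lemma gapped_less_iff: "\<lbrakk>gapped n a e h; r < a; r' < a\<rbrakk> \<Longrightarrow> e r < e r' \<longleftrightarrow> r < r'"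
  using gapped_mono by (metis less_asym' linorder_neqE_nat)

lemma gapped_inj: "\<lbrakk>gapped n a e h; r < a; r' < a; e r = e r'\<rbrakk> \<Longrightarrow> r = r'"
  using gapped_mono by (metis less_irrefl linorder_neqE_nat)

lemma gapped_succ:
  assumes g: "gapped n a e h" and r: "r < a" "r' < a" "e r' = e r + 1"
  shows "sigma a h r = r'" "r < h \<longleftrightarrow> r' < h"
proof -
  obtain v where v: "\<And>s. s < a \<Longrightarrow> e s \<noteq> v \<and> (e s < v \<longleftrightarrow> s < h)" using g by (auto simp: gapped_def)
  have "r < r'" using gapped_less_iff[OF g r(1,2)] r(3) by simp
  moreover have "\<not> Suc r < r'"
  proof
    assume "Suc r < r'"
    then have "e r < e (Suc r)" "e (Suc r) < e r'"
      using gapped_mono[OF g, of r "Suc r"] gapped_mono[OF g, of "Suc r" r'] r by auto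
    then show False using r by simp
  qed
  ultimately have S: "r' = Suc r" by simp
  show side: "r < h \<longleftrightarrow> r' < h" using v[of r] v[of r'] r by linarith
  then show "sigma a h r = r'" using S r by (auto simp: sigma_def)
qed

text \<open>Preceded by the symbol \<open>a - 1\<close>, this symbol isolates a piece. The symbols \<open>a - 1, a - 1\<close> name a piece that reaches the upper end
  of the cylinder with the largest digit; it has no neighbour above, unless that digit is \<open>n - 1\<close>. In that
  exceptional case \<open>sigma\<close> sends \<open>a - 1\<close> to the first digit above the vacant one, and the symbols \<open>a - 1, h - 1\<close> name
  a piece that reaches the lower end of that cylinder and has no neighbour below. If the digits at the current position
  all lie on one side of the vacant digit, then \<open>0\<close> or \<open>n - 1\<close> is not among them, and no carry can run over two
  positions.\<close>

definition last_digit_code :: "nat \<Rightarrow> nat \<Rightarrow> (nat \<Rightarrow> nat) \<Rightarrow> nat \<Rightarrow> nat" where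
  "last_digit_code n a e h = (if e (a - 1) = n - 1 \<and> 0 < h then h - 1 else a - 1)"

lemma decode_agree:
  assumes "r < a" "r' < a" "h \<le> a" "side \<longleftrightarrow> side'" "q < a" "q' < a"
    "r = (if side then q else sigma a h q)" "r' = (if side' then q' else sigma a h q')" "r = r'"
  shows "q = q'"
  using assms sigma_inj by (auto split: if_splits)

text \<open>The words of \<open>x\<close> and \<open>x'\<close> are consecutive integers in base \<open>n\<close>. Without a carry, or with a carry out of the last position
  only, the two points lie in one piece, because neighbouring cylinders have been glued along the cut. A carry over
  two positions means that one piece is at the upper end of its cylinder and the other at the lower end of the next
  one. The isolating pair of symbols then forces a digit of the third position to be followed or preceded by
  another digit where there is none.\<close>

lemma adjacent_codes:
  assumes n: "2 \<le> n"
    and g: "\<And>i. i \<le> j + 2 \<Longrightarrow> gapped n a (e i) (h i)"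
    and \<rho>: "\<And>i. \<rho> i < a" "\<And>i. \<rho>' i < a" and r: "\<And>i. r i < a" "\<And>i. r' i < a"
    and dec: "\<And>i. i < j + 2 \<Longrightarrow> r i = (if h (Suc i) \<le> r (Suc i) then \<rho> i else sigma a (h i) (\<rho> i))"
    and dec': "\<And>i. i < j + 2 \<Longrightarrow> r' i = (if h (Suc i) \<le> r' (Suc i) then \<rho>' i else sigma a (h i) (\<rho>' i))"
    and x: "\<And>i. i \<le> j + 2 \<Longrightarrow> x i = e i (r i)" "\<And>i. i \<le> j + 2 \<Longrightarrow> x' i = e i (r' i)"
    and xn: "\<And>i. x i < n" "\<And>i. x' i < n"
    and adj: "word_num n x' (j + 3) = word_num n x (j + 3) + 1"
    and iso: "\<rho> j = a - 1 \<and> \<rho> (j + 1) = last_digit_code n a (e j) (h (j + 1))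
            \<or> \<rho>' j = a - 1 \<and> \<rho>' (j + 1) = last_digit_code n a (e j) (h (j + 1))"
    and i: "i < j + 2"
  shows "\<rho> i = \<rho>' i"
proof -
  have ha: "h i \<le> a" if "i \<le> j + 2" for i using g[OF that] by (simp add: gapped_def)
  have gap: "\<exists>v<n. \<forall>s<a. e i s \<noteq> v \<and> (e i s < v \<longleftrightarrow> s < h i)" if "i \<le> j + 2" for i
    using g[OF that] by (simp add: gapped_def)
  have same: "\<rho> i = \<rho>' i" if "i < j + 2" "r i = r' i" "h (Suc i) \<le> r (Suc i) \<longleftrightarrow> h (Suc i) \<le> r' (Suc i)" for i
    using decode_agree[OF r(1) r(2) ha that(3) \<rho>(1) \<rho>(2) dec dec'] that by auto
  have rank_eq: "r i = r' i" if "i \<le> j + 2" "x i = x' i" for i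
    using gapped_inj[OF g[OF that(1)] r(1) r(2)] x that by auto
  have side_succ: "h i \<le> r i \<longleftrightarrow> h i \<le> r' i" if "i \<le> j + 2" "x' i = x i + 1" for i
    using gapped_succ(2)[OF g[OF that(1)] r(1) r(2)] x that by (simp add: not_less[symmetric])
  have S: "j + 3 = Suc (j + 2)" "j + 2 = Suc (j + 1)" "j + 1 = Suc j" by simp_all
  consider (nocarry) "word_num n x' (j + 2) = word_num n x (j + 2)" "x' (j + 2) = x (j + 2) + 1"
    | (carry) "word_num n x' (j + 2) = word_num n x (j + 2) + 1" "x (j + 2) = n - 1" "x' (j + 2) = 0"
    using word_num_carry[of n x' "j + 2" x] adj xn unfolding S(1) by auto
  then show ?thesis
  proof cases
    case nocarry
    have eq: "x k = x' k" if "k < j + 2" for k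
      using word_num_eq_imp[OF nocarry(1)[symmetric] xn that] .
    have "h (Suc i) \<le> r (Suc i) \<longleftrightarrow> h (Suc i) \<le> r' (Suc i)"
    proof (cases "Suc i < j + 2")
      case True
      then show ?thesis using rank_eq[of "Suc i"] eq by simp
    next
      case False
      then have "Suc i = j + 2" using i by simp
      then show ?thesis using side_succ[of "j + 2"] nocarry(2) by simp
    qed
    then show ?thesis using same i rank_eq eq by simp
  next
    case carry
    obtain v where v: "\<And>s. s < a \<Longrightarrow> e (j + 2) s \<noteq> v \<and> (e (j + 2) s < v \<longleftrightarrow> s < h (j + 2))" "v < n"
      using gap[of "j + 2"] by auto
    have upper: "h (j + 2) \<le> r (j + 2)" and lower: "\<not> h (j + 2) \<le> r' (j + 2)"
      using v(1)[OF r(1), of "j + 2"] v(1)[OF r(2), of "j + 2"] v(2)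
        x(1)[of "j + 2"] x(2)[of "j + 2"] carry(2,3) by linarith+
    have top: "r (j + 1) = \<rho> (j + 1)" and bottom: "r' (j + 1) = sigma a (h (j + 1)) (\<rho>' (j + 1))"
      using dec[of "j + 1"] dec'[of "j + 1"] upper lower by auto
    consider (nocarry2) "word_num n x' (j + 1) = word_num n x (j + 1)" "x' (j + 1) = x (j + 1) + 1"
      | (carry2) "word_num n x' (j + 1) = word_num n x (j + 1) + 1" "x (j + 1) = n - 1" "x' (j + 1) = 0"
      using word_num_carry[of n x' "j + 1" x] carry(1) xn unfolding S(2) by auto
    then show ?thesis
    proof cases
      case nocarry2
      have eq: "x k = x' k" if "k < j + 1" for k
        using word_num_eq_imp[OF nocarry2(1)[symmetric] xn that] .
      show ?thesis
      proof (cases "i = j + 1")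
        case True
        have "sigma a (h (j + 1)) (r (j + 1)) = r' (j + 1)"
          using gapped_succ(1)[OF g[of "j + 1"] r(1) r(2)] x nocarry2(2) by simp
        then show ?thesis using top bottom True sigma_inj[OF ha[of "j + 1"] \<rho>(1) \<rho>(2), of "j + 1" "j + 1"] by simp
      next
        case False
        have "h (Suc i) \<le> r (Suc i) \<longleftrightarrow> h (Suc i) \<le> r' (Suc i)"
        proof (cases "Suc i < j + 1")
          case True
          then show ?thesis using rank_eq[of "Suc i"] eq by simp
        next
          case False
          then have "Suc i = j + 1" using i \<open>i \<noteq> j + 1\<close> by simp
          then show ?thesis using side_succ[of "j + 1"] nocarry2(2) by simp
        qed
        then show ?thesis using same i False rank_eq eq by simp
      qed
    next
      case carry2
      \<comment> \<open>The carry runs over two positions, which the isolating symbols have to exclude.\<close>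
      have a: "0 < a" using r(1)[of 0] by simp
      obtain w where w: "\<And>s. s < a \<Longrightarrow> e (j + 1) s \<noteq> w \<and> (e (j + 1) s < w \<longleftrightarrow> s < h (j + 1))" "w < n"
        using gap[of "j + 1"] by auto
      have hr: "h (j + 1) \<le> r (j + 1)" and hr': "r' (j + 1) < h (j + 1)"
        using w(1)[OF r(1), of "j + 1"] w(1)[OF r(2), of "j + 1"] w(2)
          x(1)[of "j + 1"] x(2)[of "j + 1"] carry2(2,3) by linarith+
      have r_max: "r (j + 1) = a - 1"
      proof (rule ccontr)
        assume "\<not> ?thesis"
        then have "r (j + 1) < a - 1" using r(1)[of "j + 1"] by simp
        then have "e (j + 1) (r (j + 1)) < e (j + 1) (a - 1)" using gapped_mono[OF g[of "j + 1"]] a by simp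
        moreover have "e (j + 1) (a - 1) < n" using g[of "j + 1"] a by (simp add: gapped_def)
        ultimately show False using x(1)[of "j + 1"] carry2(2) by simp
      qed
      have r'_min: "r' (j + 1) = 0"
        using gapped_mono[OF g[of "j + 1"], of 0 "r' (j + 1)"] r(2)[of "j + 1"] x(2)[of "j + 1"] carry2(3)
        by (cases "r' (j + 1) = 0") auto
      have \<rho>': "\<rho>' (j + 1) = h (j + 1) - 1"
        using bottom r'_min hr' \<rho>(2)[of "j + 1"] by (auto simp: sigma_def split: if_splits)
      consider (nocarry3) "x' j = x j + 1" | (carry3) "x j = n - 1" "x' j = 0"
        using word_num_carry[of n x' j x] carry2(1) xn unfolding S(3) by auto
      note third = this
      obtain u where u: "\<And>s. s < a \<Longrightarrow> e j s \<noteq> u \<and> (e j s < u \<longleftrightarrow> s < h j)" "u < n"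
        using gap[of j] by auto
      from iso have False
      proof
        assume low: "\<rho> j = a - 1 \<and> \<rho> (j + 1) = last_digit_code n a (e j) (h (j + 1))"
        then have ne: "e j (a - 1) \<noteq> n - 1"
          using top r_max hr hr' a by (auto simp: last_digit_code_def split: if_splits)
        have xj: "x j = e j (a - 1)" using dec[of j] hr low x(1)[of j] by simp
        from third show False
        proof cases
          case nocarry3
          then have "e j (a - 1) < e j (r' j)" using xj x(2)[of j] by simp
          then show False using gapped_less_iff[OF g[of j], of "a - 1" "r' j"] r(2)[of j] a by simp
        qed (use xj ne in simp)
      next
        assume up: "\<rho>' j = a - 1 \<and> \<rho>' (j + 1) = last_digit_code n a (e j) (h (j + 1))"
        then have eq: "e j (a - 1) = n - 1"
          using \<rho>' hr hr' r_max a by (auto simp: last_digit_code_def split: if_splits)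
        then have hj: "h j \<le> a - 1" using u(1)[of "a - 1"] u(2) a by linarith
        have "r' j = sigma a (h j) (a - 1)" using dec'[of j] hr' up by simp
        then have rj: "r' j = h j" using hj a by (auto simp: sigma_def)
        have "x' j = e j (h j)" using x(2)[of j] rj by simp
        then have xj: "u < x' j" using u(1)[of "h j"] hj a by linarith
        from third show False
        proof cases
          case nocarry3
          then have "\<not> x j < u" using xj by simp
          then have "h j \<le> r j" using u(1)[OF r(1), of j] x(1)[of j] by (simp add: not_less)
          moreover have "r j < r' j"
            using nocarry3 x gapped_less_iff[OF g[of j] r(1) r(2), of j j] by simp
          ultimately show False using rj by simp
        qed (use xj in simp)
      qed
      then show ?thesis ..
    qed
  qed
qed

text \<open>By \<open>word_num_close\<close>, the words of length \<open>k + 1\<close> of two points at this distance are equal or consecutive integers. The extra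
  digit is needed because decoding looks one symbol ahead.\<close>

lemma isolated_code:
  assumes n: "2 \<le> n" and k: "2 \<le> k"
    and g: "\<And>i. i \<le> k \<Longrightarrow> gapped n a (e i) (h i)"
    and \<rho>: "\<And>i. \<rho> i < a" "\<And>i. \<rho>' i < a" and r: "\<And>i. r i < a" "\<And>i. r' i < a"
    and dec: "\<And>i. i < k \<Longrightarrow> r i = (if h (Suc i) \<le> r (Suc i) then \<rho> i else sigma a (h i) (\<rho> i))"
    and dec': "\<And>i. i < k \<Longrightarrow> r' i = (if h (Suc i) \<le> r' (Suc i) then \<rho>' i else sigma a (h i) (\<rho>' i))"
    and x: "\<And>i. i \<le> k \<Longrightarrow> x i = e i (r i)" "\<And>i. i \<le> k \<Longrightarrow> x' i = e i (r' i)"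
    and xn: "\<And>i. x i < n" "\<And>i. x' i < n"
    and close: "\<bar>val n x - val n x'\<bar> < 1 / real n ^ Suc k"
    and iso: "\<rho> (k - 2) = a - 1" "\<rho> (k - 1) = last_digit_code n a (e (k - 2)) (h (k - 1))"
    and i: "i < k"
  shows "\<rho> i = \<rho>' i"
proof -
  obtain j where j: "k = j + 2" using k by (metis add.commute le_Suc_ex)
  then have Sk: "Suc k = j + 3" by simp
  have "word_num n x (Suc k) \<le> word_num n x' (Suc k) + 1" "word_num n x' (Suc k) \<le> word_num n x (Suc k) + 1"
    using word_num_close[of n x x' "Suc k"] word_num_close[of n x' x "Suc k"] n xn close
    by (simp_all add: abs_minus_commute)
  then consider "word_num n x (Suc k) = word_num n x' (Suc k)" | "word_num n x' (Suc k) = word_num n x (Suc k) + 1"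
    | "word_num n x (Suc k) = word_num n x' (Suc k) + 1" by linarith
  then show ?thesis
  proof cases
    case 1
    have eq: "r m = r' m" if "m \<le> k" for m
    proof -
      have "x m = x' m" using word_num_eq_imp[OF 1 xn, of m] that by simp
      then show ?thesis using gapped_inj[OF g[OF that] r(1) r(2)] x[OF that] by simp
    qed
    have "h i \<le> a" using g[of i] i by (simp add: gapped_def)
    then show ?thesis
      using dec[OF i] dec'[OF i] eq[of i] eq[of "Suc i"] i sigma_inj[OF _ \<rho>(1) \<rho>(2)]
      by (auto split: if_splits)
  next
    case 2
    show ?thesis
      using adjacent_codes[of n j a e h \<rho> \<rho>' r r' x x',
          OF n g[unfolded j] \<rho> r dec[unfolded j] dec'[unfolded j] x[unfolded j] xn 2[unfolded Sk]
            disjI1 i[unfolded j]] iso j by simp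
  next
    case 3
    have "\<rho>' i = \<rho> i"
      using adjacent_codes[of n j a e h \<rho>' \<rho> r' r x' x,
          OF n g[unfolded j] \<rho>(2,1) r(2,1) dec'[unfolded j] dec[unfolded j] x(2,1)[unfolded j] xn(2,1)
            3[unfolded Sk] disjI2 i[unfolded j]] iso j by simp
    then show ?thesis by simp
  qed
qed

section \<open>Carpets as sets of expansions\<close>

definition carpet_point :: "nat \<Rightarrow> nat \<Rightarrow> (nat \<Rightarrow> nat) \<times> (nat \<Rightarrow> nat) \<Rightarrow> real \<times> real" where
  "carpet_point n m p = (val n (fst p), val m (snd p))"

lemma geometric_decay_zero:
  fixes c K b :: real
  assumes "1 < b" "\<And>L. c \<le> K / b ^ L"
  shows "c \<le> 0"
proof (rule ccontr)
  assume "\<not> c \<le> 0"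
  then obtain L where "K / c < b ^ L" using real_arch_pow[OF assms(1)] by blast
  then have "K / b ^ L < c" using \<open>\<not> c \<le> 0\<close> assms(1) by (simp add: field_simps)
  then show False using assms(2)[of L] by simp
qed

text \<open>Iterating the recursion leaves a remainder \<open>u L / b ^ L\<close>, which tends to zero as \<open>u\<close> is bounded.\<close>

lemma val_eqI:
  assumes b: "2 \<le> b" "\<And>i. x i < b"
    and u: "\<And>k. u k = (u (Suc k) + real (x k)) / real b" "\<And>k. \<bar>u k\<bar> \<le> R"
  shows "u 0 = val b x"
proof -
  have un: "u 0 = (real (word_num b x L) + u L) / real b ^ L" for L
  proof (induction L)
    case (Suc L)
    then show ?case unfolding u(1)[of L] using b(1) by (simp add: field_simps)
  qed simp
  have "\<bar>u 0 - val b x\<bar> \<le> (R + 1) / real b ^ L" for L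
  proof -
    have "u 0 - val b x = (u L - val b (\<lambda>i. x (i + L))) / real b ^ L"
      unfolding un[of L] val_word_num[of b x L, OF b] by (simp add: diff_divide_distrib[symmetric])
    moreover have "\<bar>u L - val b (\<lambda>i. x (i + L))\<bar> \<le> R + 1"
      using u(2)[of L] digit_series_bounds(2,3)[of b "\<lambda>i. x (i + L)", OF b] by linarith
    ultimately show ?thesis using b(1) by (simp add: divide_right_mono)
  qed
  then have "\<bar>u 0 - val b x\<bar> \<le> 0" using b(1) by (intro geometric_decay_zero[of "real b"]) auto
  then show ?thesis by simp
qed

lemma prefix_tendsto_val:
  assumes b: "2 \<le> b" "\<And>i. x i < b"
  shows "(\<lambda>L. (real (word_num b x L) + c) / real b ^ L) \<longlonglongrightarrow> val b x"
proof -
  have le: "\<bar>(real (word_num b x L) + c) / real b ^ L - val b x\<bar> \<le> (\<bar>c\<bar> + 1) * (1 / real b) ^ L" for L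
  proof -
    have "(real (word_num b x L) + c) / real b ^ L - val b x = (c - val b (\<lambda>i. x (i + L))) / real b ^ L"
      unfolding val_word_num[of b x L, OF b] by (simp add: diff_divide_distrib[symmetric])
    moreover have "\<bar>c - val b (\<lambda>i. x (i + L))\<bar> \<le> \<bar>c\<bar> + 1"
      using digit_series_bounds(2,3)[of b "\<lambda>i. x (i + L)", OF b] by linarith
    ultimately show ?thesis using b(1) by (simp add: divide_right_mono power_divide)
  qed
  have "(\<lambda>L. (\<bar>c\<bar> + 1) * (1 / real b) ^ L) \<longlonglongrightarrow> 0"
    using b(1) by (intro tendsto_mult_right_zero LIMSEQ_power_zero) auto
  then have "(\<lambda>L. (real (word_num b x L) + c) / real b ^ L - val b x) \<longlonglongrightarrow> 0"
    by (rule Lim_null_comparison[rotated]) (use le in auto)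
  then show ?thesis by (rule LIM_zero_cancel)
qed

text \<open>Both inclusions iterate the equation that defines \<open>E\<close>. Following a point backwards through the maps produces
  its digits. Conversely, the images of a point of \<open>E\<close> under longer and longer compositions of the maps stay in the
  closed set \<open>E\<close> and converge to the coded point.\<close>

lemma carpet_eq_carpet_point:
  assumes nm: "2 \<le> n" "2 \<le> m" and D: "D \<subseteq> {0..<n} \<times> {0..<m}" and E: "is_carpet n m D E"
  shows "E = carpet_point n m ` digit_sequences D"
proof (intro equalityI subsetI)
  have cE: "compact E" "E \<noteq> {}" and eE: "E = (\<Union>d\<in>D. carpet_map n m d ` E)"
    using E unfolding is_carpet_def by blast+
  {
    fix e assume e: "e \<in> E"
    obtain R where R: "\<And>z. z \<in> E \<Longrightarrow> norm z \<le> R"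
      using compact_imp_bounded[OF cE(1)] by (auto simp: bounded_iff)
    have "\<exists>z. \<forall>k. (z k \<in> E \<and> (k = 0 \<longrightarrow> z k = e)) \<and> (\<exists>d\<in>D. z k = carpet_map n m d (z (Suc k)))"
    proof (rule dependent_nat_choice)
      show "\<exists>x. x \<in> E \<and> (0 = 0 \<longrightarrow> x = e)" using e by blast
      fix z k assume "z \<in> E \<and> (k = (0::nat) \<longrightarrow> z = e)"
      then have "z \<in> (\<Union>d\<in>D. carpet_map n m d ` E)" using eE by simp
      then show "\<exists>y. (y \<in> E \<and> (Suc k = 0 \<longrightarrow> y = e)) \<and> (\<exists>d\<in>D. z = carpet_map n m d y)" by auto
    qed
    then obtain z where z: "\<And>k. z k \<in> E" "z 0 = e" "\<And>k. \<exists>d\<in>D. z k = carpet_map n m d (z (Suc k))"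
      by blast
    then obtain d where d: "\<And>k. d k \<in> D" "\<And>k. z k = carpet_map n m (d k) (z (Suc k))" by metis
    have lt: "fst (d k) < n" "snd (d k) < m" for k using d(1)[of k] D by auto
    have bd: "\<bar>fst (z k)\<bar> \<le> R" "\<bar>snd (z k)\<bar> \<le> R" for k
    proof -
      have "norm (fst (z k)) \<le> norm (z k)" "norm (snd (z k)) \<le> norm (z k)"
        using norm_fst_le[of "fst (z k)" "snd (z k)"] norm_snd_le[of "snd (z k)" "fst (z k)"] by simp_all
      then show "\<bar>fst (z k)\<bar> \<le> R" "\<bar>snd (z k)\<bar> \<le> R" using R[OF z(1)[of k]] by simp_all
    qed
    have rec: "fst (z k) = (fst (z (Suc k)) + real (fst (d k))) / real n"
         "snd (z k) = (snd (z (Suc k)) + real (snd (d k))) / real m" for k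
      using arg_cong[OF d(2)[of k], of fst] arg_cong[OF d(2)[of k], of snd]
      by (simp_all add: carpet_map_def divide_inverse mult.commute)
    have "fst (z 0) = val n (\<lambda>k. fst (d k))"
      by (rule val_eqI[of n "\<lambda>k. fst (d k)" "\<lambda>k. fst (z k)" R]) (fact nm lt rec bd)+
    moreover have "snd (z 0) = val m (\<lambda>k. snd (d k))"
      by (rule val_eqI[of m "\<lambda>k. snd (d k)" "\<lambda>k. snd (z k)" R]) (fact nm lt rec bd)+
    ultimately have "e = carpet_point n m (\<lambda>k. fst (d k), \<lambda>k. snd (d k))"
      using z(2) by (simp add: carpet_point_def prod_eq_iff)
    moreover have "(\<lambda>k. fst (d k), \<lambda>k. snd (d k)) \<in> digit_sequences D"
      using d(1) by (simp add: digit_sequences_def)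
    ultimately show "e \<in> carpet_point n m ` digit_sequences D" by blast
  next
    fix e assume "e \<in> carpet_point n m ` digit_sequences D"
    then obtain x y where "(x, y) \<in> digit_sequences D" "e = carpet_point n m (x, y)" by auto
    then have xy: "\<And>k. (x k, y k) \<in> D" "e = (val n x, val m y)"
      by (simp_all add: digit_sequences_def carpet_point_def)
    then have lt: "\<And>k. x k < n" "\<And>k. y k < m" using D by fastforce+
    have mem: "((real (word_num n x L) + fst w) / real n ^ L, (real (word_num m y L) + snd w) / real m ^ L) \<in> E"
      if "w \<in> E" for w L
      using that
    proof (induction L arbitrary: w)
      case (Suc L)
      have "carpet_map n m (x L, y L) w \<in> E" by (subst eE) (use xy(1) Suc.prems in blast)
      from Suc.IH[OF this] show ?case using nm by (simp add: carpet_map_def field_simps)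
    qed simp
    obtain w where w: "w \<in> E" using cE(2) by auto
    have "(\<lambda>L. ((real (word_num n x L) + fst w) / real n ^ L, (real (word_num m y L) + snd w) / real m ^ L)) \<longlonglongrightarrow> e"
      unfolding xy(2) using nm lt by (intro tendsto_Pair prefix_tendsto_val)
    then show "e \<in> E" by (rule closed_sequentially[OF compact_imp_closed[OF cE(1)] mem[OF w]])
  }
qed

text \<open>The height of the segment is the fixed point of the vertical contraction that belongs to row \<open>j\<close>.\<close>

lemma is_carpet_segment:
  assumes nm: "2 \<le> n" "2 \<le> m"
  shows "is_carpet n m ({0..<n} \<times> {j}) ({0..1::real} \<times> {real j / (real m - 1)})"
proof -
  define y where "y = real j / (real m - 1)"
  have y: "inverse (real m) * (y + real j) = y"
    using nm by (simp add: y_def field_simps)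
  have "{0..1::real} \<times> {y} = (\<Union>d\<in>{0..<n} \<times> {j}. carpet_map n m d ` ({0..1::real} \<times> {y}))"
  proof (intro equalityI subsetI)
    fix z assume "z \<in> {0..1::real} \<times> {y}"
    then obtain u where u: "z = (u, y)" "0 \<le> u" "u \<le> 1" by auto
    define i where "i = min (n - 1) (nat \<lfloor>u * real n\<rfloor>)"
    have "i < n" using nm unfolding i_def by linarith
    have fl: "real (nat \<lfloor>u * real n\<rfloor>) \<le> u * real n" "u * real n < real (nat \<lfloor>u * real n\<rfloor>) + 1"
      using u nm by (simp_all add: of_nat_nat)
    have un: "u * real n \<le> real n" using u nm by (simp add: mult_left_le_one_le)
    have i: "real i \<le> u * real n" "u * real n \<le> real i + 1"
    proof -
      show "real i \<le> u * real n" using fl(1) by (simp add: i_def min_def)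
      show "u * real n \<le> real i + 1"
        using fl(2) un nm by (cases "n - 1 \<le> nat \<lfloor>u * real n\<rfloor>") (auto simp: i_def min_def of_nat_diff)
    qed
    have "z = carpet_map n m (i, j) (u * real n - real i, y)"
      using u y nm by (simp add: carpet_map_def)
    moreover have "(u * real n - real i, y) \<in> {0..1::real} \<times> {y}" using i by simp
    ultimately show "z \<in> (\<Union>d\<in>{0..<n} \<times> {j}. carpet_map n m d ` ({0..1::real} \<times> {y}))"
      using \<open>i < n\<close> by (intro UN_I[of "(i, j)"]) auto
  next
    fix z assume "z \<in> (\<Union>d\<in>{0..<n} \<times> {j}. carpet_map n m d ` ({0..1::real} \<times> {y}))"
    then obtain i u where "i < n" "0 \<le> u" "u \<le> 1" "z = carpet_map n m (i, j) (u, y)" by auto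
    moreover from this have "u + real i \<le> real n" by linarith
    ultimately show "z \<in> {0..1::real} \<times> {y}" using y nm by (simp add: carpet_map_def field_simps)
  qed
  then show ?thesis unfolding is_carpet_def y_def by (auto intro: compact_Times)
qed

text \<open>The expansions that use only a full row make up a horizontal segment inside \<open>E\<close>.\<close>

lemma totally_disconnected_no_full_row:
  assumes nm: "2 \<le> n" "2 \<le> m" and D: "D \<subseteq> {0..<n} \<times> {0..<m}" and E: "is_carpet n m D E"
    and td: "totally_disconnected E"
  shows "\<not> {0..<n} \<times> {j} \<subseteq> D"
proof
  assume full: "{0..<n} \<times> {j} \<subseteq> D"
  define S where "S = ({0..1::real} \<times> {real j / (real m - 1)})"
  have sub: "{0..<n} \<times> {j} \<subseteq> {0..<n} \<times> {0..<m}" using full D by blast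
  have "S = carpet_point n m ` digit_sequences ({0..<n} \<times> {j})"
    unfolding S_def by (rule carpet_eq_carpet_point[OF nm sub is_carpet_segment[OF nm]])
  also have "\<dots> \<subseteq> carpet_point n m ` digit_sequences D"
    using full by (intro image_mono) (auto simp: digit_sequences_def)
  also have "\<dots> = E" using carpet_eq_carpet_point[OF nm D E] by simp
  finally have SE: "S \<subseteq> E" .
  have "connected S" unfolding S_def by (intro connected_Times) auto
  moreover have in0: "(0, real j / (real m - 1)) \<in> S" and in1: "(1, real j / (real m - 1)) \<in> S" by (auto simp: S_def)
  ultimately have "S \<subseteq> connected_component_set E (0, real j / (real m - 1))"
    using SE by (intro connected_component_maximal)
  also have "\<dots> = {(0, real j / (real m - 1))}"
    using td in0 SE unfolding totally_disconnected_def by blast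
  finally show False using in1 by auto
qed

section \<open>Vacant columns and confinement\<close>

fun words :: "nat \<Rightarrow> (nat \<Rightarrow> nat set) \<Rightarrow> nat \<Rightarrow> nat set" where
  "words n A 0 = {0}"
| "words n A (Suc L) = (\<lambda>(X, d). n * X + d) ` (words n A L \<times> A L)"

lemma word_num_in_words: "(\<And>i. i < L \<Longrightarrow> x i \<in> A i) \<Longrightarrow> word_num n x L \<in> words n A L"
  by (induction L) force+

lemma words_cong: "(\<And>i. i < L \<Longrightarrow> A i = A' i) \<Longrightarrow> words n A L = words n A' L"
  by (induction L) auto

text \<open>The quotient by \<open>n ^ s\<close> determines all digits but the last \<open>s\<close>.\<close>

lemma card_words_in_block:
  assumes A: "\<And>i. i < L + s \<Longrightarrow> A i \<subseteq> {..<n} \<and> card (A i) \<le> a"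
  shows "finite {Z\<in>words n A (L + s). Z div n ^ s = j} \<and> card {Z\<in>words n A (L + s). Z div n ^ s = j} \<le> a ^ s"
  using A
proof (induction s)
  case 0
  have "{Z\<in>words n A (L + 0). Z div n ^ 0 = j} \<subseteq> {j}" by auto
  then show ?case using card_mono[of "{j}"] finite_subset[of _ "{j}"] by fastforce
next
  case (Suc s)
  define P where "P = {Z\<in>words n A (L + s). Z div n ^ s = j}"
  have P: "finite P" "card P \<le> a ^ s" using Suc unfolding P_def by auto
  have A: "A (L + s) \<subseteq> {..<n}" "card (A (L + s)) \<le> a" "finite (A (L + s))"
    using Suc.prems[of "L + s"] finite_subset by auto
  have "{Z\<in>words n A (L + Suc s). Z div n ^ Suc s = j} \<subseteq> (\<lambda>(X, d). n * X + d) ` (P \<times> A (L + s))"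
  proof
    fix Z assume "Z \<in> {Z\<in>words n A (L + Suc s). Z div n ^ Suc s = j}"
    then obtain X d where Z: "X \<in> words n A (L + s)" "d \<in> A (L + s)" "Z = n * X + d" "Z div n ^ Suc s = j"
      by auto
    have "d < n" using Z A by auto
    then have "Z div n = X" using Z by simp
    then have "X div n ^ s = j" using Z(4) by (simp add: div_mult2_eq)
    then show "Z \<in> (\<lambda>(X, d). n * X + d) ` (P \<times> A (L + s))" using Z by (auto simp: P_def)
  qed
  moreover have "card ((\<lambda>(X, d). n * X + d) ` (P \<times> A (L + s))) \<le> a ^ s * a"
  proof -
    have "card ((\<lambda>(X, d). n * X + d) ` (P \<times> A (L + s))) \<le> card (P \<times> A (L + s))"
      using P A by (intro card_image_le) auto
    also have "\<dots> \<le> a ^ s * a" using P A by (simp add: card_cartesian_product mult_le_mono)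
    finally show ?thesis .
  qed
  ultimately show ?case using P A by (simp add: mult.commute)
    (meson card_mono finite_SigmaI finite_imageI finite_subset le_trans)
qed

lemma window_invariant:
  fixes Y Y' m c :: nat
  assumes "(Y + c) mod m \<noteq> 0" "(Y' + c) mod m \<noteq> 0" "Y \<le> Y' + 1" "Y' \<le> Y + 1"
  shows "(Y + c) div m = (Y' + c) div m"
proof -
  have aux: "Suc z div m = z div m" if "Suc z mod m \<noteq> 0" for z
    using that by (simp add: div_Suc)
  consider "Y = Y'" | "Y + c = Suc (Y' + c)" | "Y' + c = Suc (Y + c)" using assms by linarith
  then show ?thesis using aux assms by cases auto
qed

text \<open>A chain that changes both coordinates by at most one in each step cannot pass a row in which it is not allowed to
  step; so it stays in a window of \<open>m\<close> consecutive rows. If, within that window, every block of \<open>b\<close> columns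
  contains a forbidden column, the chain cannot leave the neighbourhood of its block either.\<close>

lemma chain_confined:
  fixes X Y :: "'w \<Rightarrow> nat"
  assumes chain: "R\<^sup>*\<^sup>* w w'" and w: "w \<in> A" and m: "0 < m"
    and step: "\<And>u u'. R u u' \<Longrightarrow> u \<in> A \<and> u' \<in> A \<and> X u \<le> X u' + 1 \<and> X u' \<le> X u + 1
                          \<and> Y u \<le> Y u' + 1 \<and> Y u' \<le> Y u + 1"
    and Y: "\<And>u. u \<in> A \<Longrightarrow> (Y u + c) mod m \<noteq> 0"
    and X: "\<And>j q. \<exists>z. z div b = j \<and> z \<notin> X ` {u\<in>A. (Y u + c) div m = q}"
    and b: "0 < b"
  shows "Y w' \<le> Y w + m" "Y w \<le> Y w' + m" "X w' \<le> X w + 2 * b" "X w \<le> X w' + 2 * b"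
proof -
  define V where "V = {u\<in>A. (Y u + c) div m = (Y w + c) div m}"
  have stepV: "u' \<in> V" if "R u u'" "u \<in> V" for u u'
    using that step[OF that(1)] window_invariant[of "Y u" c m "Y u'"] Y by (auto simp: V_def)
  have wV: "w \<in> V" using w by (simp add: V_def)
  have inV: "w' \<in> V" using chain wV by (induction rule: rtranclp_induct) (auto intro: stepV)
  have close: "P \<le> Q + m" if "(P + c) div m = (Q + c) div m" for P Q :: nat
  proof -
    have "P + c = (P + c) div m * m + (P + c) mod m" "Q + c = (Q + c) div m * m + (Q + c) mod m" by simp_all
    moreover have "(P + c) mod m < m" using m by simp
    moreover have "(P + c) div m * m = (Q + c) div m * m" using that by simp
    ultimately show ?thesis by linarith
  qed
  show "Y w' \<le> Y w + m" "Y w \<le> Y w' + m" using inV by (auto simp: V_def intro: close)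
  have barrier: "X u' < z \<longleftrightarrow> X u < z" if "R\<^sup>*\<^sup>* u u'" "u \<in> V" "z \<notin> X ` V" for u u' z
    using that(1,2)
  proof (induction rule: rtranclp_induct)
    case (step y y')
    have "y \<in> V" using step(1,4) by (induction rule: rtranclp_induct) (auto intro: stepV)
    then have "X y \<noteq> z" "X y' \<noteq> z" using that(3) stepV[OF step(2)] by auto
    then show ?case using step assms(4)[OF step(2)] by linarith
  qed simp
  have gap: "\<exists>z. P < z \<and> z \<le> P + 2 * b \<and> z \<notin> X ` V" for P
  proof -
    obtain z where z: "z div b = P div b + 1" "z \<notin> X ` V" using X[of "P div b + 1"] by (auto simp: V_def)
    have "z = z div b * b + z mod b" "P = P div b * b + P mod b" by simp_all
    moreover have "z mod b < b" "P mod b < b" using b by simp_all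
    moreover have "z div b * b = P div b * b + b" using z(1) by simp
    ultimately have "P < z" "z \<le> P + 2 * b" by linarith+
    then show ?thesis using z by blast
  qed
  show "X w' \<le> X w + 2 * b"
  proof -
    obtain z where "X w < z" "z \<le> X w + 2 * b" "z \<notin> X ` V" using gap by blast
    then show ?thesis using barrier[OF chain wV] by fastforce
  qed
  show "X w \<le> X w' + 2 * b"
  proof -
    obtain z where "X w' < z" "z \<le> X w' + 2 * b" "z \<notin> X ` V" using gap by blast
    then show ?thesis using barrier[OF chain wV] by fastforce
  qed
qed

lemma card_image_factor:
  assumes "finite (g ` T)" "\<And>x y. \<lbrakk>x \<in> T; y \<in> T; g x = g y\<rbrakk> \<Longrightarrow> f x = f y"
  shows "card (f ` T) \<le> card (g ` T)"
proof -
  define F where "F k = f (SOME y. y \<in> T \<and> g y = k)" for k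
  have "f x = F (g x)" if "x \<in> T" for x
  proof -
    have "(SOME y. y \<in> T \<and> g y = g x) \<in> T \<and> g (SOME y. y \<in> T \<and> g y = g x) = g x"
      using that by (intro someI[of "\<lambda>y. y \<in> T \<and> g y = g x" x]) auto
    then show ?thesis unfolding F_def using assms(2)[OF that] by auto
  qed
  then have "f ` T = F ` g ` T" unfolding image_image by (rule image_cong[OF refl])
  then show ?thesis using card_image_le[OF assms(1), of F] by simp
qed

lemma decode_eq:
  assumes "\<And>i. h i \<le> a" "\<And>i. \<rho> i < a"
  shows "decode a h \<rho> i = (if h (Suc i) \<le> decode a h \<rho> (Suc i) then \<rho> i else sigma a (h i) (\<rho> i))"
  using decode_side[of h a \<rho> "Suc i", OF assms] by (simp add: decode_def)

text \<open>Reading from right to left, each symbol is recovered from the decoded rank and the symbol after it.\<close>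

lemma decode_cancel:
  assumes h: "\<And>i. h i \<le> a" and \<rho>: "\<And>i. \<rho> i < a" "\<And>i. \<rho>' i < a"
    and hh: "\<And>i. i \<le> k \<Longrightarrow> h' i = h i"
    and eq: "\<And>i. i < k \<Longrightarrow> decode a h \<rho> i = decode a h' \<rho>' i" and last: "\<rho> k = \<rho>' k"
    and i: "i \<le> k"
  shows "\<rho> i = \<rho>' i"
  using i
proof (induction i rule: inc_induct)
  case base
  show ?case by (rule last)
next
  case (step i)
  then show ?case
    using eq[of i] hh[of i] hh[of "Suc i"] sigma_inj[OF h[of i] \<rho>(1)[of i] \<rho>(2)[of i]]
    by (auto simp: decode_def split: if_splits)
qed

lemma last_digit_code_less: "\<lbrakk>0 < a; h \<le> a\<rbrakk> \<Longrightarrow> last_digit_code n a e h < a"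
  by (auto simp: last_digit_code_def)

section \<open>Codes of a carpet with uniform fibers\<close>

text \<open>There are \<open>N\<close> non-vacant rows, listed by \<open>eH\<close>, and each of them has \<open>a\<close> digits, listed by \<open>eD j\<close> for row \<open>j\<close>. The
  numbers \<open>hH\<close> and \<open>hD j\<close> belong to a vacant row and to a vacant digit of row \<open>j\<close>.\<close>

locale carpet_code =
  fixes n m a N :: nat and eH :: "nat \<Rightarrow> nat" and hH :: nat
    and eD :: "nat \<Rightarrow> nat \<Rightarrow> nat" and hD :: "nat \<Rightarrow> nat"
  assumes m2: "2 \<le> m" and mn: "m < n" and a_pos: "0 < a" and an: "a < n" and N_pos: "0 < N"
    and two_digits: "1 < N \<or> 1 < a"
    and rows_gapped: "gapped m N eH hH"
    and cols_gapped: "r < N \<Longrightarrow> gapped n a (eD (eH r)) (hD (eH r))"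
begin

text \<open>A code consists of the symbols \<open>\<rho>\<close> for the columns and \<open>\<eta>\<close> for the rows. Uniform fibers make the set of codes a
  product, and its tree of prefixes homogeneous.\<close>

definition codes :: "((nat \<Rightarrow> nat) \<times> (nat \<Rightarrow> nat)) set" where
  "codes = {(\<rho>, \<eta>). \<forall>i. \<rho> i < a \<and> \<eta> i < N}"

definition ydig :: "(nat \<Rightarrow> nat) \<Rightarrow> nat \<Rightarrow> nat" where
  "ydig \<eta> i = eH (decode N (\<lambda>_. hH) \<eta> i)"

text \<open>The cut of a cylinder depends on the row, so the column symbols are decoded along the rows that \<open>\<eta>\<close> produces.\<close>

definition xdig :: "(nat \<Rightarrow> nat) \<Rightarrow> (nat \<Rightarrow> nat) \<Rightarrow> nat \<Rightarrow> nat" where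
  "xdig \<rho> \<eta> i = eD (ydig \<eta> i) (decode a (\<lambda>i. hD (ydig \<eta> i)) \<rho> i)"

definition point :: "(nat \<Rightarrow> nat) \<times> (nat \<Rightarrow> nat) \<Rightarrow> real \<times> real" where
  "point = (\<lambda>(\<rho>, \<eta>). (val n (xdig \<rho> \<eta>), val m (ydig \<eta>)))"

text \<open>The same codes read without the shift. This identifies them with the pairs of sequences that form the symbolic space.\<close>

definition plain :: "(nat \<Rightarrow> nat) \<times> (nat \<Rightarrow> nat) \<Rightarrow> (nat \<Rightarrow> nat) \<times> (nat \<Rightarrow> nat)" where
  "plain = (\<lambda>(\<rho>, \<eta>). (\<lambda>i. eD (eH (\<eta> i)) (\<rho> i), \<lambda>i. eH (\<eta> i)))"

definition digits :: "(nat \<times> nat) set" where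
  "digits = {(eD (eH r) q, eH r) | q r. q < a \<and> r < N}"

lemma n2: "2 \<le> n" using m2 mn by simp

lemma codesD: "(\<rho>, \<eta>) \<in> codes \<Longrightarrow> \<rho> i < a" "(\<rho>, \<eta>) \<in> codes \<Longrightarrow> \<eta> i < N"
  by (auto simp: codes_def)

lemma hH_le: "hH \<le> N" using rows_gapped by (simp add: gapped_def)

lemma ydig_rank_less: "(\<And>i. \<eta> i < N) \<Longrightarrow> decode N (\<lambda>_. hH) \<eta> i < N"
  by (rule decode_less) (auto simp: hH_le)

lemma ydig_gapped: "(\<And>i. \<eta> i < N) \<Longrightarrow> gapped n a (eD (ydig \<eta> i)) (hD (ydig \<eta> i))"
  unfolding ydig_def using cols_gapped ydig_rank_less by blast

lemma hD_le: "(\<And>i. \<eta> i < N) \<Longrightarrow> hD (ydig \<eta> i) \<le> a"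
  using ydig_gapped[of \<eta> i] by (simp add: gapped_def)

lemma ydig_less: "(\<And>i. \<eta> i < N) \<Longrightarrow> ydig \<eta> i < m"
  unfolding ydig_def using rows_gapped ydig_rank_less by (simp add: gapped_def)

lemma xdig_rank_less: "(\<rho>, \<eta>) \<in> codes \<Longrightarrow> decode a (\<lambda>i. hD (ydig \<eta> i)) \<rho> i < a"
  by (rule decode_less) (auto simp: hD_le codesD)

lemma xdig_less: "(\<rho>, \<eta>) \<in> codes \<Longrightarrow> xdig \<rho> \<eta> i < n"
  unfolding xdig_def using ydig_gapped[of \<eta> i] xdig_rank_less[of \<rho> \<eta> i] codesD(2)[of \<rho> \<eta>]
  by (simp add: gapped_def)

lemma eH_inj: "r < N \<Longrightarrow> r' < N \<Longrightarrow> eH r = eH r' \<Longrightarrow> r = r'"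
  by (rule gapped_inj[OF rows_gapped])

lemma point_image: "point ` codes = carpet_point n m ` digit_sequences digits"
proof (intro equalityI subsetI)
  fix z assume "z \<in> point ` codes"
  then obtain \<rho> \<eta> where c: "(\<rho>, \<eta>) \<in> codes" "z = point (\<rho>, \<eta>)" by auto
  have "(xdig \<rho> \<eta> k, ydig \<eta> k) \<in> digits" for k
    using ydig_rank_less[of \<eta> k] xdig_rank_less[OF c(1), of k] codesD[OF c(1)]
    unfolding digits_def xdig_def ydig_def by auto
  then show "z \<in> carpet_point n m ` digit_sequences digits"
    using c(2) by (intro image_eqI[of _ _ "(xdig \<rho> \<eta>, ydig \<eta>)"])
      (simp_all add: point_def carpet_point_def digit_sequences_def)
next
  fix z assume "z \<in> carpet_point n m ` digit_sequences digits"
  then obtain x y where "(x, y) \<in> digit_sequences digits" "z = carpet_point n m (x, y)" by auto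
  then have xy: "\<And>k. (x k, y k) \<in> digits" "z = (val n x, val m y)"
    by (simp_all add: digit_sequences_def carpet_point_def)
  have "\<forall>k. \<exists>q r. q < a \<and> r < N \<and> x k = eD (eH r) q \<and> y k = eH r"
    using xy(1) unfolding digits_def by blast
  then obtain q r where qr: "\<And>k. q k < a" "\<And>k. r k < N" "\<And>k. x k = eD (eH (r k)) (q k)" "\<And>k. y k = eH (r k)"
    by metis
  obtain \<eta> where \<eta>: "\<forall>i. \<eta> i < N" "decode N (\<lambda>_. hH) \<eta> = r"
    using decode_surj[of "\<lambda>_. hH" N r] hH_le qr(2) by blast
  have row: "ydig \<eta> = y" using \<eta> qr(4) by (auto simp: ydig_def)
  have "hD (ydig \<eta> i) \<le> a" for i using hD_le \<eta> by blast
  then obtain \<rho> where \<rho>: "\<forall>i. \<rho> i < a" "decode a (\<lambda>i. hD (ydig \<eta> i)) \<rho> = q"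
    using decode_surj[of "\<lambda>i. hD (ydig \<eta> i)" a q] qr(1) by blast
  have "xdig \<rho> \<eta> = x" using \<rho>(2) qr row by (auto simp: xdig_def)
  then have "z = point (\<rho>, \<eta>)" using row xy by (simp add: point_def)
  moreover have "(\<rho>, \<eta>) \<in> codes" using \<rho> \<eta> by (simp add: codes_def)
  ultimately show "z \<in> point ` codes" by blast
qed

lemma digit_sequences_plain: "plain ` codes = digit_sequences digits"
proof (intro equalityI subsetI)
  fix p assume "p \<in> digit_sequences digits"
  then obtain x y where p: "p = (x, y)" "\<And>k. (x k, y k) \<in> digits" by (auto simp: digit_sequences_def)
  have "\<forall>k. \<exists>q r. q < a \<and> r < N \<and> x k = eD (eH r) q \<and> y k = eH r"
    using p(2) unfolding digits_def by blast
  then obtain q r where qr: "\<And>k. q k < a" "\<And>k. r k < N" "\<And>k. x k = eD (eH (r k)) (q k)" "\<And>k. y k = eH (r k)"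
    by metis
  then have "p = plain (q, r)" "(q, r) \<in> codes" using p by (auto simp: plain_def codes_def)
  then show "p \<in> plain ` codes" by blast
qed (auto simp: plain_def codes_def digit_sequences_def digits_def)

lemma word_num_xdig_in_words:
  assumes "(\<rho>, \<eta>) \<in> codes"
  shows "word_num n (xdig \<rho> \<eta>) L \<in> words n (\<lambda>i. eD (ydig \<eta> i) ` {..<a}) L"
  using xdig_rank_less[OF assms] by (intro word_num_in_words) (auto simp: xdig_def)

lemma row_not_vacant:
  obtains v where "v < m" "\<And>\<eta> K. (\<And>i. \<eta> i < N) \<Longrightarrow> 0 < K \<Longrightarrow> (word_num m (ydig \<eta>) K + (m - v)) mod m \<noteq> 0"
proof -
  obtain v where v: "v < m" "\<And>r. r < N \<Longrightarrow> eH r \<noteq> v" using rows_gapped by (auto simp: gapped_def)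
  have "(word_num m (ydig \<eta>) K + (m - v)) mod m \<noteq> 0" if \<eta>: "\<And>i. \<eta> i < N" and "0 < K" for \<eta> K
  proof -
    obtain k where K: "K = Suc k" using \<open>0 < K\<close> gr0_implies_Suc by blast
    have r: "ydig \<eta> k \<noteq> v" "ydig \<eta> k < m" using v(2) ydig_rank_less[OF \<eta>] ydig_less[OF \<eta>] by (auto simp: ydig_def)
    have "(word_num m (ydig \<eta>) K + (m - v)) mod m = (ydig \<eta> k + (m - v)) mod m"
      unfolding K by (simp add: add.assoc)
    also have "\<dots> \<noteq> 0"
    proof
      assume "(ydig \<eta> k + (m - v)) mod m = 0"
      then obtain c where c: "ydig \<eta> k + (m - v) = m * c" by (auto simp: mod_eq_0_iff_dvd dvd_def)
      have "0 < m * c" "m * c < m * 2" using r v(1) c by linarith+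
      then have "c = 1" by simp
      then show False using c r v(1) by simp
    qed
    finally show ?thesis .
  qed
  then show thesis using v(1) that by blast
qed

lemma same_num_same_rows:
  "\<lbrakk>word_num m (ydig \<eta>) K = word_num m (ydig \<eta>') K; \<And>i. \<eta> i < N; \<And>i. \<eta>' i < N; i < K\<rbrakk> \<Longrightarrow> ydig \<eta> i = ydig \<eta>' i"
  using word_num_eq_imp[of m "ydig \<eta>" K "ydig \<eta>'" i] ydig_less by blast

text \<open>A window of \<open>m\<close> consecutive integers contains at most \<open>m\<close> row words, and the points of one row word meet at most
  \<open>a ^ s\<close> columns of a block of \<open>n ^ s\<close> columns.\<close>

lemma vacant_column:
  assumes "s \<le> L" "L \<le> K" "m * a ^ s < n ^ s"
  shows "\<exists>z. z div n ^ s = j \<and> z \<notin> (\<lambda>(\<rho>, \<eta>). word_num n (xdig \<rho> \<eta>) L) `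
            {(\<rho>, \<eta>). (\<rho>, \<eta>) \<in> codes \<and> (word_num m (ydig \<eta>) K + c) div m = q}"
proof -
  define V where "V = {(\<rho>, \<eta>). (\<rho>, \<eta>) \<in> codes \<and> (word_num m (ydig \<eta>) K + c) div m = q}"
  define W where "W = {Y. (Y + c) div m = q}"
  define X where "X Y = {word_num n (xdig \<rho> \<eta>) L | \<rho> \<eta>. (\<rho>, \<eta>) \<in> codes \<and> word_num m (ydig \<eta>) K = Y
                          \<and> word_num n (xdig \<rho> \<eta>) L div n ^ s = j}" for Y
  have W: "finite W \<and> card W \<le> m"
  proof -
    have "W \<subseteq> (\<lambda>i. q * m + i - c) ` {..<m}"
    proof
      fix Y assume "Y \<in> W"
      then have "Y = q * m + (Y + c) mod m - c" using div_mult_mod_eq[of "Y + c" m] by (auto simp: W_def)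
      moreover have "(Y + c) mod m < m" using m2 by simp
      ultimately show "Y \<in> (\<lambda>i. q * m + i - c) ` {..<m}" by blast
    qed
    then show ?thesis using card_image_le[of "{..<m}" "\<lambda>i. q * m + i - c"]
      by (metis (no_types, lifting) card_lessThan card_mono finite_imageI finite_lessThan finite_subset le_trans)
  qed
  have X: "finite (X Y) \<and> card (X Y) \<le> a ^ s" for Y
  proof (cases "\<exists>\<rho> \<eta>. (\<rho>, \<eta>) \<in> codes \<and> word_num m (ydig \<eta>) K = Y")
    case True
    then obtain \<rho>0 \<eta>0 where 0: "(\<rho>0, \<eta>0) \<in> codes" "word_num m (ydig \<eta>0) K = Y" by blast
    define A where "A i = eD (ydig \<eta>0 i) ` {..<a}" for i
    have A: "A i \<subseteq> {..<n} \<and> card (A i) \<le> a" for i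
      using ydig_gapped[of \<eta>0 i] codesD(2)[OF 0(1)] card_image_le[of "{..<a}" "eD (ydig \<eta>0 i)"]
      by (auto simp: A_def gapped_def)
    obtain L' where L': "L = L' + s" using assms(1) by (metis add.commute le_Suc_ex)
    have "X Y \<subseteq> {Z\<in>words n A (L' + s). Z div n ^ s = j}"
    proof
      fix Z assume "Z \<in> X Y"
      then obtain \<rho> \<eta> where z: "(\<rho>, \<eta>) \<in> codes" "word_num m (ydig \<eta>) K = Y" "Z div n ^ s = j"
          "Z = word_num n (xdig \<rho> \<eta>) L" by (auto simp: X_def)
      have "ydig \<eta> i = ydig \<eta>0 i" if "i < L" for i
        using same_num_same_rows[of \<eta> K \<eta>0 i] z 0 codesD that assms(2) by simp
      then have "words n (\<lambda>i. eD (ydig \<eta> i) ` {..<a}) L = words n A L"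
        by (intro words_cong) (simp add: A_def)
      then show "Z \<in> {Z\<in>words n A (L' + s). Z div n ^ s = j}"
        using word_num_xdig_in_words[OF z(1), of L] z L' by simp
    qed
    then show ?thesis using card_words_in_block[of L' s A n a j] A
      by (meson card_mono finite_subset le_trans)
  next
    case False
    then have "X Y = {}" by (auto simp: X_def)
    then show ?thesis by simp
  qed
  have fin: "finite (\<Union>Y\<in>W. X Y)" using W X by blast
  have "card (\<Union>Y\<in>W. X Y) \<le> (\<Sum>Y\<in>W. card (X Y))" using W by (intro card_UN_le) auto
  also have "\<dots> \<le> card W * a ^ s" using X sum_bounded_above[of W "\<lambda>Y. card (X Y)"] by simp
  also have "\<dots> \<le> m * a ^ s" using W by simp
  also have "\<dots> < card {j * n ^ s..<j * n ^ s + n ^ s}" using assms(3) by simp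
  finally have "\<not> {j * n ^ s..<j * n ^ s + n ^ s} \<subseteq> (\<Union>Y\<in>W. X Y)" using fin card_mono linorder_not_le by blast
  then obtain z where "z \<in> {j * n ^ s..<j * n ^ s + n ^ s}" and z': "z \<notin> (\<Union>Y\<in>W. X Y)" by blast
  then have z: "j * n ^ s \<le> z" "z < j * n ^ s + n ^ s" "z \<notin> (\<Union>Y\<in>W. X Y)" by simp_all
  have "z div n ^ s = j" using z(1,2) n2 by (intro div_nat_eqI) (simp_all add: mult.commute)
  moreover have "z \<notin> (\<lambda>(\<rho>, \<eta>). word_num n (xdig \<rho> \<eta>) L) ` V"
    using z(3) \<open>z div n ^ s = j\<close> by (auto simp: V_def W_def X_def)
  ultimately show ?thesis unfolding V_def by blast
qed

end

section \<open>Scales\<close>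

text \<open>A cell of level \<open>t\<close> prescribes \<open>S * t\<close> row symbols and \<open>ll t\<close> column symbols, where \<open>n ^ ll t\<close> approximates \<open>m ^ (S * t)\<close>, so that
  its width and height are comparable. The exponent \<open>s\<close> provides vacant columns. The number \<open>2 ^ M\<close>
  dominates the size of clusters, and \<open>S\<close> is so large that every level appends at least \<open>M + 2\<close> symbols of both kinds
  and that the rows needed to decode the column symbols of a cell are determined by its row symbols.\<close>

locale carpet_scales = carpet_code +
  fixes s M S :: nat and ll :: "nat \<Rightarrow> nat"
  assumes s: "m * a ^ s < n ^ s"
    and M: "(2 * m + 1) * (4 * n ^ s + 1) * N * a \<le> 2 ^ M"
    and S: "M + 2 \<le> S" "n ^ (M + 3) \<le> m ^ S" "n * m ^ S < n ^ S"
    and ll: "n ^ ll t \<le> m ^ (S * t)" "m ^ (S * t) < n ^ Suc (ll t)"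
begin

definition lab :: "nat \<Rightarrow> (nat \<Rightarrow> nat) \<times> (nat \<Rightarrow> nat) \<Rightarrow> nat list \<times> nat list" where
  "lab t = (\<lambda>(\<rho>, \<eta>). (map \<rho> [0..<ll t], map \<eta> [0..<S * t]))"

definition \<theta> :: real where "\<theta> = 1 / real m ^ S"

text \<open>Small enough to be below one unit of the next digit in both directions (\<open>eps_le\<close>), large enough to be comparable to the
  size of a cell.\<close>

definition eps :: "nat \<Rightarrow> real" where "eps t = \<theta> ^ t / real n"

lemma lab_eq_iff:
  "lab t (\<rho>, \<eta>) = lab t (\<rho>', \<eta>') \<longleftrightarrow> (\<forall>i<ll t. \<rho> i = \<rho>' i) \<and> (\<forall>i<S * t. \<eta> i = \<eta>' i)"
  by (auto simp: lab_def)

lemma S_pos: "0 < S" using S(1) by simp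

lemma theta: "0 < \<theta>" "\<theta> < 1"
proof -
  have "1 < real m ^ S" using m2 S_pos by (intro one_less_power) auto
  then show "0 < \<theta>" "\<theta> < 1" using m2 by (simp_all add: \<theta>_def divide_less_eq)
qed

lemma theta_power: "\<theta> ^ t = 1 / real m ^ (S * t)"
  by (simp add: \<theta>_def power_divide power_mult)

lemma ll_0: "ll 0 = 0"
proof (rule ccontr)
  assume "ll 0 \<noteq> 0"
  then have "n ^ 1 \<le> n ^ ll 0" using n2 by (intro power_increasing) auto
  then show False using ll(1)[of 0] n2 by simp
qed

lemma ll_step: "ll t + M + 3 \<le> ll (Suc t)"
proof -
  have "n ^ (ll t + M + 3) = n ^ ll t * n ^ (M + 3)" by (simp add: power_add)
  also have "\<dots> \<le> m ^ (S * t) * m ^ S" using ll(1) S(2) by (rule mult_le_mono)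
  also have "\<dots> < n ^ Suc (ll (Suc t))" using ll(2)[of "Suc t"] by (simp add: power_add mult.commute)
  finally have *: "n ^ (ll t + M + 3) < n ^ Suc (ll (Suc t))" .
  have "1 < n" using n2 by simp
  from power_less_imp_less_exp[OF this *] show ?thesis by simp
qed

lemma ll_mono: "t \<le> t' \<Longrightarrow> ll t \<le> ll t'"
proof -
  have "ll k \<le> ll (Suc k)" for k using ll_step[of k] by simp
  then show "t \<le> t' \<Longrightarrow> ll t \<le> ll t'" by (rule lift_Suc_mono_le)
qed

lemma ll_ge: "t \<le> ll t"
proof (induction t)
  case (Suc t)
  then show ?case using ll_step[of t] by simp
qed simp

text \<open>Decoding looks one symbol ahead, and column symbols refer to decoded rows; two spare row symbols take care of this.\<close>

lemma ll_gap: "0 < t \<Longrightarrow> ll t + 2 \<le> S * t"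
proof (rule ccontr)
  assume t: "0 < t" and "\<not> ll t + 2 \<le> S * t"
  then have "n ^ (S * t) \<le> n ^ Suc (ll t)" using n2 by (intro power_increasing) auto
  also have "\<dots> \<le> n * m ^ (S * t)" using ll(1) by simp
  also have "\<dots> \<le> n ^ t * m ^ (S * t)"
  proof -
    have "n ^ 1 \<le> n ^ t" using n2 t by (intro power_increasing) auto
    then show ?thesis by simp
  qed
  also have "\<dots> = (n * m ^ S) ^ t" by (simp add: power_mult_distrib power_mult)
  also have "\<dots> < (n ^ S) ^ t" using S(3) t by (intro power_strict_mono) auto
  finally show False by (simp add: power_mult)
qed

lemma level_pos: "0 < t \<Longrightarrow> 3 \<le> ll t \<and> 5 \<le> S * t"
  using ll_step[of "t - 1"] ll_gap[of t] by (cases t) auto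

lemma ll_le: "ll t \<le> S * t"
  using ll_gap[of t] ll_0 by (cases "t = 0") auto

lemma theta_le_pow: "\<theta> ^ t \<le> 1 / real n ^ ll t"
proof -
  have "real n ^ ll t \<le> real m ^ (S * t)" using ll(1)[of t] by (metis of_nat_le_iff of_nat_power)
  then show ?thesis using n2 by (simp add: theta_power frac_le)
qed

lemma pow_le_theta: "1 / real n ^ ll t \<le> real n * \<theta> ^ t"
proof -
  have "real m ^ (S * t) \<le> real n ^ Suc (ll t)"
    using ll(2)[of t] by (metis less_imp_le of_nat_le_iff of_nat_power)
  then show ?thesis using n2 m2 by (simp add: theta_power field_simps)
qed

lemma eps_le:
  shows "eps t < 1 / real m ^ Suc (S * t)" "eps t \<le> 1 / real n ^ Suc (ll t)"
proof -
  show "eps t < 1 / real m ^ Suc (S * t)"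
    using mn m2 by (simp add: eps_def theta_power field_simps)
  show "eps t \<le> 1 / real n ^ Suc (ll t)"
    using divide_right_mono[OF theta_le_pow[of t], of "real n"] by (simp add: eps_def mult.commute)
qed

lemma dist_point:
  shows "\<bar>val n (xdig \<rho> \<eta>) - val n (xdig \<rho>' \<eta>')\<bar> \<le> dist (point (\<rho>, \<eta>)) (point (\<rho>', \<eta>'))"
    and "\<bar>val m (ydig \<eta>) - val m (ydig \<eta>')\<bar> \<le> dist (point (\<rho>, \<eta>)) (point (\<rho>', \<eta>'))"
    and "dist (point (\<rho>, \<eta>)) (point (\<rho>', \<eta>')) \<le>
      \<bar>val n (xdig \<rho> \<eta>) - val n (xdig \<rho>' \<eta>')\<bar> + \<bar>val m (ydig \<eta>) - val m (ydig \<eta>')\<bar>"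
proof -
  define u v where "u = val n (xdig \<rho> \<eta>) - val n (xdig \<rho>' \<eta>')" and "v = val m (ydig \<eta>) - val m (ydig \<eta>')"
  have d: "dist (point (\<rho>, \<eta>)) (point (\<rho>', \<eta>')) = sqrt (\<bar>u\<bar>\<^sup>2 + \<bar>v\<bar>\<^sup>2)"
    by (simp add: point_def dist_Pair_Pair dist_real_def u_def v_def)
  show "\<bar>u\<bar> \<le> dist (point (\<rho>, \<eta>)) (point (\<rho>', \<eta>'))" unfolding d by (rule real_sqrt_sum_squares_ge1)
  show "\<bar>v\<bar> \<le> dist (point (\<rho>, \<eta>)) (point (\<rho>', \<eta>'))" unfolding d by (rule real_sqrt_sum_squares_ge2)
  show "dist (point (\<rho>, \<eta>)) (point (\<rho>', \<eta>')) \<le> \<bar>u\<bar> + \<bar>v\<bar>"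
    unfolding d by (rule sqrt_sum_squares_le_sum) auto
qed

lemma lab_eq_digits:
  assumes "lab t (\<rho>, \<eta>) = lab t (\<rho>', \<eta>')"
  shows "i + 1 < S * t \<Longrightarrow> ydig \<eta> i = ydig \<eta>' i"
    and "i + 1 < ll t \<Longrightarrow> xdig \<rho> \<eta> i = xdig \<rho>' \<eta>' i"
proof -
  have r: "\<And>i. i < ll t \<Longrightarrow> \<rho> i = \<rho>' i" and e: "\<And>i. i < S * t \<Longrightarrow> \<eta> i = \<eta>' i"
    using assms unfolding lab_eq_iff by auto
  have y: "ydig \<eta> i = ydig \<eta>' i" if "i + 1 < S * t" for i
    using that e[of i] e[of "Suc i"] by (simp add: ydig_def decode_def)
  then show "i + 1 < S * t \<Longrightarrow> ydig \<eta> i = ydig \<eta>' i" .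
  show "xdig \<rho> \<eta> i = xdig \<rho>' \<eta>' i" if i: "i + 1 < ll t"
  proof -
    have "0 < t" using i ll_0 by (cases t) auto
    then have "i + 2 < S * t" using ll_gap[of t] i by simp
    then show ?thesis using y[of i] y[of "Suc i"] r[of i] r[of "Suc i"] i by (simp add: xdig_def decode_def)
  qed
qed

lemma near_num:
  assumes c: "(\<rho>, \<eta>) \<in> codes" "(\<rho>', \<eta>') \<in> codes" and t: "0 < t"
    and "lab t (\<rho>, \<eta>) = lab t (\<rho>', \<eta>') \<or> dist (point (\<rho>, \<eta>)) (point (\<rho>', \<eta>')) < eps t"
  shows "word_num m (ydig \<eta>) (S * t - 1) \<le> word_num m (ydig \<eta>') (S * t - 1) + 1"
    and "word_num n (xdig \<rho> \<eta>) (ll t - 1) \<le> word_num n (xdig \<rho>' \<eta>') (ll t - 1) + 1"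
proof -
  have y: "\<And>i. ydig \<eta> i < m" "\<And>i. ydig \<eta>' i < m" using ydig_less codesD(2) c by blast+
  have x: "\<And>i. xdig \<rho> \<eta> i < n" "\<And>i. xdig \<rho>' \<eta>' i < n" using xdig_less c by blast+
  have le: "1 / real b ^ Suc K \<le> 1 / real b ^ (K - 1)" if "2 \<le> b" for b K :: nat
    using that by (intro divide_left_mono power_increasing) auto
  show "word_num m (ydig \<eta>) (S * t - 1) \<le> word_num m (ydig \<eta>') (S * t - 1) + 1"
    using assms(4)
  proof
    assume "lab t (\<rho>, \<eta>) = lab t (\<rho>', \<eta>')"
    then have "word_num m (ydig \<eta>) (S * t - 1) = word_num m (ydig \<eta>') (S * t - 1)"
      using lab_eq_digits(1) by (intro word_num_cong) auto
    then show ?thesis by simp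
  next
    assume "dist (point (\<rho>, \<eta>)) (point (\<rho>', \<eta>')) < eps t"
    then have "\<bar>val m (ydig \<eta>) - val m (ydig \<eta>')\<bar> < 1 / real m ^ (S * t - 1)"
      using dist_point(2)[of \<eta> \<eta>' \<rho> \<rho>'] eps_le(1)[of t] le[OF m2, of "S * t"] by linarith
    then show ?thesis using word_num_close[of m "ydig \<eta>" "ydig \<eta>'"] m2 y by blast
  qed
  show "word_num n (xdig \<rho> \<eta>) (ll t - 1) \<le> word_num n (xdig \<rho>' \<eta>') (ll t - 1) + 1"
    using assms(4)
  proof
    assume "lab t (\<rho>, \<eta>) = lab t (\<rho>', \<eta>')"
    then have "word_num n (xdig \<rho> \<eta>) (ll t - 1) = word_num n (xdig \<rho>' \<eta>') (ll t - 1)"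
      using lab_eq_digits(2) by (intro word_num_cong) auto
    then show ?thesis by simp
  next
    assume "dist (point (\<rho>, \<eta>)) (point (\<rho>', \<eta>')) < eps t"
    then have "\<bar>val n (xdig \<rho> \<eta>) - val n (xdig \<rho>' \<eta>')\<bar> < 1 / real n ^ (ll t - 1)"
      using dist_point(1)[of \<rho> \<eta> \<rho>' \<eta>'] eps_le(2)[of t] le[OF n2, of "ll t"] by linarith
    then show ?thesis using word_num_close[of n "xdig \<rho> \<eta>" "xdig \<rho>' \<eta>'"] n2 x by blast
  qed
qed

end

section \<open>The tree of cells of a carpet\<close>

lemma map_upt_split: "i \<le> j \<Longrightarrow> map f [0..<j] = map f [0..<i] @ map f [i..<j]"
  using upt_add_eq_append[of 0 i "j - i"] by (simp flip: map_append)

context carpet_code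
begin

lemma compact_points: "compact (point ` codes)"
proof -
  have fin: "finite digits"
  proof -
    have "digits = (\<lambda>(q, r). (eD (eH r) q, eH r)) ` ({..<a} \<times> {..<N})" by (auto simp: digits_def)
    then show ?thesis by simp
  qed
  have sub: "digits \<subseteq> {0..<n} \<times> {0..<m}"
    using cols_gapped rows_gapped by (auto simp: digits_def gapped_def)
  have mem: "(eD (eH r) q, eH r) \<in> digits" if "q < a" "r < N" for q r
    using that unfolding digits_def by blast
  have "\<exists>p q. p \<in> digits \<and> q \<in> digits \<and> p \<noteq> q"
  proof (cases "1 < N")
    case True
    then have "eH 0 \<noteq> eH 1" using eH_inj[of 0 1] by auto
    moreover have "(eD (eH 0) 0, eH 0) \<in> digits" "(eD (eH 1) 0, eH 1) \<in> digits"
      using mem True a_pos by auto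
    ultimately show ?thesis by blast
  next
    case False
    then have a: "1 < a" using two_digits by simp
    then have "eD (eH 0) 0 \<noteq> eD (eH 0) 1" using gapped_inj[OF cols_gapped[OF N_pos], of 0 1] by auto
    moreover have "(eD (eH 0) 0, eH 0) \<in> digits" "(eD (eH 0) 1, eH 0) \<in> digits"
      using mem N_pos a by auto
    ultimately show ?thesis by blast
  qed
  then obtain p q where "p \<in> digits" "q \<in> digits" "p \<noteq> q" by blast
  then have "1 < card digits" using fin card_mono[of digits "{p, q}"] by simp
  then have E: "is_carpet n m digits (carpet n m digits)"
    using carpet_is_carpet[OF n2 m2] sub by (simp add: digit_set_def)
  have "point ` codes = carpet n m digits"
    using carpet_eq_carpet_point[OF n2 m2 sub E] point_image by metis
  then show ?thesis using E unfolding is_carpet_def by metis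
qed

end

context carpet_scales
begin

definition branching :: "nat \<Rightarrow> nat" where
  "branching t = a ^ (ll (Suc t) - ll t) * N ^ S"

lemma children_labels:
  assumes "(\<rho>, \<eta>) \<in> codes"
  shows "lab (Suc t) ` {\<omega>'\<in>codes. lab t \<omega>' = lab t (\<rho>, \<eta>)} =
    (\<lambda>(u, v). (map \<rho> [0..<ll t] @ u, map \<eta> [0..<S * t] @ v)) `
      ({u. set u \<subseteq> {..<a} \<and> length u = ll (Suc t) - ll t} \<times> {v. set v \<subseteq> {..<N} \<and> length v = S})"
    (is "?L = ?R")
proof (intro equalityI subsetI)
  have le: "ll t \<le> ll (Suc t)" using ll_mono by simp
  fix l assume "l \<in> ?L"
  then obtain \<rho>' \<eta>' where l: "(\<rho>', \<eta>') \<in> codes" "lab t (\<rho>', \<eta>') = lab t (\<rho>, \<eta>)" "l = lab (Suc t) (\<rho>', \<eta>')"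
    by auto
  have "map \<rho>' [0..<ll (Suc t)] = map \<rho>' [0..<ll t] @ map \<rho>' [ll t..<ll (Suc t)]"
    using le by (rule map_upt_split)
  moreover have "map \<eta>' [0..<S * Suc t] = map \<eta>' [0..<S * t] @ map \<eta>' [S * t..<S * Suc t]"
    by (rule map_upt_split) simp
  ultimately have "l = (\<lambda>(u, v). (map \<rho> [0..<ll t] @ u, map \<eta> [0..<S * t] @ v))
      (map \<rho>' [ll t..<ll (Suc t)], map \<eta>' [S * t..<S * Suc t])"
    using l by (simp add: lab_def)
  moreover have "(map \<rho>' [ll t..<ll (Suc t)], map \<eta>' [S * t..<S * Suc t]) \<in>
      {u. set u \<subseteq> {..<a} \<and> length u = ll (Suc t) - ll t} \<times> {v. set v \<subseteq> {..<N} \<and> length v = S}"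
    using codesD[OF l(1)] by auto
  ultimately show "l \<in> ?R" by blast
next
  have le: "ll t \<le> ll (Suc t)" using ll_mono by simp
  fix l assume "l \<in> ?R"
  then obtain u v where uv: "set u \<subseteq> {..<a}" "length u = ll (Suc t) - ll t" "set v \<subseteq> {..<N}" "length v = S"
      "l = (map \<rho> [0..<ll t] @ u, map \<eta> [0..<S * t] @ v)" by auto
  define \<rho>' where "\<rho>' i = (if i < ll (Suc t) then (map \<rho> [0..<ll t] @ u) ! i else 0)" for i
  define \<eta>' where "\<eta>' i = (if i < S * Suc t then (map \<eta> [0..<S * t] @ v) ! i else 0)" for i
  have "u ! j < a" if "j < length u" for j using nth_mem[OF that] uv(1) by auto
  then have "\<rho>' i < a" for i
    using codesD(1)[OF assms, of i] a_pos uv(2) by (auto simp: \<rho>'_def nth_append)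
  moreover have "v ! j < N" if "j < length v" for j using nth_mem[OF that] uv(3) by auto
  then have "\<eta>' i < N" for i
    using codesD(2)[OF assms, of i] N_pos uv(4) by (auto simp: \<eta>'_def nth_append)
  ultimately have c: "(\<rho>', \<eta>') \<in> codes" by (simp add: codes_def)
  have "map \<rho>' [0..<ll (Suc t)] = map \<rho> [0..<ll t] @ u"
    using uv le by (intro nth_equalityI) (auto simp: \<rho>'_def)
  moreover have "map \<eta>' [0..<S * Suc t] = map \<eta> [0..<S * t] @ v"
    using uv by (intro nth_equalityI) (auto simp: \<eta>'_def)
  ultimately have "l = lab (Suc t) (\<rho>', \<eta>')" using uv by (simp add: lab_def)
  moreover have "lab t (\<rho>', \<eta>') = lab t (\<rho>, \<eta>)"
    using le by (auto simp: lab_eq_iff \<rho>'_def \<eta>'_def nth_append)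
  ultimately show "l \<in> ?L" using c by blast
qed

lemma card_children_labels:
  assumes "\<omega> \<in> codes"
  shows "finite (lab (Suc t) ` {\<omega>'\<in>codes. lab t \<omega>' = lab t \<omega>})"
    and "card (lab (Suc t) ` {\<omega>'\<in>codes. lab t \<omega>' = lab t \<omega>}) = branching t"
proof -
  obtain \<rho> \<eta> where w: "\<omega> = (\<rho>, \<eta>)" by (cases \<omega>)
  note eq = children_labels[OF assms[unfolded w], of t]
  show "finite (lab (Suc t) ` {\<omega>'\<in>codes. lab t \<omega>' = lab t \<omega>})"
    unfolding w eq by (intro finite_imageI finite_cartesian_product finite_lists_length_eq) auto
  show "card (lab (Suc t) ` {\<omega>'\<in>codes. lab t \<omega>' = lab t \<omega>}) = branching t"
    unfolding w eq
    by (subst card_image) (auto simp: inj_on_def card_cartesian_product card_lists_length_eq branching_def)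
qed

lemma codes_complete:
  assumes w: "\<And>t. w t \<in> codes" "\<And>t. lab t (w (Suc t)) = lab t (w t)"
  shows "\<exists>\<omega>\<in>codes. \<forall>t. lab t \<omega> = lab t (w t)"
proof -
  obtain \<rho> \<eta> where w': "\<And>t. w t = (\<rho> t, \<eta> t)"
    using that[of "\<lambda>t. fst (w t)" "\<lambda>t. snd (w t)"] by simp
  have step: "\<And>i t. i < ll t \<Longrightarrow> \<rho> (Suc t) i = \<rho> t i" "\<And>i t. i < S * t \<Longrightarrow> \<eta> (Suc t) i = \<eta> t i"
    using w(2) unfolding w' lab_eq_iff by auto
  have "\<rho> (t + d) i = \<rho> t i" if "i < ll t" for t d i
  proof (induction d)
    case (Suc d)
    have "i < ll (t + d)" using that ll_mono[of t "t + d"] by simp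
    then show ?case using step(1)[of i "t + d"] Suc by simp
  qed simp
  then have r: "\<rho> t' i = \<rho> t i" if "i < ll t" "t \<le> t'" for t t' i
    using that by (metis le_add_diff_inverse)
  have "\<eta> (t + d) i = \<eta> t i" if "i < S * t" for t d i
  proof (induction d)
    case (Suc d)
    have "i < S * (t + d)" using that by (simp add: add_mult_distrib2)
    then show ?case using step(2)[of i "t + d"] Suc by simp
  qed simp
  then have e: "\<eta> t' i = \<eta> t i" if "i < S * t" "t \<le> t'" for t t' i
    using that by (metis le_add_diff_inverse)
  have idx: "i < ll (Suc i)" "i < S * Suc i" for i
    using ll_ge[of "Suc i"] ll_le[of "Suc i"] by auto
  define \<rho>\<^sub>0 \<eta>\<^sub>0 where "\<rho>\<^sub>0 i = \<rho> (Suc i) i" and "\<eta>\<^sub>0 i = \<eta> (Suc i) i" for i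
  have "\<rho>\<^sub>0 i = \<rho> t i" if "i < ll t" for i t
    using r[OF that, of "max t (Suc i)"] r[OF idx(1), of i "max t (Suc i)"] by (simp add: \<rho>\<^sub>0_def)
  moreover have "\<eta>\<^sub>0 i = \<eta> t i" if "i < S * t" for i t
    using e[OF that, of "max t (Suc i)"] e[OF idx(2), of i "max t (Suc i)"] by (simp add: \<eta>\<^sub>0_def)
  ultimately have "\<forall>t. lab t (\<rho>\<^sub>0, \<eta>\<^sub>0) = lab t (w t)" unfolding w' lab_eq_iff by blast
  moreover have "(\<rho>\<^sub>0, \<eta>\<^sub>0) \<in> codes"
    using w(1) unfolding w' codes_def by (auto simp: \<rho>\<^sub>0_def \<eta>\<^sub>0_def)
  ultimately show ?thesis by blast
qed

sublocale cell_tree codes lab point eps branching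
proof
  show "codes \<noteq> {}" using a_pos N_pos by (auto simp: codes_def)
  fix \<omega> \<omega>' and t
  show "lab 0 \<omega> = lab 0 \<omega>'" by (cases \<omega>; cases \<omega>') (simp add: lab_def ll_0)
  show "lab t \<omega> = lab t \<omega>'" if "lab (Suc t) \<omega> = lab (Suc t) \<omega>'"
  proof -
    obtain \<rho> \<eta> \<rho>' \<eta>' where [simp]: "\<omega> = (\<rho>, \<eta>)" "\<omega>' = (\<rho>', \<eta>')" by (cases \<omega>; cases \<omega>')
    have "ll t \<le> ll (Suc t)" using ll_mono by simp
    then show ?thesis using that by (auto simp: lab_eq_iff)
  qed
  show "finite (lab (Suc t) ` {\<omega>'\<in>codes. lab t \<omega>' = lab t \<omega>})"
    and "card (lab (Suc t) ` {\<omega>'\<in>codes. lab t \<omega>' = lab t \<omega>}) = branching t" if "\<omega> \<in> codes"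
    using card_children_labels[OF that] by auto
  show "\<omega> = \<omega>'" if "\<And>t. lab t \<omega> = lab t \<omega>'"
  proof -
    obtain \<rho> \<eta> \<rho>' \<eta>' where eq: "\<omega> = (\<rho>, \<eta>)" "\<omega>' = (\<rho>', \<eta>')" by (cases \<omega>; cases \<omega>')
    have "\<rho> i = \<rho>' i \<and> \<eta> i = \<eta>' i" for i
      using that[of "Suc i"] ll_ge[of "Suc i"] ll_le[of "Suc i"] unfolding eq lab_eq_iff by auto
    then show ?thesis by (auto simp: eq)
  qed
  show "0 < eps t" using theta n2 by (simp add: eps_def)
  show "eps (Suc t) \<le> eps t" using theta n2 by (simp add: eps_def divide_right_mono mult_left_le_one_le)
next
  show "\<And>w. (\<And>t. w t \<in> codes) \<Longrightarrow> (\<And>t. lab t (w (Suc t)) = lab t (w t)) \<Longrightarrow> \<exists>\<omega>\<in>codes. \<forall>t. lab t \<omega> = lab t (w t)"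
    by (rule codes_complete)
  show "compact (point ` codes)" by (rule compact_points)
qed


section \<open>Bounded clusters\<close>

lemma vacancy_everywhere:
  assumes t: "0 < t"
  shows "\<exists>z. z div n ^ s = j \<and> z \<notin> (\<lambda>(\<rho>, \<eta>). word_num n (xdig \<rho> \<eta>) (ll t - 1)) `
            {(\<rho>, \<eta>). (\<rho>, \<eta>) \<in> codes \<and> (word_num m (ydig \<eta>) (S * t - 1) + c) div m = q}"
proof (cases "s \<le> ll t - 1")
  case True
  then show ?thesis using vacant_column[OF True _ s, of "S * t - 1" j c q] ll_le[of t] by simp
next
  case False
  \<comment> \<open>The words are shorter than \<open>s\<close>, and the last column of a block is beyond all of them.\<close>
  define z where "z = j * n ^ s + (n ^ s - 1)"
  have pos: "0 < n ^ s" using n2 by simp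
  have "z div n ^ s = j" using pos by (intro div_nat_eqI) (simp_all add: z_def mult.commute)
  moreover have "word_num n (xdig \<rho> \<eta>) (ll t - 1) < z" if "(\<rho>, \<eta>) \<in> codes" for \<rho> \<eta>
  proof -
    have "word_num n (xdig \<rho> \<eta>) (ll t - 1) < n ^ (ll t - 1)" using xdig_less[OF that] by (rule word_num_less)
    moreover have "n ^ (ll t - 1) < n ^ s" using False n2 by (intro power_strict_increasing) auto
    ultimately show ?thesis by (simp add: z_def)
  qed
  then have "z \<notin> (\<lambda>(\<rho>, \<eta>). word_num n (xdig \<rho> \<eta>) (ll t - 1)) `
            {(\<rho>, \<eta>). (\<rho>, \<eta>) \<in> codes \<and> (word_num m (ydig \<eta>) (S * t - 1) + c) div m = q}"
    by fastforce
  ultimately show ?thesis by blast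
qed

text \<open>The decoded words of close points, one digit shorter than the level, are equal or adjacent in both coordinates, and all
  points of a cell share these words. So no chain of close points can jump over a vacant row or a vacant column.\<close>

lemma linked_confined:
  assumes linked: "linked t (\<rho>, \<eta>) (\<rho>', \<eta>')" and c: "(\<rho>, \<eta>) \<in> codes" and t: "0 < t"
  shows "word_num m (ydig \<eta>') (S * t - 1) \<le> word_num m (ydig \<eta>) (S * t - 1) + m"
    and "word_num m (ydig \<eta>) (S * t - 1) \<le> word_num m (ydig \<eta>') (S * t - 1) + m"
    and "word_num n (xdig \<rho>' \<eta>') (ll t - 1) \<le> word_num n (xdig \<rho> \<eta>) (ll t - 1) + 2 * n ^ s"
    and "word_num n (xdig \<rho> \<eta>) (ll t - 1) \<le> word_num n (xdig \<rho>' \<eta>') (ll t - 1) + 2 * n ^ s"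
proof -
  obtain v where v: "v < m"
      "\<And>\<eta> K. (\<And>i. \<eta> i < N) \<Longrightarrow> 0 < K \<Longrightarrow> (word_num m (ydig \<eta>) K + (m - v)) mod m \<noteq> 0"
    using row_not_vacant by blast
  define X where "X = (\<lambda>(\<rho>, \<eta>). word_num n (xdig \<rho> \<eta>) (ll t - 1))"
  define Y where "Y = (\<lambda>(\<rho>::nat \<Rightarrow> nat, \<eta>). word_num m (ydig \<eta>) (S * t - 1))"
  have step: "u \<in> codes \<and> u' \<in> codes \<and> X u \<le> X u' + 1 \<and> X u' \<le> X u + 1 \<and> Y u \<le> Y u' + 1 \<and> Y u' \<le> Y u + 1"
    if "near t u u'" for u u'
  proof -
    obtain \<rho> \<eta> \<rho>' \<eta>' where u: "u = (\<rho>, \<eta>)" "u' = (\<rho>', \<eta>')" by (cases u; cases u')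
    have c: "(\<rho>, \<eta>) \<in> codes" "(\<rho>', \<eta>') \<in> codes"
      and n: "lab t (\<rho>, \<eta>) = lab t (\<rho>', \<eta>') \<or> dist (point (\<rho>, \<eta>)) (point (\<rho>', \<eta>')) < eps t"
      using that by (simp_all add: near_def u)
    have n': "lab t (\<rho>', \<eta>') = lab t (\<rho>, \<eta>) \<or> dist (point (\<rho>', \<eta>')) (point (\<rho>, \<eta>)) < eps t"
      using n by (simp add: dist_commute eq_commute)
    show ?thesis using near_num[OF c t n] near_num[OF c(2,1) t n'] c by (simp add: u X_def Y_def)
  qed
  have Yv: "(Y u + (m - v)) mod m \<noteq> 0" if "u \<in> codes" for u
  proof -
    obtain \<rho> \<eta> where u: "u = (\<rho>, \<eta>)" by (cases u)
    have "\<And>i. \<eta> i < N" using that unfolding u by (rule codesD(2))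
    moreover have "0 < S * t - 1" using level_pos[OF t] by simp
    ultimately show ?thesis using v(2)[of \<eta> "S * t - 1"] by (simp add: u Y_def)
  qed
  have Xv: "\<exists>z. z div n ^ s = j \<and> z \<notin> X ` {u\<in>codes. (Y u + (m - v)) div m = q}" for j q
  proof -
    have "{u\<in>codes. (Y u + (m - v)) div m = q} =
        {(\<rho>, \<eta>). (\<rho>, \<eta>) \<in> codes \<and> (word_num m (ydig \<eta>) (S * t - 1) + (m - v)) div m = q}"
      by (auto simp: Y_def)
    then show ?thesis using vacancy_everywhere[OF t, of j "m - v" q] by (simp add: X_def)
  qed
  have pos: "0 < m" "0 < n ^ s" using m2 n2 by auto
  note conf = chain_confined[OF linked[unfolded linked_def] c pos(1) step Yv Xv pos(2)]
  show "word_num m (ydig \<eta>') (S * t - 1) \<le> word_num m (ydig \<eta>) (S * t - 1) + m"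
    and "word_num m (ydig \<eta>) (S * t - 1) \<le> word_num m (ydig \<eta>') (S * t - 1) + m"
    and "word_num n (xdig \<rho>' \<eta>') (ll t - 1) \<le> word_num n (xdig \<rho> \<eta>) (ll t - 1) + 2 * n ^ s"
    and "word_num n (xdig \<rho> \<eta>) (ll t - 1) \<le> word_num n (xdig \<rho>' \<eta>') (ll t - 1) + 2 * n ^ s"
    using conf by (simp_all add: X_def Y_def)
qed

lemma linked_in_codes: "linked t \<omega> \<omega>' \<Longrightarrow> \<omega> \<in> codes \<Longrightarrow> \<omega>' \<in> codes"
  unfolding linked_def by (induction rule: rtranclp_induct) (auto simp: near_def)

text \<open>The three terms come from the heights and the widths allowed by \<open>linked_confined\<close>, and from level zero, where all codes are
  linked.\<close>

definition diam_const :: real where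
  "diam_const = (real m + 1) * real m + (2 * real (n ^ s) + 1) * (real n * real n) + 2"

lemma linked_dist:
  assumes l: "linked t (\<rho>, \<eta>) (\<rho>', \<eta>')" and c: "(\<rho>, \<eta>) \<in> codes"
  shows "dist (point (\<rho>, \<eta>)) (point (\<rho>', \<eta>')) \<le> diam_const * \<theta> ^ t"
proof -
  have c': "(\<rho>', \<eta>') \<in> codes" using linked_in_codes[OF l c] .
  have y: "\<And>i. ydig \<eta> i < m" "\<And>i. ydig \<eta>' i < m" using ydig_less codesD(2) c c' by blast+
  have x: "\<And>i. xdig \<rho> \<eta> i < n" "\<And>i. xdig \<rho>' \<eta>' i < n" using xdig_less c c' by blast+
  show ?thesis
  proof (cases "t = 0")
    case True
    have "\<bar>val n (xdig \<rho> \<eta>) - val n (xdig \<rho>' \<eta>')\<bar> \<le> 1" "\<bar>val m (ydig \<eta>) - val m (ydig \<eta>')\<bar> \<le> 1"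
      using digit_series_bounds(2,3)[of n "xdig \<rho> \<eta>"] digit_series_bounds(2,3)[of n "xdig \<rho>' \<eta>'"]
        digit_series_bounds(2,3)[of m "ydig \<eta>"] digit_series_bounds(2,3)[of m "ydig \<eta>'"] x y n2 m2
      by (simp_all add: abs_le_iff)
    then have "dist (point (\<rho>, \<eta>)) (point (\<rho>', \<eta>')) \<le> 2"
      using dist_point(3)[of \<rho> \<eta> \<rho>' \<eta>'] by linarith
    moreover have "2 \<le> diam_const" by (simp add: diam_const_def)
    ultimately show ?thesis using True by simp
  next
    case False
    then have t: "0 < t" by simp
    note conf = linked_confined[OF l c t]
    have conf': "real (word_num m (ydig \<eta>') (S * t - 1)) \<le> real (word_num m (ydig \<eta>) (S * t - 1)) + real m"
        "real (word_num m (ydig \<eta>) (S * t - 1)) \<le> real (word_num m (ydig \<eta>') (S * t - 1)) + real m"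
        "real (word_num n (xdig \<rho>' \<eta>') (ll t - 1)) \<le> real (word_num n (xdig \<rho> \<eta>) (ll t - 1)) + 2 * real (n ^ s)"
        "real (word_num n (xdig \<rho> \<eta>) (ll t - 1)) \<le> real (word_num n (xdig \<rho>' \<eta>') (ll t - 1)) + 2 * real (n ^ s)"
      using conf by linarith+
    have "\<bar>val m (ydig \<eta>) - val m (ydig \<eta>')\<bar> \<le> (real m + 1) / real m ^ (S * t - 1)"
      using val_dist_le[of m "ydig \<eta>" "ydig \<eta>'", OF m2 y conf'(2)]
        val_dist_le[of m "ydig \<eta>'" "ydig \<eta>", OF m2 y(2,1) conf'(1)] by linarith
    also have "\<dots> = (real m + 1) * real m * \<theta> ^ t"
    proof -
      have "real m ^ (S * t) = real m * real m ^ (S * t - 1)"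
        using power_eq_if[of "real m" "S * t"] level_pos[OF t] S_pos t by simp
      then show ?thesis using m2 by (simp add: theta_power)
    qed
    finally have Y: "\<bar>val m (ydig \<eta>) - val m (ydig \<eta>')\<bar> \<le> (real m + 1) * real m * \<theta> ^ t" .
    have "\<bar>val n (xdig \<rho> \<eta>) - val n (xdig \<rho>' \<eta>')\<bar> \<le> (2 * real (n ^ s) + 1) / real n ^ (ll t - 1)"
      using val_dist_le[of n "xdig \<rho> \<eta>" "xdig \<rho>' \<eta>'", OF n2 x conf'(4)]
        val_dist_le[of n "xdig \<rho>' \<eta>'" "xdig \<rho> \<eta>", OF n2 x(2,1) conf'(3)] by linarith
    also have "\<dots> = (2 * real (n ^ s) + 1) * (real n * (1 / real n ^ ll t))"
    proof -
      have "real n ^ ll t = real n * real n ^ (ll t - 1)"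
        using power_Suc[of "real n" "ll t - 1"] level_pos[OF t] by simp
      then show ?thesis using n2 by simp
    qed
    also have "\<dots> \<le> (2 * real (n ^ s) + 1) * (real n * (real n * \<theta> ^ t))"
      using pow_le_theta[of t] by (intro mult_left_mono) auto
    finally have X: "\<bar>val n (xdig \<rho> \<eta>) - val n (xdig \<rho>' \<eta>')\<bar> \<le> (2 * real (n ^ s) + 1) * (real n * real n) * \<theta> ^ t"
      by (simp only: mult.assoc)
    have "0 \<le> 2 * \<theta> ^ t" using theta by simp
    then show ?thesis
      using X Y dist_point(3)[of \<rho> \<eta> \<rho>' \<eta>'] unfolding diam_const_def distrib_right by linarith
  qed
qed

text \<open>A cell is determined by the rectangle that contains it, which is given by decoded digits, and its last symbol in either
  direction. With \<open>linked_confined\<close> this bounds the number of cells in a cluster.\<close>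

lemma codes_determined:
  assumes c: "(\<rho>, \<eta>) \<in> codes" "(\<rho>', \<eta>') \<in> codes" and t: "0 < t"
    and Y: "word_num m (ydig \<eta>) (S * t - 1) = word_num m (ydig \<eta>') (S * t - 1)" and \<eta>: "\<eta> (S * t - 1) = \<eta>' (S * t - 1)"
    and X: "word_num n (xdig \<rho> \<eta>) (ll t - 1) = word_num n (xdig \<rho>' \<eta>') (ll t - 1)" and \<rho>: "\<rho> (ll t - 1) = \<rho>' (ll t - 1)"
  shows "lab t (\<rho>, \<eta>) = lab t (\<rho>', \<eta>')"
proof -
  have y: "\<And>i. ydig \<eta> i < m" "\<And>i. ydig \<eta>' i < m" using ydig_less codesD(2) c by blast+
  have x: "\<And>i. xdig \<rho> \<eta> i < n" "\<And>i. xdig \<rho>' \<eta>' i < n" using xdig_less c by blast+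
  have N: "\<And>i. \<eta> i < N" "\<And>i. \<eta>' i < N" and A: "\<And>i. \<rho> i < a" "\<And>i. \<rho>' i < a"
    using codesD c by blast+
  have row: "ydig \<eta> i = ydig \<eta>' i" if "i < S * t - 1" for i
    using word_num_eq_imp[OF Y y that] .
  have "decode N (\<lambda>_. hH) \<eta> i = decode N (\<lambda>_. hH) \<eta>' i" if "i < S * t - 1" for i
    using row[OF that] eH_inj[OF ydig_rank_less ydig_rank_less, of \<eta> \<eta>' i i] N by (simp add: ydig_def)
  then have e: "\<eta> i = \<eta>' i" if "i \<le> S * t - 1" for i
    using decode_cancel[of "\<lambda>_. hH" N \<eta> \<eta>' "S * t - 1" "\<lambda>_. hH" i] hH_le N \<eta> that by auto
  have "decode a (\<lambda>i. hD (ydig \<eta> i)) \<rho> i = decode a (\<lambda>i. hD (ydig \<eta>' i)) \<rho>' i" if "i < ll t - 1" for i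
  proof -
    have "xdig \<rho> \<eta> i = xdig \<rho>' \<eta>' i" using word_num_eq_imp[OF X x that] .
    moreover have "ydig \<eta> i = ydig \<eta>' i" using row that ll_le[of t] by simp
    ultimately show ?thesis
      using gapped_inj[OF ydig_gapped[of \<eta> i, OF N(1)] xdig_rank_less[OF c(1), of i] xdig_rank_less[OF c(2), of i]]
      by (simp add: xdig_def)
  qed
  moreover have "hD (ydig \<eta>' i) = hD (ydig \<eta> i)" if "i \<le> ll t - 1" for i
    using row[of i] that ll_gap[OF t] level_pos[OF t] by simp
  moreover have "\<And>i. hD (ydig \<eta> i) \<le> a" using hD_le N by blast
  ultimately have r: "\<rho> i = \<rho>' i" if "i \<le> ll t - 1" for i
    using decode_cancel[of "\<lambda>i. hD (ydig \<eta> i)" a \<rho> \<rho>' "ll t - 1" "\<lambda>i. hD (ydig \<eta>' i)" i] A \<rho> that by blast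
  show ?thesis unfolding lab_eq_iff using e r by auto
qed

definition cluster_bound :: nat where
  "cluster_bound = (2 * m + 1) * (4 * n ^ s + 1) * N * a"

lemma card_cluster_le:
  assumes l: "l \<in> cells t"
  shows "card (cluster t l) \<le> cluster_bound"
proof (cases "t = 0")
  case True
  have "1 \<le> cluster_bound" using N_pos a_pos by (simp add: cluster_bound_def)
  moreover have "cluster t l \<subseteq> {([], [])}"
    using cluster_subset[of t l] True by (auto simp: cells_def lab_def ll_0)
  then have "card (cluster t l) \<le> card {([]::nat list, []::nat list)}" by (intro card_mono) auto
  ultimately show ?thesis by simp
next
  case False
  then have t: "0 < t" by simp
  obtain \<rho>0 \<eta>0 where c0: "(\<rho>0, \<eta>0) \<in> codes" "l = lab t (\<rho>0, \<eta>0)" using l by (auto simp: cells_def)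
  define key where "key = (\<lambda>(\<rho>, \<eta>). (word_num m (ydig \<eta>) (S * t - 1), word_num n (xdig \<rho> \<eta>) (ll t - 1),
      \<eta> (S * t - 1), \<rho> (ll t - 1)))"
  define T where "T = {\<omega>\<in>codes. linked t (\<rho>0, \<eta>0) \<omega>}"
  define Y0 X0 where "Y0 = word_num m (ydig \<eta>0) (S * t - 1)" and "X0 = word_num n (xdig \<rho>0 \<eta>0) (ll t - 1)"
  define box where "box = {Y0 - m..Y0 + m} \<times> {X0 - 2 * n ^ s..X0 + 2 * n ^ s} \<times> {..<N} \<times> {..<a}"
  have sub: "key ` T \<subseteq> box"
  proof
    fix k assume "k \<in> key ` T"
    then obtain \<rho> \<eta> where k: "k = key (\<rho>, \<eta>)" "(\<rho>, \<eta>) \<in> codes" "linked t (\<rho>0, \<eta>0) (\<rho>, \<eta>)"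
      by (auto simp: T_def)
    show "k \<in> box"
      using linked_confined[OF k(3) c0(1) t] codesD[OF k(2)]
      unfolding k(1) by (auto simp: key_def box_def Y0_def X0_def le_diff_conv)
  qed
  have fin: "finite box" by (simp add: box_def)
  have "card (lab t ` T) \<le> card (key ` T)"
  proof (rule card_image_factor)
    show "finite (key ` T)" using sub fin finite_subset by blast
    fix u u' assume u: "u \<in> T" "u' \<in> T" "key u = key u'"
    obtain \<rho> \<eta> \<rho>' \<eta>' where eq: "u = (\<rho>, \<eta>)" "u' = (\<rho>', \<eta>')" by (cases u; cases u')
    show "lab t u = lab t u'"
      unfolding eq by (rule codes_determined) (use u t in \<open>auto simp: eq T_def key_def\<close>)
  qed
  also have "\<dots> \<le> card box" by (rule card_mono[OF fin sub])
  also have "\<dots> = card {Y0 - m..Y0 + m} * (card {X0 - 2 * n ^ s..X0 + 2 * n ^ s} * (N * a))"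
    by (simp add: box_def card_cartesian_product)
  also have "\<dots> \<le> (2 * m + 1) * ((4 * n ^ s + 1) * (N * a))"
    by (intro mult_le_mono) auto
  finally have "card (lab t ` T) \<le> cluster_bound" by (simp only: cluster_bound_def mult.assoc)
  then show ?thesis unfolding c0(2) cluster_lab[OF c0(1)] T_def .
qed


section \<open>Isolated cells\<close>

definition isolating :: "nat \<Rightarrow> (nat \<Rightarrow> nat) \<Rightarrow> (nat \<Rightarrow> nat) \<Rightarrow> bool" where
  "isolating t \<rho> \<eta> \<longleftrightarrow>
     \<eta> (S * t - 2) = N - 1 \<and> \<eta> (S * t - 1) = last_digit_code m N eH hH \<and>
     \<rho> (ll t - 2) = a - 1 \<and>
     \<rho> (ll t - 1) = last_digit_code n a (eD (ydig \<eta> (ll t - 2))) (hD (ydig \<eta> (ll t - 1)))"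

lemma isolating_cong:
  assumes "lab t (\<rho>, \<eta>) = lab t (\<rho>', \<eta>')" "isolating t \<rho> \<eta>" "0 < t"
  shows "isolating t \<rho>' \<eta>'"
proof -
  have p: "3 \<le> ll t" "5 \<le> S * t" "ll t + 2 \<le> S * t" using level_pos[OF assms(3)] ll_gap[OF assms(3)] by auto
  have "ydig \<eta> (ll t - 2) = ydig \<eta>' (ll t - 2)" "ydig \<eta> (ll t - 1) = ydig \<eta>' (ll t - 1)"
    using lab_eq_digits(1)[OF assms(1)] p by auto
  then show ?thesis
    using assms(1,2) p unfolding isolating_def lab_eq_iff by auto
qed

text \<open>Rows come first: \<open>isolated_code\<close> applied to the rows shows that both points belong to the same row symbols, and
  hence the columns are decoded with the same digit sets; then it can be applied to the columns.\<close>

lemma isolating_isolated: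
  assumes c: "(\<rho>, \<eta>) \<in> codes" "(\<rho>', \<eta>') \<in> codes" and t: "0 < t" and iso: "isolating t \<rho> \<eta>"
    and d: "dist (point (\<rho>, \<eta>)) (point (\<rho>', \<eta>')) < eps t"
  shows "lab t (\<rho>, \<eta>) = lab t (\<rho>', \<eta>')"
proof -
  have p: "3 \<le> ll t" "5 \<le> S * t" "ll t + 2 \<le> S * t" using level_pos[OF t] ll_gap[OF t] by auto
  have y: "\<And>i. ydig \<eta> i < m" "\<And>i. ydig \<eta>' i < m" using ydig_less codesD(2) c by blast+
  have x: "\<And>i. xdig \<rho> \<eta> i < n" "\<And>i. xdig \<rho>' \<eta>' i < n" using xdig_less c by blast+
  have N: "\<And>i. \<eta> i < N" "\<And>i. \<eta>' i < N" and A: "\<And>i. \<rho> i < a" "\<And>i. \<rho>' i < a"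
    using codesD c by blast+
  have ry: "\<And>i. decode N (\<lambda>_. hH) \<eta> i < N" "\<And>i. decode N (\<lambda>_. hH) \<eta>' i < N"
    using ydig_rank_less N by blast+
  have e: "\<eta> i = \<eta>' i" if i: "i < S * t" for i
  proof (rule isolated_code[where n = m and a = N and e = "\<lambda>_. eH" and h = "\<lambda>_. hH" and r = "decode N (\<lambda>_. hH) \<eta>" and \<rho> = \<eta> and \<rho>' = \<eta>'
          and r' = "decode N (\<lambda>_. hH) \<eta>'" and x = "ydig \<eta>" and x' = "ydig \<eta>'" and k = "S * t"])
    show "2 \<le> m" "2 \<le> S * t" "i < S * t" using m2 p i by auto
    show "gapped m N eH hH" by (rule rows_gapped)
    show "decode N (\<lambda>_. hH) \<eta> i = (if hH \<le> decode N (\<lambda>_. hH) \<eta> (Suc i) then \<eta> i else sigma N hH (\<eta> i))" for i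
      using decode_eq[of "\<lambda>_. hH" N \<eta> i] hH_le N by simp
    show "decode N (\<lambda>_. hH) \<eta>' i = (if hH \<le> decode N (\<lambda>_. hH) \<eta>' (Suc i) then \<eta>' i else sigma N hH (\<eta>' i))" for i
      using decode_eq[of "\<lambda>_. hH" N \<eta>' i] hH_le N by simp
    show "\<bar>val m (ydig \<eta>) - val m (ydig \<eta>')\<bar> < 1 / real m ^ Suc (S * t)"
      using dist_point(2)[of \<eta> \<eta>' \<rho> \<rho>'] d eps_le(1)[of t] by linarith
  qed (use N ry y iso in \<open>simp_all add: ydig_def isolating_def\<close>)
  have row: "ydig \<eta>' i = ydig \<eta> i" if "i \<le> ll t" for i
    using e[of i] e[of "Suc i"] that p by (simp add: ydig_def decode_def)
  define h h' where "h i = hD (ydig \<eta> i)" and "h' i = hD (ydig \<eta>' i)" for i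
  have ha: "\<And>i. h i \<le> a" "\<And>i. h' i \<le> a" unfolding h_def h'_def using hD_le N by blast+
  have hh: "h' i = h i" if "i \<le> ll t" for i using row[OF that] by (simp add: h_def h'_def)
  have rx: "\<And>i. decode a h \<rho> i < a" "\<And>i. decode a h' \<rho>' i < a"
    using decode_less ha A by blast+
  have xe: "xdig \<rho> \<eta> i = eD (ydig \<eta> i) (decode a h \<rho> i)" "xdig \<rho>' \<eta>' i = eD (ydig \<eta>' i) (decode a h' \<rho>' i)" for i
    by (simp_all add: xdig_def h_def[abs_def] h'_def[abs_def])
  have r: "\<rho> i = \<rho>' i" if i: "i < ll t" for i
  proof (rule isolated_code[where n = n and a = a and e = "\<lambda>i. eD (ydig \<eta> i)" and h = h and r = "decode a h \<rho>" and \<rho> = \<rho> and \<rho>' = \<rho>'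
          and r' = "decode a h' \<rho>'" and x = "xdig \<rho> \<eta>" and x' = "xdig \<rho>' \<eta>'" and k = "ll t"])
    show "2 \<le> n" "2 \<le> ll t" "i < ll t" using n2 p i by auto
    show "gapped n a (eD (ydig \<eta> i)) (h i)" for i unfolding h_def using ydig_gapped N by blast
    show "decode a h \<rho> i = (if h (Suc i) \<le> decode a h \<rho> (Suc i) then \<rho> i else sigma a (h i) (\<rho> i))" for i
      using decode_eq[of h a \<rho> i] ha A by simp
    show "decode a h' \<rho>' i = (if h (Suc i) \<le> decode a h' \<rho>' (Suc i) then \<rho>' i else sigma a (h i) (\<rho>' i))"
      if "i < ll t" for i
      using decode_eq[of h' a \<rho>' i] ha A hh[of i] hh[of "Suc i"] that by simp
    show "xdig \<rho>' \<eta>' i = eD (ydig \<eta> i) (decode a h' \<rho>' i)" if "i \<le> ll t" for i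
      using xe(2)[of i] row[OF that] by simp
    show "\<bar>val n (xdig \<rho> \<eta>) - val n (xdig \<rho>' \<eta>')\<bar> < 1 / real n ^ Suc (ll t)"
      using dist_point(1)[of \<rho> \<eta> \<rho>' \<eta>'] d eps_le(2)[of t] by linarith
  qed (use A rx x iso xe(1) in \<open>simp_all add: isolating_def h_def\<close>)
  show ?thesis using e r by (simp add: lab_eq_iff)
qed

lemma isolating_imp_isolated:
  assumes "(\<rho>, \<eta>) \<in> codes" "0 < t" "isolating t \<rho> \<eta>"
  shows "isolated t (lab t (\<rho>, \<eta>))"
  unfolding isolated_def
proof (intro ballI impI)
  fix u u' assume u: "u \<in> codes" "u' \<in> codes" "lab t u = lab t (\<rho>, \<eta>)" "dist (point u) (point u') < eps t"
  obtain \<rho>1 \<eta>1 \<rho>2 \<eta>2 where eq: "u = (\<rho>1, \<eta>1)" "u' = (\<rho>2, \<eta>2)" by (cases u; cases u')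
  have "isolating t \<rho>1 \<eta>1" using isolating_cong[of t \<rho> \<eta>] assms(2,3) u(3) by (simp add: eq)
  then have "lab t u = lab t u'"
    using isolating_isolated[of \<rho>1 \<eta>1 \<rho>2 \<eta>2 t] u assms(2) by (simp add: eq)
  then show "lab t u' = lab t (\<rho>, \<eta>)" using u(3) by simp
qed

text \<open>After the prefix of the parent, \<open>M\<close> positions are filled with the binary digits of a set \<open>A\<close>, and the last two positions
  with the isolating symbols. The binary digits are written in both directions where possible, since one
  of the two alphabets may consist of a single symbol.\<close>

lemma many_isolated_children:
  assumes l: "l \<in> cells t"
  shows "cluster_bound \<le> card {l'\<in>cells (Suc t). parent t l' = l \<and> isolated (Suc t) l'}"
proof -
  obtain \<rho> \<eta> where c: "(\<rho>, \<eta>) \<in> codes" "l = lab t (\<rho>, \<eta>)" using l by (auto simp: cells_def)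
  define k where "k = S * Suc t"
  define L where "L = ll (Suc t)"
  have k: "S * t + M + 2 \<le> k" and L: "ll t + M + 3 \<le> L" "L + 2 \<le> k"
    using S(1) ll_step[of t] ll_gap[of "Suc t"] by (simp_all add: k_def L_def)
  define \<eta>' where "\<eta>' A i = (if i < S * t then \<eta> i
      else if i < S * t + M then (if i - S * t \<in> A \<and> 1 < N then 1 else 0)
      else if i = k - 1 then last_digit_code m N eH hH else N - 1)" for A i
  define \<rho>' where "\<rho>' A i = (if i < ll t then \<rho> i
      else if i < ll t + M then (if i - ll t \<in> A \<and> 1 < a then 1 else 0)
      else if i = L - 1 then last_digit_code n a (eD (ydig (\<eta>' A) (L - 2))) (hD (ydig (\<eta>' A) (L - 1)))
      else a - 1)" for A i
  have N: "\<eta>' A i < N" for A i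
    using codesD(2)[OF c(1), of i] N_pos hH_le last_digit_code_less[of N hH m eH] by (auto simp: \<eta>'_def)
  have a: "\<rho>' A i < a" for A i
    using codesD(1)[OF c(1), of i] a_pos
      last_digit_code_less[OF a_pos hD_le[of "\<eta>' A" "L - 1", OF N], of n "eD (ydig (\<eta>' A) (L - 2))"]
    by (auto simp: \<rho>'_def)
  have c': "(\<rho>' A, \<eta>' A) \<in> codes" for A using N a by (simp add: codes_def)
  have iso: "isolating (Suc t) (\<rho>' A) (\<eta>' A)" for A
    unfolding isolating_def k_def[symmetric] L_def[symmetric]
    using k L by (auto simp: \<eta>'_def \<rho>'_def)
  have par: "lab t (\<rho>' A, \<eta>' A) = l" for A
    unfolding c(2) lab_eq_iff by (simp add: \<eta>'_def \<rho>'_def)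
  have inj: "inj_on (\<lambda>A. lab (Suc t) (\<rho>' A, \<eta>' A)) (Pow {..<M})"
  proof (rule inj_onI)
    fix A A' assume sub: "A \<in> Pow {..<M}" "A' \<in> Pow {..<M}"
      and eq: "lab (Suc t) (\<rho>' A, \<eta>' A) = lab (Suc t) (\<rho>' A', \<eta>' A')"
    have "i \<in> A \<longleftrightarrow> i \<in> A'" if i: "i < M" for i
    proof -
      have "\<rho>' A (ll t + i) = \<rho>' A' (ll t + i)" "\<eta>' A (S * t + i) = \<eta>' A' (S * t + i)"
        using eq k L i unfolding lab_eq_iff k_def[symmetric] L_def[symmetric] by auto
      moreover have "\<rho>' B (ll t + i) = (if i \<in> B \<and> 1 < a then 1 else 0)"
          "\<eta>' B (S * t + i) = (if i \<in> B \<and> 1 < N then 1 else 0)" for B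
        using i by (simp_all add: \<rho>'_def \<eta>'_def)
      ultimately show ?thesis using two_digits by (metis zero_neq_one)
    qed
    then show "A = A'" using sub by blast
  qed
  have "cluster_bound \<le> card (Pow {..<M})" using M by (simp add: card_Pow cluster_bound_def)
  also have "\<dots> = card ((\<lambda>A. lab (Suc t) (\<rho>' A, \<eta>' A)) ` Pow {..<M})" by (simp add: card_image[OF inj])
  also have "\<dots> \<le> card {l'\<in>cells (Suc t). parent t l' = l \<and> isolated (Suc t) l'}"
  proof (rule card_mono)
    show "finite {l'\<in>cells (Suc t). parent t l' = l \<and> isolated (Suc t) l'}"
      using finite_cells[of "Suc t"] by simp
    show "(\<lambda>A. lab (Suc t) (\<rho>' A, \<eta>' A)) ` Pow {..<M} \<subseteq> {l'\<in>cells (Suc t). parent t l' = l \<and> isolated (Suc t) l'}"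
      using c' par parent_lab[OF c'] isolating_imp_isolated[OF c' _ iso] by auto
  qed
  finally show ?thesis .
qed

sublocale clustered_cell_tree codes lab point eps branching cluster_bound
  by unfold_locales (rule card_cluster_le many_isolated_children, assumption)+

end

section \<open>The symbolic metric\<close>

lemma seq_dist_le:
  assumes "0 < \<xi>" "\<xi> < 1" "\<And>i. i < k \<Longrightarrow> x i = x' i"
  shows "seq_dist \<xi> x x' \<le> \<xi> ^ k"
proof (cases "x = x'")
  case False
  then have "k \<le> common_prefix x x'" using common_prefix_neq[OF False] assms(3) not_le by blast
  then show ?thesis using False assms by (simp add: seq_dist_def power_decreasing)
qed (use assms in \<open>simp add: seq_dist_def\<close>)

lemma seq_dist_ge:
  assumes "0 < \<xi>" "\<xi> < 1" "x i \<noteq> x' i" "i \<le> k"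
  shows "\<xi> ^ k \<le> seq_dist \<xi> x x'"
proof -
  have ne: "x \<noteq> x'" using assms(3) by auto
  have "common_prefix x x' \<le> i" using common_prefix_agree[OF ne] assms(3) not_le by blast
  then show ?thesis using ne assms by (simp add: seq_dist_def power_decreasing)
qed

context carpet_scales
begin

lemma xis: "0 < 1 / real n" "1 / real n < 1" "0 < 1 / real m" "1 / real m < 1"
  using n2 m2 by auto

text \<open>Since \<open>n\<close> exceeds \<open>m\<close>, a cell prescribes at least as many rows as columns. Hence digits and ranks of the prescribed
  columns determine each other, and the labels describe the symbolic metric up to a constant.\<close>

lemma plain_dist_le:
  assumes "lab t (\<rho>, \<eta>) = lab t (\<rho>', \<eta>')"
  shows "carpet_seq_dist n m (plain (\<rho>, \<eta>)) (plain (\<rho>', \<eta>')) \<le> real n * \<theta> ^ t"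
proof -
  have r: "\<And>i. i < ll t \<Longrightarrow> \<rho> i = \<rho>' i" and e: "\<And>i. i < S * t \<Longrightarrow> \<eta> i = \<eta>' i"
    using assms unfolding lab_eq_iff by auto
  have "seq_dist (1 / real n) (\<lambda>i. eD (eH (\<eta> i)) (\<rho> i)) (\<lambda>i. eD (eH (\<eta>' i)) (\<rho>' i)) \<le> (1 / real n) ^ ll t"
    by (rule seq_dist_le[OF xis(1,2)]) (use r e ll_le[of t] in simp)
  also have "\<dots> \<le> real n * \<theta> ^ t" using pow_le_theta[of t] by (simp add: power_one_over)
  finally have 1: "seq_dist (1 / real n) (\<lambda>i. eD (eH (\<eta> i)) (\<rho> i)) (\<lambda>i. eD (eH (\<eta>' i)) (\<rho>' i)) \<le> real n * \<theta> ^ t" .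
  have "seq_dist (1 / real m) (\<lambda>i. eH (\<eta> i)) (\<lambda>i. eH (\<eta>' i)) \<le> (1 / real m) ^ (S * t)"
    by (rule seq_dist_le[OF xis(3,4)]) (use e in simp)
  also have "\<dots> = \<theta> ^ t" by (simp add: theta_power power_one_over)
  also have "\<dots> \<le> real n * \<theta> ^ t" using n2 theta by simp
  finally show ?thesis using 1 by (simp add: carpet_seq_dist_def plain_def)
qed

lemma plain_dist_ge:
  assumes c: "(\<rho>, \<eta>) \<in> codes" "(\<rho>', \<eta>') \<in> codes" and ne: "lab t (\<rho>, \<eta>) \<noteq> lab t (\<rho>', \<eta>')"
  shows "\<theta> ^ t \<le> carpet_seq_dist n m (plain (\<rho>, \<eta>)) (plain (\<rho>', \<eta>'))"
proof (cases "\<exists>i<S * t. \<eta> i \<noteq> \<eta>' i")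
  case True
  then obtain i where i: "i < S * t" "\<eta> i \<noteq> \<eta>' i" by blast
  then have "eH (\<eta> i) \<noteq> eH (\<eta>' i)" using eH_inj codesD(2) c by blast
  then have "(1 / real m) ^ (S * t) \<le> seq_dist (1 / real m) (\<lambda>i. eH (\<eta> i)) (\<lambda>i. eH (\<eta>' i))"
    using i by (intro seq_dist_ge[OF xis(3,4), where i = i]) auto
  then show ?thesis by (simp add: carpet_seq_dist_def plain_def theta_power power_one_over le_max_iff_disj)
next
  case False
  then obtain i where i: "i < ll t" "\<rho> i \<noteq> \<rho>' i" using ne unfolding lab_eq_iff by auto
  have e: "\<eta> i = \<eta>' i" using False i ll_le[of t] by auto
  have "eD (eH (\<eta> i)) (\<rho> i) \<noteq> eD (eH (\<eta> i)) (\<rho>' i)"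
    using gapped_inj[OF cols_gapped[OF codesD(2)[OF c(1)]] codesD(1)[OF c(1)] codesD(1)[OF c(2)]] i(2) by blast
  then have "(1 / real n) ^ ll t \<le> seq_dist (1 / real n) (\<lambda>i. eD (eH (\<eta> i)) (\<rho> i)) (\<lambda>i. eD (eH (\<eta>' i)) (\<rho>' i))"
    using i e by (intro seq_dist_ge[OF xis(1,2), where i = i]) auto
  then have "\<theta> ^ t \<le> seq_dist (1 / real n) (\<lambda>i. eD (eH (\<eta> i)) (\<rho> i)) (\<lambda>i. eD (eH (\<eta>' i)) (\<rho>' i))"
    using theta_le_pow[of t] by (simp add: power_one_over)
  then show ?thesis by (simp add: carpet_seq_dist_def plain_def le_max_iff_disj)
qed

lemma plain_dist_le_1: "carpet_seq_dist n m p q \<le> 1"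
  using seq_dist_le[OF xis(1,2), of 0 "fst p" "fst q"] seq_dist_le[OF xis(3,4), of 0 "snd p" "snd q"]
  by (simp add: carpet_seq_dist_def)

section \<open>Assembling the equivalence\<close>

lemma diam_const_pos: "0 < diam_const"
  by (simp add: diam_const_def add_nonneg_pos)

text \<open>Given two points, let \<open>t\<close> be the last level at which their codes are linked. Then the points are at distance about
  \<open>\<theta> ^ t\<close>, because clusters have diameter at most \<open>diam_const * \<theta> ^ t\<close> and distinct ones are separated by \<open>eps\<close>; and the rearranged
  codes have about the same symbolic distance, because they agree up to level \<open>t - 1\<close> but not up to level \<open>t + 1\<close>.\<close>

lemma lipschitz_equivalent_points:
  "lipschitz_equivalent (point ` codes) dist (digit_sequences digits) (carpet_seq_dist n m)"
proof -
  obtain f where f': "f ` codes = codes"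
    "\<forall>\<omega>\<in>codes. \<forall>\<omega>'\<in>codes. \<forall>t. (linked (Suc t) \<omega> \<omega>' \<longrightarrow> lab t (f \<omega>) = lab t (f \<omega>')) \<and>
                         (\<not> linked t \<omega> \<omega>' \<longrightarrow> lab t (f \<omega>) \<noteq> lab t (f \<omega>'))"
    using ex_rearrangement by (elim exE conjE)
  then have f: "f ` codes = codes"
    "\<And>\<omega> \<omega>' t. \<lbrakk>\<omega> \<in> codes; \<omega>' \<in> codes; linked (Suc t) \<omega> \<omega>'\<rbrakk> \<Longrightarrow> lab t (f \<omega>) = lab t (f \<omega>')"
    "\<And>\<omega> \<omega>' t. \<lbrakk>\<omega> \<in> codes; \<omega>' \<in> codes; \<not> linked t \<omega> \<omega>'\<rbrakk> \<Longrightarrow> lab t (f \<omega>) \<noteq> lab t (f \<omega>')"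
    by blast+
  have fc: "f \<omega> \<in> codes" if "\<omega> \<in> codes" for \<omega> using f(1) that by blast
  define \<delta> where "\<delta> \<omega> \<omega>' = carpet_seq_dist n m (plain (f \<omega>)) (plain (f \<omega>'))" for \<omega> \<omega>'
  have \<theta>pos: "0 < \<theta> ^ t" for t using theta by simp
  have dist_le: "dist (point \<omega>) (point \<omega>') \<le> diam_const * \<theta> ^ t" if "\<omega> \<in> codes" "linked t \<omega> \<omega>'" for \<omega> \<omega>' t
    using linked_dist[of t "fst \<omega>" "snd \<omega>" "fst \<omega>'" "snd \<omega>'"] that by simp
  have \<delta>_le: "\<delta> \<omega> \<omega>' \<le> real n * \<theta> ^ t" if "\<omega> \<in> codes" "\<omega>' \<in> codes" "linked (Suc t) \<omega> \<omega>'" for \<omega> \<omega>' t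
    using plain_dist_le[of t "fst (f \<omega>)" "snd (f \<omega>)" "fst (f \<omega>')" "snd (f \<omega>')"] f(2)[OF that] by (simp add: \<delta>_def)
  have \<delta>_ge: "\<theta> ^ t \<le> \<delta> \<omega> \<omega>'" if "\<omega> \<in> codes" "\<omega>' \<in> codes" "\<not> linked t \<omega> \<omega>'" for \<omega> \<omega>' t
    using plain_dist_ge[of "fst (f \<omega>)" "snd (f \<omega>)" "fst (f \<omega>')" "snd (f \<omega>')" t] f(3)[OF that] fc that
    by (simp add: \<delta>_def)
  have dist_ge: "eps t \<le> dist (point \<omega>) (point \<omega>')" if "\<omega> \<in> codes" "\<omega>' \<in> codes" "\<not> linked t \<omega> \<omega>'" for \<omega> \<omega>' t
    using near_imp_linked[of t \<omega> \<omega>'] that by (force simp: near_def)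
  have linked_0: "linked 0 \<omega> \<omega>'" if "\<omega> \<in> codes" "\<omega>' \<in> codes" for \<omega> \<omega>'
    using same_lab_linked[OF that] root[OF that] by blast
  have separated: "\<exists>t. linked t \<omega> \<omega>' \<and> \<not> linked (Suc t) \<omega> \<omega>'"
    if w: "\<omega> \<in> codes" "\<omega>' \<in> codes" "point \<omega> \<noteq> point \<omega>'" for \<omega> \<omega>'
  proof (rule ccontr)
    assume "\<not> ?thesis"
    then have "linked t \<omega> \<omega>'" for t by (induction t) (use linked_0[OF w(1,2)] in auto)
    then have "dist (point \<omega>) (point \<omega>') \<le> diam_const / (1 / \<theta>) ^ t" for t
      using dist_le[OF w(1), of t \<omega>'] by (simp add: power_one_over)
    moreover have "1 < 1 / \<theta>" using theta by simp
    ultimately have "dist (point \<omega>) (point \<omega>') \<le> 0" by (intro geometric_decay_zero)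
    then show False using w(3) by simp
  qed
  have \<delta>_same: "f \<omega> = f \<omega>'" if w: "\<omega> \<in> codes" "\<omega>' \<in> codes" "point \<omega> = point \<omega>'" for \<omega> \<omega>'
  proof (rule separating[OF fc[OF w(1)] fc[OF w(2)]])
    fix t
    have "near (Suc t) \<omega> \<omega>'" using w scale_pos by (simp add: near_def)
    then show "lab t (f \<omega>) = lab t (f \<omega>')" using f(2)[OF w(1,2)] near_imp_linked by blast
  qed
  \<comment> \<open>The two terms bound the quotients of the distances. Every lower bound comes from level \<open>t + 1\<close>, and the
  upper bound for the symbolic distance from level \<open>t - 1\<close>.\<close>
  define C where "C = real n * real n / (\<theta> * \<theta>) + diam_const / \<theta>"
  have C1: "real n * real n / (\<theta> * \<theta>) \<le> C" and C2: "diam_const / \<theta> \<le> C" and C0: "0 < C"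
    using theta diam_const_pos n2 by (simp_all add: C_def add_nonneg_pos)
  have compare: "\<delta> \<omega> \<omega>' \<le> C * dist (point \<omega>) (point \<omega>') \<and> dist (point \<omega>) (point \<omega>') \<le> C * \<delta> \<omega> \<omega>' \<and> 0 < \<delta> \<omega> \<omega>'"
    if w: "\<omega> \<in> codes" "\<omega>' \<in> codes" "point \<omega> \<noteq> point \<omega>'" for \<omega> \<omega>'
  proof -
    obtain t where t: "linked t \<omega> \<omega>'" "\<not> linked (Suc t) \<omega> \<omega>'" using separated[OF w] by blast
    have up: "\<delta> \<omega> \<omega>' \<le> real n * \<theta> ^ t / \<theta>"
    proof (cases t)
      case 0
      have "\<theta> \<le> real n" using theta n2 by linarith
      then have "1 \<le> real n / \<theta>" using theta by simp
      then show ?thesis using plain_dist_le_1[of "plain (f \<omega>)" "plain (f \<omega>')"] 0 by (simp add: \<delta>_def)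
    next
      case (Suc r)
      then show ?thesis using \<delta>_le[OF w(1,2), of r] t(1) theta by simp
    qed
    have low: "\<theta> ^ t * \<theta> \<le> \<delta> \<omega> \<omega>'" using \<delta>_ge[OF w(1,2) t(2)] by (simp add: mult.commute)
    have dl: "\<theta> ^ t * \<theta> / real n \<le> dist (point \<omega>) (point \<omega>')"
      using dist_ge[OF w(1,2) t(2)] by (simp add: eps_def mult.commute)
    have du: "dist (point \<omega>) (point \<omega>') \<le> diam_const * \<theta> ^ t" by (rule dist_le[OF w(1) t(1)])
    have "\<delta> \<omega> \<omega>' \<le> real n * real n / (\<theta> * \<theta>) * (\<theta> ^ t * \<theta> / real n)"
      using up theta n2 by simp
    also have "\<dots> \<le> C * dist (point \<omega>) (point \<omega>')"
      using C1 dl theta C0 by (intro mult_mono) auto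
    finally have 1: "\<delta> \<omega> \<omega>' \<le> C * dist (point \<omega>) (point \<omega>')" .
    have "dist (point \<omega>) (point \<omega>') \<le> diam_const / \<theta> * (\<theta> ^ t * \<theta>)" using du theta by simp
    also have "\<dots> \<le> C * \<delta> \<omega> \<omega>'" using C2 low theta C0 by (intro mult_mono) auto
    finally have 2: "dist (point \<omega>) (point \<omega>') \<le> C * \<delta> \<omega> \<omega>'" .
    have "0 < \<theta> ^ t * \<theta>" using theta by simp
    then show ?thesis using 1 2 low by linarith
  qed
  have zero: "\<delta> \<omega> \<omega>' = 0" if "f \<omega> = f \<omega>'" for \<omega> \<omega>'
    using that by (simp add: \<delta>_def carpet_seq_dist_def seq_dist_def)
  define code where "code z = (SOME \<omega>. \<omega> \<in> codes \<and> point \<omega> = z)" for z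
  have code: "code z \<in> codes \<and> point (code z) = z" if "z \<in> point ` codes" for z
    using someI_ex[of "\<lambda>\<omega>. \<omega> \<in> codes \<and> point \<omega> = z"] that by (auto simp: code_def)
  define F where "F z = plain (f (code z))" for z
  have Fim: "F ` point ` codes = digit_sequences digits"
  proof (intro equalityI subsetI)
    fix p assume "p \<in> F ` point ` codes"
    then obtain z where "z \<in> point ` codes" "p = F z" by blast
    then have "f (code z) \<in> codes" "p = plain (f (code z))" using code[of z] fc by (auto simp: F_def)
    then show "p \<in> digit_sequences digits" unfolding digit_sequences_plain[symmetric] by blast
  next
    fix p assume "p \<in> digit_sequences digits"
    then have "p \<in> plain ` f ` codes" unfolding digit_sequences_plain f(1) .
    then obtain \<omega> where w: "\<omega> \<in> codes" "p = plain (f \<omega>)" by blast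
    have "point \<omega> \<in> point ` codes" using w by blast
    with code[OF this] have "f (code (point \<omega>)) = f \<omega>" using \<delta>_same[of "code (point \<omega>)" \<omega>] w by blast
    then have "p = F (point \<omega>)" using w(2) by (simp only: F_def)
    then show "p \<in> F ` point ` codes" using w by blast
  qed
  have Finj: "inj_on F (point ` codes)"
  proof (rule inj_onI, rule ccontr)
    fix z z' assume z: "z \<in> point ` codes" "z' \<in> point ` codes" "F z = F z'" "z \<noteq> z'"
    have "0 < \<delta> (code z) (code z')" using compare[of "code z" "code z'"] code z by auto
    then show False using z(3) by (simp add: \<delta>_def F_def carpet_seq_dist_def seq_dist_def)
  qed
  have "inverse C * dist z z' \<le> carpet_seq_dist n m (F z) (F z') \<and> carpet_seq_dist n m (F z) (F z') \<le> C * dist z z'"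
    if z: "z \<in> point ` codes" "z' \<in> point ` codes" for z z'
  proof (cases "z = z'")
    case True
    then show ?thesis using zero[of "code z" "code z"] by (simp add: \<delta>_def F_def)
  next
    case False
    then have "\<delta> (code z) (code z') \<le> C * dist z z'" "dist z z' \<le> C * \<delta> (code z) (code z')"
      using compare[of "code z" "code z'"] code z by auto
    then show ?thesis using C0 by (simp add: \<delta>_def F_def field_simps)
  qed
  moreover have "bij_betw F (point ` codes) (digit_sequences digits)" using Fim Finj by (simp add: bij_betw_def)
  moreover have "Metric_space (point ` codes) dist"
    by unfold_locales (auto simp: dist_commute dist_triangle)
  moreover have "Metric_space (digit_sequences digits) (carpet_seq_dist n m)"
    by (rule carpet_seq_dist_Metric_space[OF m2 n2])
  ultimately show ?thesis using C0 unfolding lipschitz_equivalent_def by blast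
qed

end

lemma ex_gapped:
  assumes A: "A \<subseteq> {..<n}" and v: "v < n" "v \<notin> A"
  shows "\<exists>e h. gapped n (card A) e h \<and> e ` {..<card A} = A"
proof -
  have fin: "finite A" using A finite_subset by blast
  define e where "e r = sorted_list_of_set A ! r" for r
  have len: "length (sorted_list_of_set A) = card A" by simp
  have mono: "e r < e r'" if "r < r'" "r' < card A" for r r'
    using sorted_wrt_nth_less[OF strict_sorted_list_of_set[of A] that(1)] that(2) by (simp add: e_def)
  have im: "e ` {..<card A} = A"
    using set_sorted_list_of_set[OF fin] len unfolding set_conv_nth e_def by auto
  define R where "R = {r. r < card A \<and> e r < v}"
  have R: "finite R" "R \<subseteq> {..<card A}" by (auto simp: R_def)
  have down: "r \<in> R" if "r' \<in> R" "r \<le> r'" for r r'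
    using that mono[of r r'] by (cases "r = r'") (auto simp: R_def)
  have "e r < v \<longleftrightarrow> r < card R" if r: "r < card A" for r
  proof
    assume "e r < v"
    then have "{..r} \<subseteq> R" using down[of r] r by (auto simp: R_def)
    then have "card {..r} \<le> card R" by (rule card_mono[OF R(1)])
    then show "r < card R" by simp
  next
    assume "r < card R"
    show "e r < v"
    proof (rule ccontr)
      assume "\<not> e r < v"
      then have "R \<subseteq> {..<r}" using down[of _ r] by (force simp: R_def not_le[symmetric])
      then have "card R \<le> card {..<r}" by (intro card_mono) auto
      then show False using \<open>r < card R\<close> by simp
    qed
  qed
  moreover have "e r \<noteq> v" "e r < n" if "r < card A" for r using im A v that by auto
  moreover have "card R \<le> card A" using card_mono[OF _ R(2)] by simp
  ultimately have "gapped n (card A) e (card R)"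
    using v(1) mono unfolding gapped_def strict_mono_on_def by blast
  then show ?thesis using im by blast
qed

text \<open>All conditions hold for large parameters because \<open>a\<close> and \<open>m\<close> are smaller than \<open>n\<close>. The exponent \<open>S\<close> is chosen last.\<close>

lemma ex_scales:
  fixes a n m :: nat
  assumes "2 \<le> m" "m < n" "0 < a" "a < n"
  shows "\<exists>s M S ll. m * a ^ s < n ^ s \<and> (2 * m + 1) * (4 * n ^ s + 1) * N * a \<le> 2 ^ M \<and>
     M + 2 \<le> S \<and> n ^ (M + 3) \<le> m ^ S \<and> n * m ^ S < n ^ S \<and>
     (\<forall>t. n ^ ll t \<le> m ^ (S * t) \<and> m ^ (S * t) < n ^ Suc (ll t))"
proof -
  have arch: "\<exists>s. k * b ^ s < n ^ s" if "0 < b" "b < n" for k b :: nat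
  proof -
    have "1 < real n / real b" using that by simp
    then obtain s where "real k < (real n / real b) ^ s" using real_arch_pow by blast
    then have "real k * real b ^ s < real n ^ s" using that by (simp add: power_divide field_simps)
    then have "real (k * b ^ s) < real (n ^ s)" by simp
    then show ?thesis unfolding of_nat_less_iff by blast
  qed
  obtain s where s: "m * a ^ s < n ^ s" using arch assms by blast
  define M where "M = (2 * m + 1) * (4 * n ^ s + 1) * N * a"
  have "M \<le> 2 ^ M" using less_exp[of M] by simp
  then have M: "(2 * m + 1) * (4 * n ^ s + 1) * N * a \<le> 2 ^ M" by (simp only: M_def[symmetric])
  obtain S1 where S1: "n * m ^ S1 < n ^ S1" using arch[of m n] assms by auto
  define S where "S = S1 + n * (M + 3)"
  have "M + 3 \<le> n * (M + 3)" using assms by simp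
  then have "M + 2 \<le> S" unfolding S_def by linarith
  moreover have "n ^ (M + 3) \<le> m ^ S"
  proof -
    have "n \<le> 2 ^ n" using less_exp[of n] by simp
    also have "\<dots> \<le> m ^ n" using assms by (intro power_mono) auto
    finally have "n ^ (M + 3) \<le> (m ^ n) ^ (M + 3)" by (intro power_mono) auto
    also have "\<dots> = m ^ (n * (M + 3))" by (simp only: power_mult)
    also have "\<dots> \<le> m ^ S" using assms by (intro power_increasing) (auto simp: S_def)
    finally show ?thesis .
  qed
  moreover have "n * m ^ S < n ^ S"
  proof -
    have "n * m ^ S = n * m ^ S1 * m ^ (n * (M + 3))" by (simp add: S_def power_add)
    also have "\<dots> \<le> n * m ^ S1 * n ^ (n * (M + 3))" using assms by (intro mult_le_mono power_mono) auto
    also have "\<dots> < n ^ S1 * n ^ (n * (M + 3))" using S1 assms by (intro mult_strict_right_mono) auto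
    also have "\<dots> = n ^ S" by (simp add: S_def power_add)
    finally show ?thesis .
  qed
  moreover have "\<exists>ll. \<forall>t. n ^ ll t \<le> m ^ (S * t) \<and> m ^ (S * t) < n ^ Suc (ll t)"
  proof (intro choice allI)
    fix t
    have "\<exists>k. n ^ k \<le> m ^ (S * t) \<and> m ^ (S * t) < n ^ (k + 1)"
      using assms by (intro ex_power_ivl1) auto
    then show "\<exists>k. n ^ k \<le> m ^ (S * t) \<and> m ^ (S * t) < n ^ Suc k" by simp
  qed
  ultimately show ?thesis using s M by blast
qed

theorem theorem1p3:
  fixes n m :: nat and D :: "(nat \<times> nat) set" and E :: "(real \<times> real) set"
  assumes "2 \<le> m" and "m < n"
    and "E = carpet n m D" and "carpet_tvr n m D"
  shows "lipschitz_equivalent E dist (digit_sequences D) (carpet_seq_dist n m)"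
proof -
  have n2: "2 \<le> n" using assms by simp
  have dig: "digit_set n m D" and td: "totally_disconnected E" and vac: "has_vacant_row m D"
    and unif: "uniform_horizontal_fibers m D"
    using assms(3,4) by (auto simp: carpet_tvr_def)
  have sub: "D \<subseteq> {0..<n} \<times> {0..<m}" and card: "1 < card D" using dig by (auto simp: digit_set_def)
  have E: "is_carpet n m D E" using carpet_is_carpet[OF n2 assms(1) dig] assms(3) by simp
  define H where "H = snd ` D"
  define A where "A j = {i. (i, j) \<in> D}" for j
  have rc: "row_count D j = card (A j)" for j by (simp add: row_count_def A_def)
  have Hm: "H \<subseteq> {..<m}" using sub by (auto simp: H_def)
  have An: "A j \<subseteq> {..<n}" for j using sub by (auto simp: A_def)
  have Afin: "finite (A j)" for j using An finite_subset by blast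
  have Ane: "card (A j) \<noteq> 0" if "j \<in> H" for j using that Afin by (auto simp: H_def A_def)
  have "D \<noteq> {}" using card by auto
  then obtain j0 where j0: "j0 \<in> H" by (auto simp: H_def)
  define a where "a = card (A j0)"
  have Aa: "card (A j) = a" if "j \<in> H" for j
    using unif that j0 Hm Ane unfolding uniform_horizontal_fibers_def rc a_def by blast
  have a0: "0 < a" using Ane[OF j0] by (simp add: a_def)
  have less_n: "\<exists>v<n. v \<notin> A j" for j
    using totally_disconnected_no_full_row[OF n2 assms(1) sub E td, of j] by (auto simp: A_def)
  have an: "a < n"
  proof -
    have "A j0 \<subset> {..<n}" using An less_n[of j0] by auto
    then have "card (A j0) < card {..<n}" by (intro psubset_card_mono) auto
    then show ?thesis by (simp add: a_def)
  qed
  obtain v where v: "v < m" "v \<notin> H"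
  proof -
    obtain j where "j < m" "card (A j) = 0" using vac unfolding has_vacant_row_def rc by blast
    then show thesis using that Ane by blast
  qed
  define N where "N = card H"
  have Hfin: "finite H" using Hm finite_subset by blast
  have N0: "0 < N" using j0 Hfin by (auto simp: N_def card_gt_0_iff)
  obtain eH hH where rows: "gapped m N eH hH" "eH ` {..<N} = H"
    using ex_gapped[OF Hm v] by (auto simp: N_def)
  have "\<forall>j\<in>H. \<exists>e h. gapped n a e h \<and> e ` {..<a} = A j"
    using ex_gapped[OF An] less_n Aa by metis
  then obtain eD hD where cols: "\<And>j. j \<in> H \<Longrightarrow> gapped n a (eD j) (hD j)" "\<And>j. j \<in> H \<Longrightarrow> eD j ` {..<a} = A j"
    by metis
  have eHin: "eH r \<in> H" if "r < N" for r using rows(2) that by blast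
  have two: "1 < N \<or> 1 < a"
  proof (rule ccontr)
    assume "\<not> (1 < N \<or> 1 < a)"
    then have "card H = 1" "\<And>j. j \<in> H \<Longrightarrow> card (A j) = 1" using N0 a0 Aa by (auto simp: N_def)
    then obtain j i where ij: "H = {j}" "A j = {i}" by (metis card_1_singletonE insertI1)
    have "D \<subseteq> {(i, j)}"
    proof
      fix d assume d: "d \<in> D"
      then have "snd d = j" using ij(1) unfolding H_def by blast
      moreover from this have "fst d \<in> A j" using d by (auto simp: A_def)
      ultimately show "d \<in> {(i, j)}" using ij(2) by (simp add: prod_eq_iff)
    qed
    then have "card D \<le> card {(i, j)}" by (intro card_mono) auto
    then show False using card by simp
  qed
  obtain s M S ll where scales: "m * a ^ s < n ^ s" "(2 * m + 1) * (4 * n ^ s + 1) * N * a \<le> 2 ^ M"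
      "M + 2 \<le> S" "n ^ (M + 3) \<le> m ^ S" "n * m ^ S < n ^ S"
      "\<And>t. n ^ ll t \<le> m ^ (S * t)" "\<And>t. m ^ (S * t) < n ^ Suc (ll t)"
    using ex_scales[OF assms(1,2) a0 an, of N] by blast
  interpret carpet_scales n m a N eH hH eD hD s M S ll
    by unfold_locales (use assms(1,2) a0 an N0 two rows(1) cols(1) eHin scales in auto)
  have "digits = D"
  proof (intro equalityI subsetI)
    fix d assume "d \<in> digits"
    then obtain q r where "d = (eD (eH r) q, eH r)" "q < a" "r < N" by (auto simp: digits_def)
    then show "d \<in> D" using cols(2)[OF eHin] by (auto simp: A_def)
  next
    fix d assume d: "d \<in> D"
    then have "snd d \<in> H" by (simp add: H_def)
    then obtain r where r: "r < N" "snd d = eH r" using rows(2) by auto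
    have "fst d \<in> eD (eH r) ` {..<a}" using cols(2)[OF eHin[OF r(1)]] d unfolding r(2)[symmetric] by (simp add: A_def)
    then show "d \<in> digits" using r unfolding digits_def by (cases d) auto
  qed
  then have "point ` codes = E"
    using point_image carpet_eq_carpet_point[OF n2 assms(1) sub E] by simp
  then show ?thesis using lipschitz_equivalent_points \<open>digits = D\<close> by simp
qed

end
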